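(* Let $\mathcal{D}$ be a separable Hilbert space and let $B \in \mathcal{S}(\mathcal{D}, \mathbb{C})$ be such that $\log (1- BB^* ) \in L^1(\mathbb{T})$. Then any proper closed $L$-invariant subspace of $\mathcal{H}(B)$ is of the form $$\mathcal{H}(B) \cap K_\theta,$$ where $\theta$ is an inner function and $K_\theta = H^2 \ominus \theta H^2$.
   Context: $\mathbb{D}$ is the open unit disc and $\mathbb{T}$ the unit circle. For separable Hilbert spaces $\mathcal{D},\mathcal{E}$, $H^2(\mathcal{D})$ is the Hardy space of power series on $\mathbb{D}$ with square summable coefficients in $\mathcal{D}$, $H^2=H^2(\mathbb{C})$, and $\mathcal{S}(\mathcal{D},\mathcal{E})$ is the Schur class: analytic functions on $\mathbb{D}$ whose values are contractive operators from $\mathcal{D}$ to $\mathcal{E}$. For $B\in\mathcal{S}(\mathcal{D},\mathbb{C})$, $T_B:H^2(\mathcal{D})\to H^2$ is multiplication by $B$, and on $\mathbb{T}$, $B(z)$ denotes the boundary values, so that $BB^*$ is the scalar function $z\mapsto B(z)B(z)^*$ defined a.e. on $\mathbb{T}$. For a bounded operator $A$, $\mathcal{M}(A)$ is the range of $A$ with the Hilbert space norm making $A$ a coisometry onto $\mathcal{M}(A)$ (i.e. $\|Ax\|_{\mathcal{M}(A)}=\|x\|$ for $x\perp\ker A$). The de Branges-Rovnyak space is $\mathcal{H}(B)=\mathcal{M}((I-T_BT_B^* )^{1/2})$; it is contractively contained in $H^2$ and has reproducing kernel $K^B_w(z)=\frac{1-B(z)B(w)^*}{1-z\overline{w}}$.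 $L$ is the backward shift $Lf(z)=\frac{f(z)-f(0)}{z}$, which acts contractively on $\mathcal{H}(B)$. Inner functions may be unimodular constants. *)

theory Defs
  imports "HOL-Analysis.Analysis"
begin

section \<open>Complex Hilbert spaces and their operators\<close>

text \<open>The inner product is linear in its first argument.\<close>

class complex_hilbert = banach +
  fixes scaleC :: "complex \<Rightarrow> 'a \<Rightarrow> 'a" (infixr "*\<^sub>C" 75)
    and cinner :: "'a \<Rightarrow> 'a \<Rightarrow> complex"
  assumes scaleC_add_right: "c *\<^sub>C (x + y) = c *\<^sub>C x + c *\<^sub>C y"
    and scaleC_add_left: "(c + d) *\<^sub>C x = c *\<^sub>C x + d *\<^sub>C x"
    and scaleC_scaleC: "c *\<^sub>C d *\<^sub>C x = (c * d) *\<^sub>C x"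
    and scaleC_of_real: "of_real r *\<^sub>C x = r *\<^sub>R x"
    and cinner_commute: "cinner x y = cnj (cinner y x)"
    and cinner_add_left: "cinner (x + y) z = cinner x z + cinner y z"
    and cinner_scaleC_left: "cinner (c *\<^sub>C x) y = c * cinner x y"
    and cinner_self: "cinner x x = of_real ((norm x)\<^sup>2)"

instantiation complex :: complex_hilbert
begin

definition scaleC_complex :: "complex \<Rightarrow> complex \<Rightarrow> complex"
  where "scaleC_complex c x = c * x"

definition cinner_complex :: "complex \<Rightarrow> complex \<Rightarrow> complex"
  where "cinner_complex x y = x * cnj y"

instance
  by standard
    (simp_all add: scaleC_complex_def cinner_complex_def algebra_simps scaleR_conv_of_real
      complex_norm_square del: of_real_power)

end

lemma cinner_add_right: "cinner x (y + z) = cinner x y + cinner x z"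
  by (metis cinner_add_left cinner_commute complex_cnj_add)

lemma cinner_scaleC_right: "cinner x (c *\<^sub>C y) = cnj c * cinner x y"
  by (metis cinner_commute cinner_scaleC_left complex_cnj_mult)

lemma norm_scaleC: "norm (c *\<^sub>C x) = cmod c * norm x"
proof -
  have "cinner (c *\<^sub>C x) (c *\<^sub>C x) = (c * cnj c) * cinner x x"
    unfolding cinner_scaleC_left cinner_scaleC_right by (simp add: mult_ac)
  then have "complex_of_real ((norm (c *\<^sub>C x))\<^sup>2) = of_real ((cmod c)\<^sup>2 * (norm x)\<^sup>2)"
    unfolding cinner_self complex_norm_square[symmetric] of_real_mult .
  then have "(norm (c *\<^sub>C x))\<^sup>2 = (cmod c * norm x)\<^sup>2"
    unfolding of_real_eq_iff power_mult_distrib .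
  then show ?thesis
    by (rule power2_eq_imp_eq) simp_all
qed

lemma Re_cinner_le: "Re (cinner x y) \<le> norm x * norm y"
proof -
  have "(norm (x + y))\<^sup>2 = Re (cinner (x + y) (x + y))"
    by (simp only: cinner_self Re_complex_of_real)
  also have "\<dots> = Re (cinner x x) + Re (cinner y y) + Re (cinner x y) + Re (cinner y x)"
    by (simp add: cinner_add_left cinner_add_right)
  also have "\<dots> = (norm x)\<^sup>2 + (norm y)\<^sup>2 + 2 * Re (cinner x y)"
    using cinner_commute[of y x] by (simp only: cinner_self Re_complex_of_real cnj.simps)
  finally have "(norm x)\<^sup>2 + (norm y)\<^sup>2 + 2 * Re (cinner x y) \<le> (norm x + norm y)\<^sup>2"
    by (metis norm_ge_zero norm_triangle_ineq power_mono)
  then show ?thesis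
    by (simp add: power2_sum)
qed

lemma norm_cinner_le: "cmod (cinner x y) \<le> norm x * norm y"
proof (cases "cinner x y = 0")
  case False
  define c where "c = cnj (sgn (cinner x y))"
  have c: "cmod c = 1"
    using False by (simp add: c_def norm_sgn)
  have "cinner (c *\<^sub>C x) y = (cinner x y * cnj (cinner x y)) / of_real (cmod (cinner x y))"
    by (simp add: c_def cinner_scaleC_left sgn_eq mult.commute)
  also have "\<dots> = of_real (cmod (cinner x y))"
    using False by (simp only: complex_norm_square[symmetric]) (simp add: power2_eq_square)
  finally show ?thesis
    using Re_cinner_le[of "c *\<^sub>C x" y] c by (simp add: norm_scaleC)
qed simp

definition bounded_clinear :: "('a::complex_hilbert \<Rightarrow> 'b::complex_hilbert) \<Rightarrow> bool"
  where "bounded_clinear A \<longleftrightarrow> bounded_linear A \<and> (\<forall>c x. A (c *\<^sub>C x) = c *\<^sub>C A x)"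

definition csubspace :: "'a::complex_hilbert set \<Rightarrow> bool"
  where "csubspace M \<longleftrightarrow>
    0 \<in> M \<and> (\<forall>x\<in>M. \<forall>y\<in>M. x + y \<in> M) \<and> (\<forall>c. \<forall>x\<in>M. c *\<^sub>C x \<in> M)"

definition orth_complement :: "'a::complex_hilbert set \<Rightarrow> 'a set"
  where "orth_complement S = {x. \<forall>y\<in>S. cinner x y = 0}"

definition adjoint_op :: "('a::complex_hilbert \<Rightarrow> 'b::complex_hilbert) \<Rightarrow> 'b \<Rightarrow> 'a"
  where "adjoint_op A = (THE A'. \<forall>x y. cinner (A x) y = cinner x (A' y))"

definition positive_op :: "('a::complex_hilbert \<Rightarrow> 'a) \<Rightarrow> bool"
  where "positive_op A \<longleftrightarrow> bounded_clinear A \<and> (\<forall>x. cinner (A x) x \<in> \<real>\<^sub>\<ge>\<^sub>0)"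

definition sqrt_op :: "('a::complex_hilbert \<Rightarrow> 'a) \<Rightarrow> 'a \<Rightarrow> 'a"
  where "sqrt_op A = (THE R. positive_op R \<and> R \<circ> R = A)"

text \<open>The range of an operator \<open>A\<close>, normed so that \<open>A\<close> is a coisometry onto it: the norm of
  \<open>y\<close> is that of its unique preimage orthogonal to the kernel of \<open>A\<close>.\<close>

definition range_norm :: "('a::complex_hilbert \<Rightarrow> 'b::complex_hilbert) \<Rightarrow> 'b \<Rightarrow> real"
  where "range_norm A y = norm (THE x. A x = y \<and> x \<in> orth_complement {k. A k = 0})"

definition range_topology :: "('a::complex_hilbert \<Rightarrow> 'b::complex_hilbert) \<Rightarrow> 'b topology"
  where "range_topology A = Metric_space.mtopology (range A) (\<lambda>x y. range_norm A (x - y))"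


section \<open>Vector-valued Hardy spaces\<close>

text \<open>A power series is represented by its coefficient sequence; its values on the disc
  are given by \<open>hardy_eval\<close> below.\<close>

typedef (overloaded) 'a hardy =
    "{a :: nat \<Rightarrow> 'a::complex_hilbert. summable (\<lambda>n. (norm (a n))\<^sup>2)}"
  morphisms hardy_coeff Hardy
  by (intro exI[of _ "\<lambda>_. 0"]) simp

setup_lifting type_definition_hardy

lemma summable_hardy: "summable (\<lambda>n. (norm (hardy_coeff f n))\<^sup>2)"
  using hardy_coeff[of f] by simp

lemma norm_add_sq_le: "(norm (x + y))\<^sup>2 \<le> 2 * (norm x)\<^sup>2 + 2 * (norm y)\<^sup>2"
  for x y :: "'a::real_normed_vector"
proof -
  have "(norm (x + y))\<^sup>2 \<le> (norm x + norm y)\<^sup>2"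
    by (simp add: norm_triangle_ineq power_mono)
  also have "\<dots> \<le> 2 * (norm x)\<^sup>2 + 2 * (norm y)\<^sup>2"
    using zero_le_power2[of "norm x - norm y"] by (simp add: power2_eq_square algebra_simps)
  finally show ?thesis .
qed

lemma summable_sq_add:
  fixes a b :: "nat \<Rightarrow> 'a::real_normed_vector"
  assumes "summable (\<lambda>n. (norm (a n))\<^sup>2)" "summable (\<lambda>n. (norm (b n))\<^sup>2)"
  shows "summable (\<lambda>n. (norm (a n + b n))\<^sup>2)"
  by (rule summable_comparison_test[OF _ summable_add[OF summable_mult[OF assms(1), of 2]
          summable_mult[OF assms(2), of 2]]])
    (auto simp: norm_add_sq_le)

lemma summable_sq_scaleC:
  assumes "summable (\<lambda>n. (norm (a n))\<^sup>2)"
  shows "summable (\<lambda>n. (norm (c *\<^sub>C a n))\<^sup>2)"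
  unfolding norm_scaleC power_mult_distrib by (rule summable_mult[OF assms])

lemma summable_sq_scaleR:
  fixes a :: "nat \<Rightarrow> 'a::real_normed_vector"
  assumes "summable (\<lambda>n. (norm (a n))\<^sup>2)"
  shows "summable (\<lambda>n. (norm (r *\<^sub>R a n))\<^sup>2)"
  unfolding norm_scaleR power_mult_distrib by (rule summable_mult[OF assms])

lemma summable_cinner:
  fixes a b :: "nat \<Rightarrow> 'a::complex_hilbert"
  assumes "summable (\<lambda>n. (norm (a n))\<^sup>2)" "summable (\<lambda>n. (norm (b n))\<^sup>2)"
  shows "summable (\<lambda>n. cinner (a n) (b n))"
proof (rule summable_comparison_test[OF _ summable_add[OF assms]])
  have "norm (cinner (a n) (b n)) \<le> (norm (a n))\<^sup>2 + (norm (b n))\<^sup>2" for n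
  proof -
    have "2 * (norm (a n) * norm (b n)) \<le> (norm (a n))\<^sup>2 + (norm (b n))\<^sup>2"
      using zero_le_power2[of "norm (a n) - norm (b n)"]
      by (simp add: power2_eq_square algebra_simps)
    moreover have "0 \<le> norm (a n) * norm (b n)"
      by simp
    ultimately show ?thesis
      using norm_cinner_le[of "a n" "b n"] by linarith
  qed
  then show "\<exists>N. \<forall>n\<ge>N. norm (cinner (a n) (b n)) \<le> (norm (a n))\<^sup>2 + (norm (b n))\<^sup>2"
    by blast
qed

instantiation hardy :: (complex_hilbert) real_normed_vector
begin

lift_definition zero_hardy :: "'a hardy" is "\<lambda>_. 0"
  by simp

lift_definition plus_hardy :: "'a hardy \<Rightarrow> 'a hardy \<Rightarrow> 'a hardy" is "\<lambda>a b n. a n + b n"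
  by (rule summable_sq_add)

lift_definition uminus_hardy :: "'a hardy \<Rightarrow> 'a hardy" is "\<lambda>a n. - a n"
  by simp

definition minus_hardy :: "'a hardy \<Rightarrow> 'a hardy \<Rightarrow> 'a hardy"
  where "minus_hardy f g = f + - g"

lift_definition scaleR_hardy :: "real \<Rightarrow> 'a hardy \<Rightarrow> 'a hardy" is "\<lambda>r a n. r *\<^sub>R a n"
  by (rule summable_sq_scaleR)

lift_definition norm_hardy :: "'a hardy \<Rightarrow> real" is "\<lambda>a. sqrt (\<Sum>n. (norm (a n))\<^sup>2)" .

definition sgn_hardy :: "'a hardy \<Rightarrow> 'a hardy"
  where "sgn_hardy f = inverse (norm f) *\<^sub>R f"

definition dist_hardy :: "'a hardy \<Rightarrow> 'a hardy \<Rightarrow> real"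
  where "dist_hardy f g = norm (f - g)"

definition uniformity_hardy :: "('a hardy \<times> 'a hardy) filter"
  where "uniformity_hardy = (INF e\<in>{0 <..}. principal {(x, y). dist x y < e})"

definition open_hardy :: "'a hardy set \<Rightarrow> bool"
  where "open_hardy S \<longleftrightarrow> (\<forall>x\<in>S. \<forall>\<^sub>F (x', y) in uniformity. x' = x \<longrightarrow> y \<in> S)"

lemma hardy_coeff_simps:
  "hardy_coeff (0 :: 'a hardy) n = 0"
  "hardy_coeff (f + g) n = hardy_coeff f n + hardy_coeff g n"
  "hardy_coeff (- f) n = - hardy_coeff f n"
  "hardy_coeff (f - g) n = hardy_coeff f n - hardy_coeff g n"
  "hardy_coeff (r *\<^sub>R f) n = r *\<^sub>R hardy_coeff f n"
  by (simp_all add: minus_hardy_def zero_hardy.rep_eq plus_hardy.rep_eq uminus_hardy.rep_eq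
      scaleR_hardy.rep_eq)

lemma hardy_eqI: "(\<And>n. hardy_coeff f n = hardy_coeff g n) \<Longrightarrow> f = g"
  by (metis ext hardy_coeff_inject)

lemma norm_hardy_sq: "(norm f)\<^sup>2 = (\<Sum>n. (norm (hardy_coeff f n))\<^sup>2)" for f :: "'a hardy"
  by (simp add: norm_hardy.rep_eq suminf_nonneg summable_hardy)

lemma norm_hardy_nonneg: "0 \<le> norm f" for f :: "'a hardy"
  by (simp add: norm_hardy.rep_eq suminf_nonneg summable_hardy)

lemma L2_set_hardy_le: "L2_set (\<lambda>n. norm (hardy_coeff f n)) {..<N} \<le> norm f"
  for f :: "'a hardy"
  unfolding L2_set_def norm_hardy.rep_eq
  by (intro real_sqrt_le_mono sum_le_suminf summable_hardy) auto

lemma norm_coeff_le: "norm (hardy_coeff f n) \<le> norm f" for f :: "'a hardy"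
  using L2_set_hardy_le[of f "Suc n"]
    member_le_L2_set[of "{..<Suc n}" n "\<lambda>n. norm (hardy_coeff f n)"]
  by simp

lemma norm_hardy_leI:
  fixes f :: "'a hardy"
  assumes "\<And>N. L2_set (\<lambda>n. norm (hardy_coeff f n)) {..<N} \<le> C"
  shows "norm f \<le> C"
proof -
  have C: "0 \<le> C"
    using assms[of 0] by simp
  have "(\<Sum>n<N. (norm (hardy_coeff f n))\<^sup>2) \<le> C\<^sup>2" for N
    using assms[of N] C unfolding L2_set_def by (simp add: real_sqrt_le_iff sqrt_le_D)
  then have "(norm f)\<^sup>2 \<le> C\<^sup>2"
    unfolding norm_hardy_sq by (intro suminf_le_const summable_hardy)
  then show ?thesis
    using C power2_le_imp_le by blast
qed

instance
proof
  fix f g h :: "'a hardy" and r s :: real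
  show "f + g + h = f + (g + h)" "f + g = g + f" "0 + f = f" "- f + f = 0" "f - g = f + - g"
    "r *\<^sub>R (f + g) = r *\<^sub>R f + r *\<^sub>R g" "(r + s) *\<^sub>R f = r *\<^sub>R f + s *\<^sub>R f"
    "r *\<^sub>R s *\<^sub>R f = (r * s) *\<^sub>R f" "1 *\<^sub>R f = f"
    by (auto intro!: hardy_eqI simp: hardy_coeff_simps algebra_simps)
  show "sgn f = inverse (norm f) *\<^sub>R f" "dist f g = norm (f - g)"
    by (simp_all add: sgn_hardy_def dist_hardy_def)
  show "(uniformity :: ('a hardy \<times> 'a hardy) filter)
      = (INF e\<in>{0 <..}. principal {(x, y). dist x y < e})"
    by (rule uniformity_hardy_def)
  show "open S = (\<forall>x\<in>S. \<forall>\<^sub>F (x', y) in uniformity. x' = x \<longrightarrow> y \<in> S)" for S :: "'a hardy set"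
    by (rule open_hardy_def)
  show "(norm f = 0) = (f = 0)"
  proof
    assume "norm f = 0"
    then have "hardy_coeff f n = 0" for n
      using norm_coeff_le[of f n] by simp
    then show "f = 0"
      by (intro hardy_eqI) (simp add: hardy_coeff_simps)
  qed (simp add: norm_hardy.rep_eq hardy_coeff_simps)
  show "norm (f + g) \<le> norm f + norm g"
  proof (rule norm_hardy_leI)
    fix N
    have "L2_set (\<lambda>n. norm (hardy_coeff (f + g) n)) {..<N}
        \<le> L2_set (\<lambda>n. norm (hardy_coeff f n) + norm (hardy_coeff g n)) {..<N}"
      by (intro L2_set_mono) (auto simp: hardy_coeff_simps norm_triangle_ineq)
    also have "\<dots> \<le> L2_set (\<lambda>n. norm (hardy_coeff f n)) {..<N}
        + L2_set (\<lambda>n. norm (hardy_coeff g n)) {..<N}"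
      by (rule L2_set_triangle_ineq)
    also have "\<dots> \<le> norm f + norm g"
      by (intro add_mono L2_set_hardy_le)
    finally show "L2_set (\<lambda>n. norm (hardy_coeff (f + g) n)) {..<N} \<le> norm f + norm g" .
  qed
  show "norm (r *\<^sub>R f) = \<bar>r\<bar> * norm f"
    by (simp add: norm_hardy.rep_eq hardy_coeff_simps power_mult_distrib
        suminf_mult summable_hardy real_sqrt_mult)
qed

end

instantiation hardy :: (complex_hilbert) complex_hilbert
begin

lift_definition scaleC_hardy :: "complex \<Rightarrow> 'a hardy \<Rightarrow> 'a hardy" is "\<lambda>c a n. c *\<^sub>C a n"
  by (rule summable_sq_scaleC)

lift_definition cinner_hardy :: "'a hardy \<Rightarrow> 'a hardy \<Rightarrow> complex"
  is "\<lambda>a b. \<Sum>n. cinner (a n) (b n)" .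

lemma hardy_coeff_scaleC: "hardy_coeff (c *\<^sub>C f) n = c *\<^sub>C hardy_coeff f n" for f :: "'a hardy"
  by transfer simp

instance
proof
  fix X :: "nat \<Rightarrow> 'a hardy"
  assume X: "Cauchy X"
  have coeff_le: "norm (hardy_coeff (X m) n - hardy_coeff (X k) n) \<le> norm (X m - X k)" for m k n
    using norm_coeff_le[of "X m - X k" n] by (simp add: hardy_coeff_simps)
  have "Cauchy (\<lambda>m. hardy_coeff (X m) n)" for n
    using X coeff_le unfolding Cauchy_iff by (meson le_less_trans)
  then have "\<exists>l. (\<lambda>m. hardy_coeff (X m) n) \<longlonglongrightarrow> l" for n
    by (simp add: Cauchy_convergent convergentD)
  then obtain a where a: "\<And>n. (\<lambda>m. hardy_coeff (X m) n) \<longlonglongrightarrow> a n"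
    by metis
  have tail: "\<exists>N. \<forall>m\<ge>N. \<forall>K. L2_set (\<lambda>n. norm (hardy_coeff (X m) n - a n)) {..<K} \<le> e"
    if e: "e > 0" for e
  proof -
    obtain N where N: "\<And>m k. m \<ge> N \<Longrightarrow> k \<ge> N \<Longrightarrow> norm (X m - X k) < e"
      using X e unfolding Cauchy_iff by blast
    have "L2_set (\<lambda>n. norm (hardy_coeff (X m) n - a n)) {..<K} \<le> e" if "m \<ge> N" for m K
    proof (rule tendsto_upperbound)
      show "(\<lambda>k. L2_set (\<lambda>n. norm (hardy_coeff (X m) n - hardy_coeff (X k) n)) {..<K})
          \<longlonglongrightarrow> L2_set (\<lambda>n. norm (hardy_coeff (X m) n - a n)) {..<K}"
        unfolding L2_set_def by (intro tendsto_intros a)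
      show "\<forall>\<^sub>F k in sequentially.
          L2_set (\<lambda>n. norm (hardy_coeff (X m) n - hardy_coeff (X k) n)) {..<K} \<le> e"
        unfolding eventually_sequentially
      proof (intro exI allI impI)
        fix k assume "k \<ge> N"
        then have "norm (X m - X k) < e"
          using N \<open>m \<ge> N\<close> by blast
        then show "L2_set (\<lambda>n. norm (hardy_coeff (X m) n - hardy_coeff (X k) n)) {..<K} \<le> e"
          using L2_set_hardy_le[of "X m - X k" K] by (simp add: hardy_coeff_simps)
      qed
    qed simp
    then show ?thesis
      by blast
  qed
  obtain m where m: "\<And>K. L2_set (\<lambda>n. norm (hardy_coeff (X m) n - a n)) {..<K} \<le> 1"
    using tail[of 1] by auto
  have "(\<Sum>n<K. (norm (hardy_coeff (X m) n - a n))\<^sup>2) \<le> 1" for K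
    using m[of K] unfolding L2_set_def by simp
  then have "summable (\<lambda>n. (norm (a n - hardy_coeff (X m) n))\<^sup>2)"
    by (intro bounded_imp_summable[where B = 1])
      (auto simp: norm_minus_commute lessThan_Suc_atMost[symmetric] simp del: sum.lessThan_Suc)
  from summable_sq_add[OF this summable_hardy[of "X m"]]
  have "summable (\<lambda>n. (norm (a n))\<^sup>2)"
    by simp
  then have coeff_a: "hardy_coeff (Hardy a) n = a n" for n
    by (simp add: Hardy_inverse)
  have "X \<longlonglongrightarrow> Hardy a"
  proof (rule LIMSEQ_I)
    fix e :: real
    assume "e > 0"
    then obtain N
      where N: "\<And>m K. m \<ge> N \<Longrightarrow> L2_set (\<lambda>n. norm (hardy_coeff (X m) n - a n)) {..<K} \<le> e / 2"
      using tail[of "e / 2"] by auto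
    have "norm (X m - Hardy a) \<le> e / 2" if "m \<ge> N" for m
      using N[OF that] by (intro norm_hardy_leI) (simp add: hardy_coeff_simps coeff_a)
    then show "\<exists>N. \<forall>m\<ge>N. norm (X m - Hardy a) < e"
    proof (intro exI allI impI)
      fix m assume "m \<ge> N"
      then show "norm (X m - Hardy a) < e"
        using \<open>\<And>m. m \<ge> N \<Longrightarrow> norm (X m - Hardy a) \<le> e / 2\<close>[of m] \<open>e > 0\<close> by linarith
    qed
  qed
  then show "convergent X"
    by (rule convergentI)
next
  fix f g h :: "'a hardy" and r :: real and c d :: complex
  show "c *\<^sub>C (f + g) = c *\<^sub>C f + c *\<^sub>C g" "(c + d) *\<^sub>C f = c *\<^sub>C f + d *\<^sub>C f"
    "c *\<^sub>C d *\<^sub>C f = (c * d) *\<^sub>C f" "of_real r *\<^sub>C f = r *\<^sub>R f"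
    by (auto intro!: hardy_eqI
        simp: hardy_coeff_simps hardy_coeff_scaleC scaleC_add_right scaleC_add_left
        scaleC_scaleC scaleC_of_real)
  show "cinner f g = cnj (cinner g f)"
  proof -
    have "(\<lambda>n. cinner (hardy_coeff g n) (hardy_coeff f n)) sums cinner g f"
      unfolding cinner_hardy.rep_eq
      by (intro summable_sums summable_cinner summable_hardy)
    then have "(\<lambda>n. cinner (hardy_coeff f n) (hardy_coeff g n)) sums cnj (cinner g f)"
      by (subst cinner_commute) (simp add: sums_cnj)
    then show ?thesis
      unfolding cinner_hardy.rep_eq by (simp add: sums_iff)
  qed
  show "cinner (f + g) h = cinner f h + cinner g h"
    by (simp add: cinner_hardy.rep_eq hardy_coeff_simps cinner_add_left suminf_add
        summable_cinner summable_hardy)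
  show "cinner (c *\<^sub>C f) g = c * cinner f g"
    by (simp add: cinner_hardy.rep_eq hardy_coeff_scaleC cinner_scaleC_left suminf_mult
        summable_cinner summable_hardy)
  show "cinner f f = of_real ((norm f)\<^sup>2)"
    unfolding norm_hardy_sq cinner_hardy.rep_eq cinner_self
    by (rule suminf_of_real[symmetric, OF summable_hardy])
qed

end

text \<open>The value \<open>f(z)\<close>, meaningful for \<open>\<bar>z\<bar> < 1\<close>.\<close>

definition hardy_eval :: "'a::complex_hilbert hardy \<Rightarrow> complex \<Rightarrow> 'a"
  where "hardy_eval f z = (\<Sum>n. z ^ n *\<^sub>C hardy_coeff f n)"

lemma hardy_eval_sums:
  assumes "cmod z < 1"
  shows "(\<lambda>n. z ^ n *\<^sub>C hardy_coeff f n) sums hardy_eval f z"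
  unfolding hardy_eval_def
proof (rule summable_sums, rule summable_comparison_test)
  show "\<exists>N. \<forall>n\<ge>N. norm (z ^ n *\<^sub>C hardy_coeff f n) \<le> cmod z ^ n * norm f"
    by (auto simp: norm_scaleC norm_power intro!: mult_left_mono norm_coeff_le)
  show "summable (\<lambda>n. cmod z ^ n * norm f)"
    using assms by (intro summable_mult2 summable_geometric) simp
qed

text \<open>The backward shift \<open>L\<close>; \<open>hardy_eval_backward_shift\<close> is the formula
  \<open>L f(z) = (f(z) - f(0)) / z\<close>.\<close>

lift_definition backward_shift :: "'a::complex_hilbert hardy \<Rightarrow> 'a hardy"
  is "\<lambda>a n. a (Suc n)"
  by (simp add: summable_Suc_iff[of "\<lambda>n. (norm (_ n))\<^sup>2"])

lemma scaleC_zero_left: "0 *\<^sub>C x = 0"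
  using scaleC_of_real[of 0 x] by simp

lemma scaleC_one: "1 *\<^sub>C x = x"
  using scaleC_of_real[of 1 x] by simp

lemma bounded_linear_scaleC: "bounded_linear (\<lambda>x. c *\<^sub>C x)"
  by (rule bounded_linear_intro[of _ "cmod c"])
    (simp_all add: scaleC_add_right scaleC_of_real[symmetric] scaleC_scaleC norm_scaleC mult.commute)

lemma hardy_eval_0: "hardy_eval f 0 = hardy_coeff f 0"
proof -
  have "(\<lambda>n. 0 ^ n *\<^sub>C hardy_coeff f n) sums (0 ^ 0 *\<^sub>C hardy_coeff f 0)"
    using sums_single[of 0 "\<lambda>n. 0 ^ n *\<^sub>C hardy_coeff f n"]
    by (rule back_subst[where P = "\<lambda>u. u sums _"]) (auto simp: scaleC_zero_left fun_eq_iff zero_power)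
  then show ?thesis
    using hardy_eval_sums[of 0 f] by (simp add: scaleC_one sums_unique2)
qed

lemma hardy_eval_backward_shift:
  assumes "cmod z < 1" "z \<noteq> 0"
  shows "hardy_eval (backward_shift f) z = inverse z *\<^sub>C (hardy_eval f z - hardy_eval f 0)"
proof -
  have "(\<lambda>n. z ^ Suc n *\<^sub>C hardy_coeff f (Suc n)) sums (hardy_eval f z - hardy_eval f 0)"
    using hardy_eval_sums[OF assms(1), of f]
    by (subst sums_Suc_iff) (simp add: hardy_eval_0 scaleC_one)
  then have "(\<lambda>n. inverse z *\<^sub>C z ^ Suc n *\<^sub>C hardy_coeff f (Suc n))
      sums (inverse z *\<^sub>C (hardy_eval f z - hardy_eval f 0))"
    by (rule bounded_linear.sums[OF bounded_linear_scaleC])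
  then have "(\<lambda>n. z ^ n *\<^sub>C hardy_coeff (backward_shift f) n)
      sums (inverse z *\<^sub>C (hardy_eval f z - hardy_eval f 0))"
    using assms(2) by (simp add: scaleC_scaleC backward_shift.rep_eq field_simps)
  then show ?thesis
    using hardy_eval_sums[OF assms(1)] sums_unique2 by blast
qed


section \<open>Schur functions and de Branges--Rovnyak spaces\<close>

text \<open>Only the values of \<open>B\<close> on the open disc matter. Analyticity is complex
  differentiability with respect to the operator norm.\<close>

definition schur_class :: "(complex \<Rightarrow> 'd::complex_hilbert \<Rightarrow> 'e::complex_hilbert) set"
  where "schur_class = {B. \<forall>z\<in>ball 0 1.
      bounded_clinear (B z) \<and> (\<forall>x. norm (B z x) \<le> norm x) \<and>
      (\<exists>D. bounded_clinear D \<and>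
        ((\<lambda>h. onorm (\<lambda>x. inverse h *\<^sub>C (B (z + h) x - B z x) - D x)) \<longlongrightarrow> 0) (at 0))}"

definition mult_op ::
    "(complex \<Rightarrow> 'd::complex_hilbert \<Rightarrow> 'e::complex_hilbert) \<Rightarrow> 'd hardy \<Rightarrow> 'e hardy"
  where "mult_op B f =
    (THE g. \<forall>z\<in>ball 0 1. hardy_eval g z = B z (hardy_eval f z))"

definition dBR_op ::
    "(complex \<Rightarrow> 'd::complex_hilbert \<Rightarrow> 'e::complex_hilbert) \<Rightarrow> 'e hardy \<Rightarrow> 'e hardy"
  where "dBR_op B = sqrt_op (\<lambda>f. f - mult_op B (adjoint_op (mult_op B) f))"

definition dBR_space ::
    "(complex \<Rightarrow> 'd::complex_hilbert \<Rightarrow> 'e::complex_hilbert) \<Rightarrow> 'e hardy set"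
  where "dBR_space B = range (dBR_op B)"

definition dBR_topology ::
    "(complex \<Rightarrow> 'd::complex_hilbert \<Rightarrow> 'e::complex_hilbert) \<Rightarrow> 'e hardy topology"
  where "dBR_topology B = range_topology (dBR_op B)"

text \<open>The boundary value at \<open>\<zeta>\<close> of a Schur function is its radial limit in the strong operator
  topology, which exists for almost every \<open>\<zeta>\<close> on the circle when the spaces are separable.\<close>

definition boundary_value ::
    "(complex \<Rightarrow> 'd::complex_hilbert \<Rightarrow> 'e::complex_hilbert) \<Rightarrow> complex \<Rightarrow> 'd \<Rightarrow> 'e"
  where "boundary_value B \<zeta> x = Lim (at_left 1) (\<lambda>r. B (of_real r * \<zeta>) x)"

text \<open>The scalar \<open>B(\<zeta>) B(\<zeta>)\<^sup>*\<close>, identified with a real number.\<close>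

definition BB_star :: "(complex \<Rightarrow> 'd::complex_hilbert \<Rightarrow> complex) \<Rightarrow> complex \<Rightarrow> real"
  where "BB_star B \<zeta> = Re (boundary_value B \<zeta> (adjoint_op (boundary_value B \<zeta>) 1))"

text \<open>Positivity almost everywhere is a separate conjunct because \<open>ln 0 = 0\<close> here, whereas
  \<open>log 0 = -\<infinity>\<close> is not integrable.\<close>

definition log_integrable_on_circle :: "(complex \<Rightarrow> real) \<Rightarrow> bool"
  where "log_integrable_on_circle u \<longleftrightarrow>
    (AE t in lebesgue_on {0..2*pi}. 0 < u (cis t)) \<and>
    integrable (lebesgue_on {0..2*pi}) (\<lambda>t. ln (u (cis t)))"

definition inner_function :: "(complex \<Rightarrow> complex) \<Rightarrow> bool"
  where "inner_function \<theta> \<longleftrightarrow>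
    \<theta> holomorphic_on ball 0 1 \<and> bounded (\<theta> ` ball 0 1) \<and>
    (AE t in lebesgue_on {0..2*pi}.
      \<exists>w. ((\<lambda>r. \<theta> (of_real r * cis t)) \<longlongrightarrow> w) (at_left 1) \<and> cmod w = 1)"

definition model_space :: "(complex \<Rightarrow> complex) \<Rightarrow> complex hardy set"
  where "model_space \<theta> = orth_complement (range (mult_op (\<lambda>z x. \<theta> z * x)))"

end

theory Submission
  imports Defs "HOL-Complex_Analysis.Complex_Analysis"
begin

text \<open>Write \<open>P = I - T\<^sub>B T\<^sub>B\<^sup>*\<close>, \<open>R = P\<^sup>1\<^sup>/\<^sup>2\<close> and \<open>u = 1 - BB\<^sup>*\<close>. Since \<open>\<parallel>T\<^sub>B\<^sup>* f\<parallel>\<^sup>2 \<le> \<integral> BB\<^sup>* |f|\<^sup>2\<close>,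
  we get \<open>\<parallel>R f\<parallel>\<^sup>2 \<ge> \<integral> u |f|\<^sup>2 \<ge> \<parallel>T\<^sub>a f\<parallel>\<^sup>2\<close>, where \<open>a\<close> is the outer function with \<open>|a|\<^sup>2 = u\<close> on the circle,
  which exists because \<open>log u\<close> is integrable. By duality \<open>T\<^sub>a\<^sup>*\<close> maps \<open>H\<^sup>2\<close> contractively into \<open>\<H>(B)\<close>.

  Let \<open>M\<close> be a closed invariant subspace of \<open>\<H>(B)\<close> and let \<open>f \<in> \<H>(B)\<close> lie in the \<open>H\<^sup>2\<close>-closure \<open>N\<close>
  of \<open>M\<close>. If \<open>f\<^sub>m \<in> M\<close> tends to \<open>f\<close> in \<open>H\<^sup>2\<close> then \<open>T\<^sub>a\<^sup>* f\<^sub>m \<in> M\<close> tends to \<open>T\<^sub>a\<^sup>* f\<close> in \<open>\<H>(B)\<close>, so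
  \<open>T\<^sub>a\<^sup>* f \<in> M\<close>. As \<open>a\<close> is outer, there are bounded analytic \<open>\<phi>\<^sub>n\<close> such that \<open>\<psi>\<^sub>n = \<phi>\<^sub>n a\<close> is bounded by \<open>1\<close>
  and tends to \<open>1\<close>. By von Neumann's inequality for \<open>L\<close> on \<open>\<H>(B)\<close>, the functions
  \<open>T\<^sub>\<psi>\<^sub>n\<^sup>* f = T\<^sub>\<phi>\<^sub>n\<^sup>* T\<^sub>a\<^sup>* f \<in> M\<close> are bounded in \<open>\<H>(B)\<close>, and they tend weakly to \<open>f\<close>; hence \<open>f \<in> M\<close>.
  Thus \<open>M = \<H>(B) \<inter> N\<close>. Since \<open>M\<close> is proper, so is \<open>N\<close>, and Beurling's theorem gives \<open>N = K\<^sub>\<theta>\<close>.\<close>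

section \<open>Operators on complex Hilbert spaces\<close>

lemma scaleC_minus1: "(-1) *\<^sub>C x = - x"
  using scaleC_of_real[of "-1" x] by simp

lemma scaleC_zero_right [simp]: "c *\<^sub>C 0 = 0"
  by (metis norm_eq_zero norm_scaleC mult_zero_right)

lemma scaleC_diff_right: "c *\<^sub>C (x - y) = c *\<^sub>C x - c *\<^sub>C y"
  by (metis add_diff_cancel_right' diff_add_cancel scaleC_add_right)

lemma bounded_linear_scaleC_left: "bounded_linear (\<lambda>c. c *\<^sub>C x)"
  by (rule bounded_linear_intro[of _ "norm x"])
    (auto simp: scaleC_add_left norm_scaleC scaleR_conv_of_real scaleC_scaleC[symmetric] scaleC_of_real)

lemma cinner_zero_left [simp]: "cinner 0 y = 0"
  by (metis cinner_scaleC_left mult_zero_left scaleC_zero_left)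

lemma cinner_zero_right [simp]: "cinner x 0 = 0"
  by (metis cinner_commute cinner_zero_left complex_cnj_zero)

lemma cinner_minus_left: "cinner (- x) y = - cinner x y"
  by (metis cinner_scaleC_left mult_minus1 scaleC_minus1)

lemma cinner_minus_right: "cinner x (- y) = - cinner x y"
  by (metis cinner_commute cinner_minus_left complex_cnj_minus)

lemma cinner_diff_left: "cinner (x - y) z = cinner x z - cinner y z"
  using cinner_add_left[of x "- y" z] by (simp add: cinner_minus_left)

lemma cinner_diff_right: "cinner x (y - z) = cinner x y - cinner x z"
  using cinner_add_right[of x y "- z"] by (simp add: cinner_minus_right)

lemma cinner_scaleR_left: "cinner (r *\<^sub>R x) y = of_real r * cinner x y"
  by (metis cinner_scaleC_left scaleC_of_real)

lemma cinner_scaleR_right: "cinner x (r *\<^sub>R y) = of_real r * cinner x y"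
  by (metis cinner_scaleC_right complex_cnj_complex_of_real scaleC_of_real)

lemma cinner_sum_left: "cinner (\<Sum>i\<in>A. f i) y = (\<Sum>i\<in>A. cinner (f i) y)"
  by (induction A rule: infinite_finite_induct) (auto simp: cinner_add_left)

lemma cinner_sum_right: "cinner y (\<Sum>i\<in>A. f i) = (\<Sum>i\<in>A. cinner y (f i))"
  by (induction A rule: infinite_finite_induct) (auto simp: cinner_add_right)

lemma bounded_linear_cinner_left: "bounded_linear (\<lambda>x. cinner x y)"
  by (rule bounded_linear_intro[of _ "norm y"])
    (auto simp: cinner_add_left cinner_scaleR_left scaleR_conv_of_real norm_cinner_le)

lemma bounded_linear_cinner_right: "bounded_linear (cinner x)"
  by (rule bounded_linear_intro[of _ "norm x"])
    (auto simp: cinner_add_right cinner_scaleR_right scaleR_conv_of_real norm_cinner_le mult.commute[of "norm _" "norm x"])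

lemmas tendsto_cinner_left = bounded_linear.tendsto[OF bounded_linear_cinner_left]
lemmas tendsto_cinner_right = bounded_linear.tendsto[OF bounded_linear_cinner_right]

lemma cinner_self_Re: "(norm x)\<^sup>2 = Re (cinner x x)"
  by (simp add: cinner_self del: of_real_power)

lemma cinner_eq_zero_iff: "cinner x x = 0 \<longleftrightarrow> x = 0"
  by (simp add: cinner_self)

lemma cinner_eqI: "x = y" if "\<And>z. cinner z x = cinner z y"
  using that[of "x - y"] cinner_eq_zero_iff[of "x - y"] by (simp add: cinner_diff_right)

lemma norm_add_sq: "(norm (x + y))\<^sup>2 = (norm x)\<^sup>2 + (norm y)\<^sup>2 + 2 * Re (cinner x y)"
  for x y :: "'a::complex_hilbert"
  using cinner_commute[of y x] by (simp add: cinner_self_Re cinner_add_left cinner_add_right)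

lemma norm_diff_sq: "(norm (x - y))\<^sup>2 = (norm x)\<^sup>2 + (norm y)\<^sup>2 - 2 * Re (cinner x y)"
  for x y :: "'a::complex_hilbert"
  using norm_add_sq[of x "- y"] by (simp add: cinner_minus_right)

lemma csubspace_UNIV: "csubspace UNIV"
  by (simp add: csubspace_def)

lemma csubspace_diff: "csubspace V \<Longrightarrow> x \<in> V \<Longrightarrow> y \<in> V \<Longrightarrow> x - y \<in> V"
  unfolding csubspace_def by (metis diff_conv_add_uminus scaleC_minus1)

lemma csubspace_scaleR: "csubspace V \<Longrightarrow> x \<in> V \<Longrightarrow> r *\<^sub>R x \<in> V"
  unfolding csubspace_def by (metis scaleC_of_real)

lemma csubspace_sum: "csubspace V \<Longrightarrow> (\<And>i. i \<in> A \<Longrightarrow> f i \<in> V) \<Longrightarrow> (\<Sum>i\<in>A. f i) \<in> V"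
  by (induction A rule: infinite_finite_induct) (auto simp: csubspace_def)

lemma csubspace_closure:
  assumes "csubspace V"
  shows "csubspace (closure V)"
  unfolding csubspace_def
proof (intro conjI ballI allI)
  show "0 \<in> closure V"
    using assms closure_subset by (auto simp: csubspace_def)
next
  fix x y assume "x \<in> closure V" "y \<in> closure V"
  then obtain f g where fg: "\<forall>n. f n \<in> V" "f \<longlonglongrightarrow> x" "\<forall>n. g n \<in> V" "g \<longlonglongrightarrow> y"
    by (auto simp: closure_sequential)
  then have "(\<lambda>n. f n + g n) \<longlonglongrightarrow> x + y" "\<forall>n. f n + g n \<in> V"
    using assms by (auto intro: tendsto_add simp: csubspace_def)
  then show "x + y \<in> closure V"
    unfolding closure_sequential by (intro exI[of _ "\<lambda>n. f n + g n"]) simp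
next
  fix c x assume "x \<in> closure V"
  then obtain f where f: "\<forall>n. f n \<in> V" "f \<longlonglongrightarrow> x"
    by (auto simp: closure_sequential)
  then have "(\<lambda>n. c *\<^sub>C f n) \<longlonglongrightarrow> c *\<^sub>C x" "\<forall>n. c *\<^sub>C f n \<in> V"
    using assms bounded_linear.tendsto[OF bounded_linear_scaleC] by (auto simp: csubspace_def)
  then show "c *\<^sub>C x \<in> closure V"
    unfolding closure_sequential by (intro exI[of _ "\<lambda>n. c *\<^sub>C f n"]) simp
qed

text \<open>The representing vector minimises \<open>v \<mapsto> \<parallel>v\<parallel>\<^sup>2 - 2 Re (\<phi> v)\<close>; by the parallelogram law
  minimising sequences are Cauchy.\<close>

lemma riesz_subspace:
  fixes \<phi> :: "'a::complex_hilbert \<Rightarrow> complex"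
  assumes V: "csubspace V"
    and add: "\<And>x y. x \<in> V \<Longrightarrow> y \<in> V \<Longrightarrow> \<phi> (x + y) = \<phi> x + \<phi> y"
    and scale: "\<And>c x. x \<in> V \<Longrightarrow> \<phi> (c *\<^sub>C x) = c * \<phi> x"
    and bound: "\<And>x. x \<in> V \<Longrightarrow> cmod (\<phi> x) \<le> K * norm x" and "0 \<le> K"
  obtains c where "c \<in> closure V" "\<And>v. v \<in> V \<Longrightarrow> \<phi> v = cinner v c" "norm c \<le> K"
proof -
  define J where "J v = (norm v)\<^sup>2 - 2 * Re (\<phi> v)" for v
  define m where "m = Inf (J ` V)"
  have V0: "0 \<in> V"
    using V by (simp add: csubspace_def)
  have J_ge: "- K\<^sup>2 \<le> J v" if "v \<in> V" for v
  proof -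
    have "Re (\<phi> v) \<le> K * norm v"
      using bound[OF that] complex_Re_le_cmod order_trans by blast
    moreover have "0 \<le> (norm v - K)\<^sup>2"
      by simp
    ultimately show ?thesis
      unfolding J_def power2_diff by (simp add: algebra_simps)
  qed
  have bdd: "bdd_below (J ` V)"
    using J_ge by (auto intro!: bdd_belowI[of _ "- K\<^sup>2"])
  have m_le: "m \<le> J v" if "v \<in> V" for v
    unfolding m_def using bdd that by (simp add: cInf_lower)
  have "\<exists>v\<in>V. J v < m + 1 / Suc n" for n
  proof -
    have "Inf (J ` V) < m + 1 / Suc n"
      by (simp add: m_def)
    then show ?thesis
      using V0 bdd by (subst (asm) cInf_less_iff) auto
  qed
  then obtain v where v: "\<And>n. v n \<in> V" "\<And>n. J (v n) < m + 1 / Suc n"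
    by metis
  have dist_le: "(norm (x - y))\<^sup>2 \<le> 2 * J x + 2 * J y - 4 * m" if "x \<in> V" "y \<in> V" for x y
  proof -
    have "m \<le> J ((1 / 2) *\<^sub>R (x + y))"
      using that V by (intro m_le csubspace_scaleR) (auto simp: csubspace_def)
    also have "\<dots> = (norm (x + y))\<^sup>2 / 4 - Re (\<phi> x) - Re (\<phi> y)"
    proof -
      have "\<phi> ((1 / 2) *\<^sub>R (x + y)) = (1 / 2) * (\<phi> x + \<phi> y)"
        using scale[of "x + y" "of_real (1/2)"] add[of x y] that V unfolding scaleC_of_real
        by (simp add: csubspace_def)
      then have "Re (\<phi> ((1 / 2) *\<^sub>R (x + y))) = Re (1 / 2 * (\<phi> x + \<phi> y))"
        by (rule arg_cong)
      then have "Re (\<phi> ((1 / 2) *\<^sub>R (x + y))) = (Re (\<phi> x) + Re (\<phi> y)) / 2"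
        by simp
      then show ?thesis
        by (simp add: J_def power_divide)
    qed
    finally show ?thesis
      unfolding J_def using norm_add_sq[of x y] norm_diff_sq[of x y] by argo
  qed
  have "Cauchy v"
    unfolding Cauchy_iff
  proof (intro allI impI)
    fix e :: real assume "e > 0"
    then obtain N where N: "1 / real (Suc N) < e\<^sup>2 / 4"
      by (metis nat_approx_posE zero_less_divide_iff zero_less_numeral zero_less_power)
    have "norm (v i - v j) < e" if "i \<ge> N" "j \<ge> N" for i j
    proof -
      have "1 / real (Suc i) \<le> 1 / real (Suc N)" "1 / real (Suc j) \<le> 1 / real (Suc N)"
        using that by (auto simp: field_simps)
      then have "(norm (v i - v j))\<^sup>2 < e\<^sup>2"
        using dist_le[OF v(1) v(1), of i j] v(2)[of i] v(2)[of j] N by linarith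
      then show ?thesis
        using \<open>e > 0\<close> by (simp add: power2_less_imp_less)
    qed
    then show "\<exists>M. \<forall>m\<ge>M. \<forall>n\<ge>M. norm (v m - v n) < e"
      by blast
  qed
  then obtain c where c: "v \<longlonglongrightarrow> c"
    by (auto simp: Cauchy_convergent_iff convergent_def)
  have eq: "\<phi> u = cinner u c" if u: "u \<in> V" for u
  proof (rule ccontr)
    assume ne: "\<phi> u \<noteq> cinner u c"
    define d where "d = \<phi> u - cinner u c"
    define t where "t = 1 / (1 + (norm u)\<^sup>2)"
    define s where "s = of_real t * cnj d"
    have t: "t > 0" "t * (norm u)\<^sup>2 < 1"
      by (auto simp: t_def add_pos_nonneg field_simps add_strict_increasing)
    have "2 * Re (\<phi> (s *\<^sub>C u) - cinner (s *\<^sub>C u) (v n)) \<le> (norm (s *\<^sub>C u))\<^sup>2 + 1 / Suc n" for n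
    proof -
      have su: "s *\<^sub>C u \<in> V"
        using u V by (simp add: csubspace_def)
      then have "m \<le> J (v n + s *\<^sub>C u)"
        using v(1)[of n] V by (intro m_le) (auto simp: csubspace_def)
      then show ?thesis
        using v(2)[of n] add[OF v(1)[of n] su] cinner_commute[of "s *\<^sub>C u" "v n"]
        unfolding J_def norm_add_sq by simp
    qed
    moreover have "(\<lambda>n. 2 * Re (\<phi> (s *\<^sub>C u) - cinner (s *\<^sub>C u) (v n)))
        \<longlonglongrightarrow> 2 * Re (\<phi> (s *\<^sub>C u) - cinner (s *\<^sub>C u) c)"
      by (intro tendsto_intros tendsto_cinner_right c)
    moreover have "(\<lambda>n. (norm (s *\<^sub>C u))\<^sup>2 + 1 / Suc n) \<longlonglongrightarrow> (norm (s *\<^sub>C u))\<^sup>2 + 0"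
      by (intro tendsto_intros LIMSEQ_Suc[OF lim_1_over_n])
    ultimately have "2 * Re (\<phi> (s *\<^sub>C u) - cinner (s *\<^sub>C u) c) \<le> (norm (s *\<^sub>C u))\<^sup>2 + 0"
      by (meson LIMSEQ_le)
    moreover have "\<phi> (s *\<^sub>C u) - cinner (s *\<^sub>C u) c = of_real (t * (cmod d)\<^sup>2)"
      using scale[OF u, of s] complex_norm_square[of d]
      by (simp add: s_def cinner_scaleC_left d_def[symmetric] right_diff_distrib[symmetric] mult_ac
          del: of_real_power)
    moreover have "(norm (s *\<^sub>C u))\<^sup>2 = t * (t * (norm u)\<^sup>2) * (cmod d)\<^sup>2"
      using t by (simp add: norm_scaleC s_def norm_mult power2_eq_square)
    ultimately have "2 * (t * (cmod d)\<^sup>2) \<le> (t * (norm u)\<^sup>2) * (t * (cmod d)\<^sup>2)"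
      by (simp add: mult_ac)
    moreover have "t * (cmod d)\<^sup>2 > 0"
      using ne t by (simp add: d_def)
    ultimately show False
      using t(2) by (simp add: mult_le_cancel_right)
  qed
  have "norm c \<le> K"
  proof -
    have "(\<lambda>n. cmod (cinner (v n) c)) \<longlonglongrightarrow> cmod (cinner c c)"
      by (intro tendsto_norm tendsto_cinner_left c)
    moreover have "(\<lambda>n. K * norm (v n)) \<longlonglongrightarrow> K * norm c"
      by (intro tendsto_intros c)
    moreover have "cmod (cinner (v n) c) \<le> K * norm (v n)" for n
      using bound[OF v(1)] eq[OF v(1)] by simp
    ultimately have "cmod (cinner c c) \<le> K * norm c"
      by (meson LIMSEQ_le)
    then show ?thesis
      using \<open>0 \<le> K\<close> by (cases "c = 0") (auto simp: cinner_self norm_mult power2_eq_square)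
  qed
  moreover have "c \<in> closure V"
    using v(1) c closure_sequential by blast
  ultimately show thesis
    using that eq by blast
qed

lemma projection_exists:
  fixes V :: "'a::complex_hilbert set"
  assumes "csubspace V" "closed V"
  obtains p where "p \<in> V" "\<And>v. v \<in> V \<Longrightarrow> cinner v (x - p) = 0"
proof -
  obtain p where "p \<in> closure V" "\<And>v. v \<in> V \<Longrightarrow> cinner v x = cinner v p"
  proof (rule riesz_subspace[OF assms(1), of "\<lambda>v. cinner v x" "norm x"])
    show "cmod (cinner v x) \<le> norm x * norm v" for v
      using norm_cinner_le[of v x] by (simp add: mult.commute)
  qed (auto simp: cinner_add_left cinner_scaleC_left)
  then show thesis
    using that assms(2) by (simp add: cinner_diff_right)
qed

lemma mem_closed_csubspaceI:
  fixes V :: "'a::complex_hilbert set"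
  assumes "csubspace V" "closed V"
    and "\<And>y. (\<And>v. v \<in> V \<Longrightarrow> cinner v y = 0) \<Longrightarrow> cinner x y = 0"
  shows "x \<in> V"
proof -
  obtain p where p: "p \<in> V" "\<And>v. v \<in> V \<Longrightarrow> cinner v (x - p) = 0"
    using projection_exists[OF assms(1,2)] by metis
  then have "cinner x (x - p) = 0" "cinner p (x - p) = 0"
    using assms(3) by auto
  then have "cinner (x - p) (x - p) = 0"
    by (simp add: cinner_diff_left)
  then show ?thesis
    using p(1) by (simp add: cinner_eq_zero_iff)
qed

lemma bounded_clinearI:
  assumes "\<And>x y. A (x + y) = A x + A y" "\<And>c x. A (c *\<^sub>C x) = c *\<^sub>C A x"
    and "\<And>x. norm (A x) \<le> K * norm x"
  shows "bounded_clinear A"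
  unfolding bounded_clinear_def
proof
  show "bounded_linear A"
    using assms by (intro bounded_linear_intro[of _ K])
      (auto simp: scaleC_of_real[symmetric] mult.commute)
qed (use assms in auto)

lemma bounded_clinear_add: "bounded_clinear A \<Longrightarrow> A (x + y) = A x + A y"
  unfolding bounded_clinear_def by (simp add: linear_add bounded_linear.linear)

lemma bounded_clinear_diff: "bounded_clinear A \<Longrightarrow> A (x - y) = A x - A y"
  unfolding bounded_clinear_def by (simp add: linear_diff bounded_linear.linear)

lemma bounded_clinear_zero: "bounded_clinear A \<Longrightarrow> A 0 = 0"
  unfolding bounded_clinear_def by (simp add: linear_0 bounded_linear.linear)

lemma bounded_clinear_scaleC: "bounded_clinear A \<Longrightarrow> A (c *\<^sub>C x) = c *\<^sub>C A x"
  unfolding bounded_clinear_def by simp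

lemma bounded_clinear_sum: "bounded_clinear A \<Longrightarrow> A (\<Sum>i\<in>I. f i) = (\<Sum>i\<in>I. A (f i))"
  unfolding bounded_clinear_def by (simp add: linear_sum bounded_linear.linear)

lemma bounded_clinear_tendsto:
  "bounded_clinear A \<Longrightarrow> (f \<longlongrightarrow> l) F \<Longrightarrow> ((\<lambda>x. A (f x)) \<longlongrightarrow> A l) F"
  unfolding bounded_clinear_def by (simp add: bounded_linear.tendsto)

lemma bounded_clinear_bound:
  assumes "bounded_clinear A"
  obtains K where "0 \<le> K" "\<And>x. norm (A x) \<le> K * norm x"
  using assms bounded_linear.nonneg_bounded[of A] unfolding bounded_clinear_def
  by (metis mult.commute)

lemma csubspace_image:
  assumes A: "bounded_clinear A" and V: "csubspace V"
  shows "csubspace (A ` V)"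
  unfolding csubspace_def
proof (intro conjI ballI allI)
  show "0 \<in> A ` V"
    using V bounded_clinear_zero[OF A] by (metis csubspace_def image_eqI)
qed (use V in \<open>auto simp: csubspace_def simp flip: bounded_clinear_add[OF A] bounded_clinear_scaleC[OF A]\<close>)

lemmas csubspace_range = csubspace_image[OF _ csubspace_UNIV]

lemma adjoint_exists:
  assumes A: "bounded_clinear A"
  shows "cinner (A x) y = cinner x (adjoint_op A y)"
proof -
  obtain K where K: "0 \<le> K" "\<And>x. norm (A x) \<le> K * norm x"
    using bounded_clinear_bound[OF A] by metis
  have "\<exists>c. \<forall>x. cinner (A x) y = cinner x c" for y
  proof -
    have "cmod (cinner (A x) y) \<le> (K * norm y) * norm x" for x
      using norm_cinner_le[of "A x" y] mult_right_mono[OF K(2)[of x], of "norm y"]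
      by (simp add: mult_ac)
    moreover have "0 \<le> K * norm y"
      using K(1) by simp
    ultimately obtain c where "\<And>x. x \<in> UNIV \<Longrightarrow> cinner (A x) y = cinner x c"
      using riesz_subspace[OF csubspace_UNIV, of "\<lambda>x. cinner (A x) y" "K * norm y"]
      unfolding bounded_clinear_add[OF A] bounded_clinear_scaleC[OF A]
          cinner_add_left cinner_scaleC_left by blast
    then show ?thesis
      by blast
  qed
  then obtain A' where A': "\<And>x y. cinner (A x) y = cinner x (A' y)"
    by metis
  moreover have "A'' = A'" if "\<forall>x y. cinner (A x) y = cinner x (A'' y)" for A''
    by (rule ext, rule cinner_eqI) (metis that A')
  ultimately have "adjoint_op A = A'"
    unfolding adjoint_op_def by (intro the_equality) blast+
  then show ?thesis
    using A' by simp
qed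

lemma adjoint_exists': "bounded_clinear A \<Longrightarrow> cinner (adjoint_op A y) x = cinner y (A x)"
  by (metis adjoint_exists cinner_commute)

lemma norm_adjoint_le:
  assumes A: "bounded_clinear A" and K: "\<And>x. norm (A x) \<le> K * norm x" and "0 \<le> K"
  shows "norm (adjoint_op A y) \<le> K * norm y"
proof -
  define x where "x = adjoint_op A y"
  have "norm x * norm x = Re (cinner (A x) y)"
    by (simp add: adjoint_exists[OF A] x_def[symmetric] cinner_self_Re[symmetric] power2_eq_square)
  also have "\<dots> \<le> K * norm x * norm y"
    using Re_cinner_le[of "A x" y] mult_right_mono[OF K[of x], of "norm y"] by simp
  finally have "norm x * norm x \<le> norm x * (K * norm y)"
    by (simp add: mult_ac)
  then show ?thesis
    using \<open>0 \<le> K\<close> unfolding x_def[symmetric] by (cases "x = 0") auto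
qed

lemma bounded_clinear_adjoint:
  assumes A: "bounded_clinear A"
  shows "bounded_clinear (adjoint_op A)"
proof -
  obtain K where K: "0 \<le> K" "\<And>x. norm (A x) \<le> K * norm x"
    using bounded_clinear_bound[OF A] by metis
  show ?thesis
  proof (rule bounded_clinearI[of _ K])
    show "norm (adjoint_op A y) \<le> K * norm y" for y
      by (rule norm_adjoint_le[OF A K(2,1)])
  qed (rule cinner_eqI, simp add: adjoint_exists[OF A, symmetric] cinner_add_right cinner_scaleC_right)+
qed

lemma range_criterion:
  fixes R :: "'a::complex_hilbert \<Rightarrow> 'a"
  assumes R: "bounded_clinear R" and sa: "\<And>x y. cinner (R x) y = cinner x (R y)"
    and bound: "\<And>h. cmod (cinner h g) \<le> K * norm (R h)" and "0 \<le> K"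
  obtains c where "R c = g" "norm c \<le> K"
proof -
  define \<phi> where "\<phi> v = cinner (SOME h. R h = v) g" for v
  have \<phi>: "\<phi> (R h) = cinner h g" for h
  proof -
    have "R (SOME h'. R h' = R h) = R h"
      by (rule someI[of "\<lambda>h'. R h' = R h" h]) simp
    then show ?thesis
      using bound[of "(SOME h'. R h' = R h) - h"]
      by (simp add: \<phi>_def bounded_clinear_diff[OF R] cinner_diff_left)
  qed
  have "csubspace (range R)"
    by (rule csubspace_range[OF R])
  moreover have "\<phi> (x + y) = \<phi> x + \<phi> y" if xy: "x \<in> range R" "y \<in> range R" for x y
    using xy by (auto simp: \<phi> cinner_add_left simp flip: bounded_clinear_add[OF R])
  moreover have "\<phi> (c *\<^sub>C x) = c * \<phi> x" if "x \<in> range R" for c x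
    using that by (auto simp: \<phi> cinner_scaleC_left simp flip: bounded_clinear_scaleC[OF R])
  moreover have "cmod (\<phi> x) \<le> K * norm x" if "x \<in> range R" for x
    using that bound by (auto simp: \<phi>)
  ultimately obtain c where c: "\<And>v. v \<in> range R \<Longrightarrow> \<phi> v = cinner v c" "norm c \<le> K"
    using riesz_subspace[of "range R" \<phi> K] \<open>0 \<le> K\<close> by metis
  have "R c = g"
  proof (rule cinner_eqI)
    show "cinner z (R c) = cinner z g" for z
      using c(1)[of "R z"] by (simp add: \<phi> sa)
  qed
  then show thesis
    using that c(2) by blast
qed

subsection \<open>Square roots\<close>

lemma positive_op_bounded: "positive_op A \<Longrightarrow> bounded_clinear A"
  by (simp add: positive_op_def)

lemma positive_op_real: "positive_op A \<Longrightarrow> Im (cinner (A x) x) = 0 \<and> 0 \<le> Re (cinner (A x) x)"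
  by (simp add: positive_op_def complex_nonneg_Reals_iff)

lemma positive_op_self_adjoint:
  assumes A: "positive_op A"
  shows "cinner (A x) y = cinner x (A y)"
proof -
  note bl = positive_op_bounded[OF A]
  note add = bounded_clinear_add[OF bl] and scale = bounded_clinear_scaleC[OF bl]
  have 1: "Im (cinner (A x) y + cinner (A y) x) = 0"
    using positive_op_real[OF A, of "x + y"] positive_op_real[OF A, of x] positive_op_real[OF A, of y]
    by (simp add: add cinner_add_left cinner_add_right)
  have 2: "Im (cinner (A x) (\<i> *\<^sub>C y) + cinner (A (\<i> *\<^sub>C y)) x) = 0"
    using positive_op_real[OF A, of "x + \<i> *\<^sub>C y"] positive_op_real[OF A, of x]
      positive_op_real[OF A, of "\<i> *\<^sub>C y"]
    by (simp add: add cinner_add_left cinner_add_right)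
  have "cinner (A x) y = cnj (cinner (A y) x)"
    using 1 2 by (simp add: complex_eq_iff scale cinner_scaleC_left cinner_scaleC_right)
  then show ?thesis
    by (simp add: cinner_commute[of x "A y"])
qed

lemma positive_op_kernel:
  assumes A: "positive_op A" and 0: "cinner (A y) y = 0"
  shows "A y = 0"
proof (rule ccontr)
  assume ne: "A y \<noteq> 0"
  note bl = positive_op_bounded[OF A]
  define z where "z = A y"
  define k where "k = Re (cinner (A z) z)"
  define t where "t = (norm z)\<^sup>2 / (k + 1)"
  have k: "k \<ge> 0"
    using positive_op_real[OF A] by (simp add: k_def)
  have pos: "(norm z)\<^sup>2 > 0"
    using ne by (simp add: z_def)
  then have t: "t > 0"
    using k by (simp add: t_def)
  have tz: "t *\<^sub>R z = of_real t *\<^sub>C z"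
    by (simp add: scaleC_of_real)
  have "0 \<le> Re (cinner (A (y - t *\<^sub>R z)) (y - t *\<^sub>R z))"
    using positive_op_real[OF A] by blast
  also have "\<dots> = t * (t * k - 2 * (norm z)\<^sup>2)"
    unfolding tz using 0 positive_op_self_adjoint[OF A, of z y]
    by (simp add: bounded_clinear_diff[OF bl] bounded_clinear_scaleC[OF bl] cinner_diff_left
        cinner_diff_right cinner_scaleC_left cinner_scaleC_right k_def z_def[symmetric]
        cinner_self_Re algebra_simps)
  finally have "2 * (norm z)\<^sup>2 \<le> t * k"
    using t by (simp add: zero_le_mult_iff)
  moreover have "t * k \<le> (norm z)\<^sup>2"
    using k pos by (simp add: t_def field_simps)
  ultimately show False
    using pos by simp
qed

text \<open>If \<open>T\<close> is a self-adjoint contraction then the iterates below are polynomials in \<open>T\<close> with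
  nonnegative coefficients that converge to the solution \<open>Y\<close> of \<open>Y = (T + Y\<^sup>2) / 2\<close>,
  so that \<open>(I - Y)\<^sup>2 = I - T\<close>. The case \<open>T = 1\<close> controls the speed of convergence.\<close>

primrec sqrt_iter :: "('a::complex_hilbert \<Rightarrow> 'a) \<Rightarrow> nat \<Rightarrow> 'a \<Rightarrow> 'a" where
  "sqrt_iter T 0 = (\<lambda>x. 0)"
| "sqrt_iter T (Suc n) = (\<lambda>x. (1 / 2) *\<^sub>R (T x + sqrt_iter T n (sqrt_iter T n x)))"

primrec sqrt_iter_real :: "nat \<Rightarrow> real" where
  "sqrt_iter_real 0 = 0"
| "sqrt_iter_real (Suc n) = (1 + (sqrt_iter_real n)\<^sup>2) / 2"

lemma sqrt_iter_real_bounds: "0 \<le> sqrt_iter_real n \<and> sqrt_iter_real n \<le> 1"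
proof (induction n)
  case (Suc n)
  then have "(sqrt_iter_real n)\<^sup>2 \<le> 1"
    by (simp add: power_le_one)
  then show ?case
    by simp
qed simp

lemma convergent_sqrt_iter_real: "convergent sqrt_iter_real"
proof -
  have "incseq sqrt_iter_real"
  proof (rule incseq_SucI)
    show "sqrt_iter_real n \<le> sqrt_iter_real (Suc n)" for n
      using zero_le_power2[of "sqrt_iter_real n - 1"] by (simp add: power2_eq_square algebra_simps)
  qed
  then obtain L where "sqrt_iter_real \<longlonglongrightarrow> L"
    using incseq_convergent[of sqrt_iter_real 1] sqrt_iter_real_bounds by blast
  then show ?thesis
    by (rule convergentI)
qed

locale selfadjoint_contraction =
  fixes T :: "'a::complex_hilbert \<Rightarrow> 'a"
  assumes bounded: "bounded_clinear T"
    and contraction: "norm (T x) \<le> norm x"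
    and selfadjoint: "cinner (T x) y = cinner x (T y)"
begin

lemma sqrt_iter_add: "sqrt_iter T n (x + y) = sqrt_iter T n x + sqrt_iter T n y"
  by (induction n arbitrary: x y)
    (auto simp: bounded_clinear_add[OF bounded] scaleR_add_right[symmetric] add_ac)

lemma sqrt_iter_scaleC: "sqrt_iter T n (c *\<^sub>C x) = c *\<^sub>C sqrt_iter T n x"
  by (induction n arbitrary: x)
    (auto simp: bounded_clinear_scaleC[OF bounded] scaleC_add_right[symmetric]
      scaleC_of_real[symmetric] scaleC_scaleC mult.commute simp del: of_real_divide)

lemma sqrt_iter_diff: "sqrt_iter T n (x - y) = sqrt_iter T n x - sqrt_iter T n y"
  by (metis add_diff_cancel_right' diff_add_cancel sqrt_iter_add)

lemma norm_sqrt_iter: "norm (sqrt_iter T n x) \<le> sqrt_iter_real n * norm x"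
proof (induction n arbitrary: x)
  case (Suc n)
  have "norm (sqrt_iter T n (sqrt_iter T n x)) \<le> sqrt_iter_real n * (sqrt_iter_real n * norm x)"
    using Suc.IH[of "sqrt_iter T n x"] mult_left_mono[OF Suc.IH[of x], of "sqrt_iter_real n"]
      sqrt_iter_real_bounds[of n] by linarith
  then have "norm (T x + sqrt_iter T n (sqrt_iter T n x)) \<le> (1 + (sqrt_iter_real n)\<^sup>2) * norm x"
    using norm_triangle_ineq[of "T x" "sqrt_iter T n (sqrt_iter T n x)"] contraction[of x]
    by (simp add: power2_eq_square algebra_simps)
  then show ?case
    by simp
qed simp

lemma norm_sqrt_iter_le: "norm (sqrt_iter T n x) \<le> norm x"
  using norm_sqrt_iter[of n x] sqrt_iter_real_bounds[of n]
    mult_right_mono[of "sqrt_iter_real n" 1 "norm x"] by simp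

lemma norm_sqrt_iter_diff:
  "norm (sqrt_iter T (Suc n) x - sqrt_iter T n x) \<le> (sqrt_iter_real (Suc n) - sqrt_iter_real n) * norm x"
proof (induction n arbitrary: x)
  case (Suc n)
  let ?Y = "sqrt_iter T" and ?y = sqrt_iter_real
  define D where "D x = ?Y (Suc n) x - ?Y n x" for x
  have IH: "norm (D x) \<le> (?y (Suc n) - ?y n) * norm x" for x
    using Suc.IH by (simp add: D_def del: sqrt_iter.simps sqrt_iter_real.simps)
  have d: "0 \<le> ?y (Suc n) - ?y n"
    using zero_le_power2[of "?y n - 1"] by (simp add: power2_eq_square algebra_simps)
  have "?Y (Suc (Suc n)) x - ?Y (Suc n) x = (1 / 2) *\<^sub>R (?Y (Suc n) (D x) + D (?Y n x))"
    unfolding D_def sqrt_iter_diff by (simp add: algebra_simps del: sqrt_iter.simps)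
      (simp add: algebra_simps)
  moreover have "norm (?Y (Suc n) (D x)) \<le> ?y (Suc n) * ((?y (Suc n) - ?y n) * norm x)"
    using norm_sqrt_iter[of "Suc n" "D x"] mult_left_mono[OF IH[of x], of "?y (Suc n)"]
      sqrt_iter_real_bounds[of "Suc n"] by linarith
  moreover have "norm (D (?Y n x)) \<le> (?y (Suc n) - ?y n) * (?y n * norm x)"
    using IH[of "?Y n x"] mult_left_mono[OF norm_sqrt_iter[of n x] d] by linarith
  ultimately have "norm (?Y (Suc (Suc n)) x - ?Y (Suc n) x)
      \<le> (1 / 2) * (?y (Suc n) * ((?y (Suc n) - ?y n) * norm x) + (?y (Suc n) - ?y n) * (?y n * norm x))"
    using norm_triangle_ineq[of "?Y (Suc n) (D x)" "D (?Y n x)"] by simp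
  also have "\<dots> = (1 / 2) * ((?y (Suc n))\<^sup>2 - (?y n)\<^sup>2) * norm x"
    by (simp add: power2_eq_square algebra_simps del: sqrt_iter_real.simps)
  also have "\<dots> = (?y (Suc (Suc n)) - ?y (Suc n)) * norm x"
    unfolding sqrt_iter_real.simps(2)[of "Suc n"] sqrt_iter_real.simps(2)[of n] by (simp add: field_simps)
  finally show ?case .
qed (use contraction in \<open>simp add: field_simps\<close>)

lemma norm_sqrt_iter_diff_le:
  assumes "m \<le> n"
  shows "norm (sqrt_iter T n x - sqrt_iter T m x) \<le> (sqrt_iter_real n - sqrt_iter_real m) * norm x"
  using assms
proof (induction n rule: dec_induct)
  case (step n)
  then show ?case
    using norm_sqrt_iter_diff[of n x]
      norm_triangle_ineq[of "sqrt_iter T (Suc n) x - sqrt_iter T n x" "sqrt_iter T n x - sqrt_iter T m x"]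
    by (simp add: algebra_simps del: sqrt_iter.simps sqrt_iter_real.simps)
qed simp

definition sqrt_lim :: "'a \<Rightarrow> 'a" where
  "sqrt_lim x = lim (\<lambda>n. sqrt_iter T n x)"

lemma tendsto_sqrt_iter: "(\<lambda>n. sqrt_iter T n x) \<longlonglongrightarrow> sqrt_lim x"
proof -
  have "Cauchy (\<lambda>n. sqrt_iter T n x)"
  proof (rule metric_CauchyI)
    fix e :: real assume e: "e > 0"
    have "Cauchy sqrt_iter_real"
      by (simp add: Cauchy_convergent_iff convergent_sqrt_iter_real)
    then obtain N where N: "\<And>m n. m \<ge> N \<Longrightarrow> n \<ge> N \<Longrightarrow> \<bar>sqrt_iter_real m - sqrt_iter_real n\<bar> < e / (norm x + 1)"
      using e by (metis Cauchy_iff add_nonneg_pos divide_pos_pos norm_ge_zero real_norm_def zero_less_one)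
    have *: "norm (sqrt_iter T n x - sqrt_iter T m x) < e" if "m \<ge> N" "n \<ge> m" for m n
    proof -
      have "norm (sqrt_iter T n x - sqrt_iter T m x) \<le> (sqrt_iter_real n - sqrt_iter_real m) * norm x"
        using that by (intro norm_sqrt_iter_diff_le)
      also have "\<dots> \<le> e / (norm x + 1) * norm x"
        using N[of n m] that by (intro mult_right_mono) auto
      also have "\<dots> < e"
        using e by (simp add: field_simps add_pos_nonneg)
      finally show ?thesis .
    qed
    show "\<exists>N. \<forall>m\<ge>N. \<forall>n\<ge>N. dist (sqrt_iter T m x) (sqrt_iter T n x) < e"
      by (rule exI[of _ N]) (metis * dist_commute dist_norm nle_le)
  qed
  then show ?thesis
    unfolding sqrt_lim_def by (simp add: Cauchy_convergent_iff convergent_LIMSEQ_iff)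
qed

lemma norm_sqrt_lim: "norm (sqrt_lim x) \<le> norm x"
  by (rule LIMSEQ_le_const2[OF tendsto_norm[OF tendsto_sqrt_iter]]) (use norm_sqrt_iter_le in blast)

lemma bounded_clinear_sqrt_lim: "bounded_clinear sqrt_lim"
proof (rule bounded_clinearI[where K = 1])
  show "sqrt_lim (x + y) = sqrt_lim x + sqrt_lim y" for x y
    using tendsto_sqrt_iter[of "x + y"] tendsto_add[OF tendsto_sqrt_iter[of x] tendsto_sqrt_iter[of y]]
    by (simp add: sqrt_iter_add LIMSEQ_unique)
  show "sqrt_lim (c *\<^sub>C x) = c *\<^sub>C sqrt_lim x" for c x
    using tendsto_sqrt_iter[of "c *\<^sub>C x"]
      bounded_linear.tendsto[OF bounded_linear_scaleC tendsto_sqrt_iter[of x]]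
    by (simp add: sqrt_iter_scaleC LIMSEQ_unique)
qed (simp add: norm_sqrt_lim)

lemma sqrt_iter_selfadjoint: "cinner (sqrt_iter T n x) y = cinner x (sqrt_iter T n y)"
  by (induction n arbitrary: x y)
    (auto simp: cinner_scaleR_left cinner_scaleR_right cinner_add_left cinner_add_right selfadjoint)

lemma sqrt_lim_selfadjoint: "cinner (sqrt_lim x) y = cinner x (sqrt_lim y)"
  using tendsto_cinner_left[OF tendsto_sqrt_iter, of x y] tendsto_cinner_right[OF tendsto_sqrt_iter, of x y]
  by (simp add: sqrt_iter_selfadjoint LIMSEQ_unique)

lemma sqrt_lim_eq: "sqrt_lim x = (1 / 2) *\<^sub>R (T x + sqrt_lim (sqrt_lim x))"
proof -
  have "(\<lambda>n. sqrt_iter T n (sqrt_iter T n x)) \<longlonglongrightarrow> sqrt_lim (sqrt_lim x)"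
  proof (rule LIM_zero_cancel)
    have "(\<lambda>n. sqrt_iter T n x - sqrt_lim x) \<longlonglongrightarrow> 0"
      using tendsto_sqrt_iter by (rule LIM_zero)
    then have "(\<lambda>n. sqrt_iter T n (sqrt_iter T n x - sqrt_lim x)) \<longlonglongrightarrow> 0"
      by (rule Lim_transform_bound[rotated]) (simp add: norm_sqrt_iter_le)
    then show "(\<lambda>n. sqrt_iter T n (sqrt_iter T n x) - sqrt_lim (sqrt_lim x)) \<longlonglongrightarrow> 0"
      using tendsto_add[OF _ LIM_zero[OF tendsto_sqrt_iter[of "sqrt_lim x"]]]
      by (fastforce simp: sqrt_iter_diff)
  qed
  then have "(\<lambda>n. sqrt_iter T (Suc n) x) \<longlonglongrightarrow> (1 / 2) *\<^sub>R (T x + sqrt_lim (sqrt_lim x))"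
    by (auto intro!: tendsto_intros)
  then show ?thesis
    using LIMSEQ_Suc[OF tendsto_sqrt_iter[of x]] LIMSEQ_unique by blast
qed

lemma sqrt_lim_commute:
  assumes Z: "bounded_clinear Z" and comm: "\<And>x. Z (T x) = T (Z x)"
  shows "Z (sqrt_lim x) = sqrt_lim (Z x)"
proof -
  have "Z (sqrt_iter T n x) = sqrt_iter T n (Z x)" for n x
    by (induction n arbitrary: x)
      (auto simp: bounded_clinear_zero[OF Z] scaleC_of_real[symmetric] bounded_clinear_scaleC[OF Z]
        bounded_clinear_add[OF Z] comm simp del: of_real_divide)
  then show ?thesis
    using bounded_clinear_tendsto[OF Z tendsto_sqrt_iter[of x]] tendsto_sqrt_iter[of "Z x"]
    by (simp add: LIMSEQ_unique)
qed

definition sqrt_root :: "'a \<Rightarrow> 'a" where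
  "sqrt_root x = x - sqrt_lim x"

lemma sqrt_root_bounded: "bounded_clinear sqrt_root"
proof (rule bounded_clinearI[where K = 2])
  show "norm (sqrt_root x) \<le> 2 * norm x" for x
    using norm_triangle_ineq4[of x "sqrt_lim x"] norm_sqrt_lim[of x] by (simp add: sqrt_root_def)
qed (simp_all add: sqrt_root_def bounded_clinear_add[OF bounded_clinear_sqrt_lim]
    bounded_clinear_scaleC[OF bounded_clinear_sqrt_lim] scaleC_diff_right)

lemma sqrt_root_positive: "positive_op sqrt_root"
  unfolding positive_op_def
proof (intro conjI allI sqrt_root_bounded)
  fix x
  have "Re (cinner (sqrt_lim x) x) \<le> (norm x)\<^sup>2"
    using Re_cinner_le[of "sqrt_lim x" x] mult_right_mono[OF norm_sqrt_lim[of x], of "norm x"]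
    by (simp add: power2_eq_square)
  moreover have "Im (cinner (sqrt_lim x) x) = 0"
    using sqrt_lim_selfadjoint[of x x] cinner_commute[of x "sqrt_lim x"] by (simp add: complex_eq_iff)
  ultimately show "cinner (sqrt_root x) x \<in> \<real>\<^sub>\<ge>\<^sub>0"
    by (simp add: sqrt_root_def cinner_diff_left cinner_self complex_nonneg_Reals_iff del: of_real_power)
qed

lemma sqrt_root_square: "sqrt_root (sqrt_root x) = x - T x"
proof -
  have "T x + sqrt_lim (sqrt_lim x) = 2 *\<^sub>R sqrt_lim x"
    by (subst (2) sqrt_lim_eq) simp
  then show ?thesis
    by (simp add: sqrt_root_def bounded_clinear_diff[OF bounded_clinear_sqrt_lim] algebra_simps scaleR_2)
qed

lemma sqrt_root_unique:
  assumes S: "positive_op S" and sq: "\<And>x. S (S x) = x - T x"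
  shows "S = sqrt_root"
proof
  fix x
  note bS = positive_op_bounded[OF S] and bR = sqrt_root_bounded
  have "S (T x) = T (S x)" for x
    using sq[of "S x"] sq[of x] bounded_clinear_diff[OF bS, of x "T x"] by simp
  then have comm: "S (sqrt_root x) = sqrt_root (S x)" for x
    unfolding sqrt_root_def using sqrt_lim_commute[OF bS] by (simp add: bounded_clinear_diff[OF bS])
  define y where "y = sqrt_root x - S x"
  have "sqrt_root y + S y = 0"
    unfolding y_def bounded_clinear_diff[OF bS] bounded_clinear_diff[OF bR] comm sqrt_root_square sq
    by simp
  then have "cinner (sqrt_root y) y + cinner (S y) y = 0"
    by (metis cinner_add_left cinner_zero_left)
  then have "cinner (sqrt_root y) y = 0" "cinner (S y) y = 0"
    using positive_op_real[OF S, of y] positive_op_real[OF sqrt_root_positive, of y]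
    by (auto simp: complex_eq_iff)
  then have "sqrt_root y = 0" "S y = 0"
    using positive_op_kernel S sqrt_root_positive by auto
  then have "cinner y y = 0"
    by (subst (2) y_def, simp add: cinner_diff_right positive_op_self_adjoint[OF S, symmetric]
        positive_op_self_adjoint[OF sqrt_root_positive, symmetric])
  then show "S x = sqrt_root x"
    by (simp add: cinner_eq_zero_iff y_def)
qed

lemma sqrt_op_eq: "sqrt_op (\<lambda>x. x - T x) = sqrt_root"
  unfolding sqrt_op_def
proof (rule the_equality)
  show "positive_op sqrt_root \<and> sqrt_root \<circ> sqrt_root = (\<lambda>x. x - T x)"
    using sqrt_root_positive sqrt_root_square by auto
  show "R = sqrt_root" if "positive_op R \<and> R \<circ> R = (\<lambda>x. x - T x)" for R
    using that by (intro sqrt_root_unique) (auto simp: fun_eq_iff)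
qed

end

section \<open>Means over the circle\<close>

abbreviation circ :: "real measure" where
  "circ \<equiv> lebesgue_on {0..2*pi}"

definition circle_mean :: "(real \<Rightarrow> 'a::{banach, second_countable_topology}) \<Rightarrow> 'a" where
  "circle_mean f = (1 / (2 * pi)) *\<^sub>R (\<integral>t. f t \<partial>circ)"

lemma finite_measure_circ: "finite_measure circ"
  using finite_measure_lebesgue_on[OF lmeasurable_cbox[of 0 "2*pi"]] by simp

lemma integrable_circ_const [intro!, simp]: "integrable circ (\<lambda>_. c)"
  by (rule finite_measure.integrable_const[OF finite_measure_circ])

lemma integrable_circ_continuous:
  fixes f :: "real \<Rightarrow> 'a::euclidean_space"
  shows "continuous_on UNIV f \<Longrightarrow> integrable circ f"
  by (rule continuous_imp_integrable_real) (rule continuous_on_subset, auto)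

lemma measurable_circ_continuous:
  fixes f :: "real \<Rightarrow> 'a::euclidean_space"
  shows "continuous_on UNIV f \<Longrightarrow> f \<in> borel_measurable circ"
  by (rule borel_measurable_integrable) (rule integrable_circ_continuous)

lemma integrable_circ_mult_bounded:
  fixes g :: "real \<Rightarrow> 'a::{real_normed_algebra, banach, second_countable_topology}"
  assumes k: "integrable circ k" and g: "g \<in> borel_measurable circ" "\<And>t. norm (g t) \<le> K"
  shows "integrable circ (\<lambda>t. g t * k t)"
proof (rule Bochner_Integration.integrable_bound)
  show "integrable circ (\<lambda>t. K * norm (k t))"
    using k by auto
  have "norm (g t * k t) \<le> K * norm (k t)" for t
    using norm_mult_ineq[of "g t" "k t"] mult_right_mono[OF g(2), of "norm (k t)" t] by simp
  then show "AE t in circ. norm (g t * k t) \<le> norm (K * norm (k t))"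
    by (intro AE_I2) (metis abs_ge_self order_trans real_norm_def)
qed (use k g in measurable)

lemma circle_mean_const [simp]: "circle_mean (\<lambda>_. c) = c"
proof -
  have "measure circ (space circ) = 2 * pi"
    by (simp add: measure_restrict_space)
  then show ?thesis
    by (simp add: circle_mean_def)
qed

lemma circle_mean_add:
  "integrable circ f \<Longrightarrow> integrable circ g \<Longrightarrow>
    circle_mean (\<lambda>t. f t + g t) = circle_mean f + circle_mean g"
  by (simp add: circle_mean_def scaleR_add_right)

lemma circle_mean_diff:
  "integrable circ f \<Longrightarrow> integrable circ g \<Longrightarrow>
    circle_mean (\<lambda>t. f t - g t) = circle_mean f - circle_mean g"
  by (simp add: circle_mean_def scaleR_diff_right)

lemma circle_mean_sum:
  "(\<And>i. i \<in> I \<Longrightarrow> integrable circ (f i)) \<Longrightarrow>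
    circle_mean (\<lambda>t. \<Sum>i\<in>I. f i t) = (\<Sum>i\<in>I. circle_mean (f i))"
  by (simp add: circle_mean_def scaleR_sum_right)

lemma circle_mean_mult_right:
  fixes c :: "'a::{real_normed_field, banach, second_countable_topology}"
  shows "circle_mean (\<lambda>t. c * f t) = c * circle_mean f"
  by (simp add: circle_mean_def)

lemma circle_mean_mult_left:
  fixes c :: "'a::{real_normed_field, banach, second_countable_topology}"
  shows "circle_mean (\<lambda>t. f t * c) = circle_mean f * c"
  by (simp add: circle_mean_def)

lemma circle_mean_mono:
  fixes f g :: "real \<Rightarrow> real"
  assumes "integrable circ f" "integrable circ g" "AE t in circ. f t \<le> g t"
  shows "circle_mean f \<le> circle_mean g"
  unfolding circle_mean_def
  by (simp, intro divide_right_mono integral_mono_AE assms) simp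

lemma circle_mean_nonneg:
  fixes f :: "real \<Rightarrow> real"
  assumes "AE t in circ. 0 \<le> f t"
  shows "0 \<le> circle_mean f"
  unfolding circle_mean_def by (simp add: integral_nonneg_AE assms)

lemma circle_mean_of_real:
  "circle_mean (\<lambda>t. complex_of_real (f t)) = complex_of_real (circle_mean f)"
  by (simp add: circle_mean_def scaleR_conv_of_real)

lemma circle_mean_cnj: "circle_mean (\<lambda>t. cnj (f t)) = cnj (circle_mean f)"
  by (simp add: circle_mean_def)

lemma Re_circle_mean: "integrable circ f \<Longrightarrow> circle_mean (\<lambda>t. Re (f t)) = Re (circle_mean f)"
  by (simp add: circle_mean_def)

lemma norm_circle_mean_le:
  "norm (circle_mean f) \<le> circle_mean (\<lambda>t. norm (f t))"
  unfolding circle_mean_def by (simp, intro divide_right_mono integral_norm_bound) simp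

lemma circle_mean_tendsto:
  fixes s :: "nat \<Rightarrow> real \<Rightarrow> 'a::{banach, second_countable_topology}"
  assumes "\<And>i. s i \<in> borel_measurable circ" "f \<in> borel_measurable circ" "integrable circ w"
    and "AE t in circ. (\<lambda>i. s i t) \<longlonglongrightarrow> f t" "\<And>i. AE t in circ. norm (s i t) \<le> w t"
  shows "(\<lambda>i. circle_mean (s i)) \<longlonglongrightarrow> circle_mean f"
  unfolding circle_mean_def
  by (intro tendsto_scaleR tendsto_const integral_dominated_convergence[where w = w] assms)

lemma circle_mean_suminf:
  fixes F :: "nat \<Rightarrow> real \<Rightarrow> 'a::{banach, second_countable_topology}"
  assumes F: "\<And>n. F n \<in> borel_measurable circ" and g: "integrable circ g"
    and bound: "\<And>n t. norm (F n t) \<le> M n * g t" and M: "summable M"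
  shows "(\<lambda>n. circle_mean (F n)) sums circle_mean (\<lambda>t. \<Sum>n. F n t)"
    and "integrable circ (\<lambda>t. \<Sum>n. F n t)"
proof -
  have int: "integrable circ (F n)" for n
  proof (rule Bochner_Integration.integrable_bound)
    show "integrable circ (\<lambda>t. M n * g t)"
      using g by simp
    show "AE t in circ. norm (F n t) \<le> norm (M n * g t)"
      using bound by (auto intro!: AE_I2 order_trans[OF bound])
  qed (rule F)
  have s1: "AE t in circ. summable (\<lambda>n. norm (F n t))"
  proof (rule AE_I2, rule summable_comparison_test)
    show "\<exists>N. \<forall>n\<ge>N. norm (norm (F n t)) \<le> M n * g t" for t
      using bound by auto
    show "summable (\<lambda>n. M n * g t)" for t
      using M by (rule summable_mult2)
  qed
  have s2: "summable (\<lambda>n. \<integral>t. norm (F n t) \<partial>circ)"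
  proof (rule summable_comparison_test)
    have "(\<integral>t. norm (F n t) \<partial>circ) \<le> (\<integral>t. M n * g t \<partial>circ)" for n
      using int g bound by (intro integral_mono) auto
    then show "\<exists>N. \<forall>n\<ge>N. norm (\<integral>t. norm (F n t) \<partial>circ) \<le> M n * (\<integral>t. g t \<partial>circ)"
      using g by (auto intro!: exI[of _ 0])
    show "summable (\<lambda>n. M n * (\<integral>t. g t \<partial>circ))"
      using M by (rule summable_mult2)
  qed
  show "integrable circ (\<lambda>t. \<Sum>n. F n t)"
    by (rule integrable_suminf[OF int s1 s2])
  show "(\<lambda>n. circle_mean (F n)) sums circle_mean (\<lambda>t. \<Sum>n. F n t)"
    unfolding circle_mean_def using sums_integral[OF int s1 s2]
    by (intro sums_scaleR_right)
qed

lemma circle_mean_cis_int: "circle_mean (\<lambda>t. cis (of_int k * t)) = of_bool (k = 0)"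
proof (cases "k = 0")
  case False
  have cont: "continuous_on UNIV (\<lambda>t. cis (of_int k * t))"
    by (intro continuous_intros)
  have "((\<lambda>t. cis (of_int k * t) / (\<i> * of_int k)) has_vector_derivative cis (of_int k * t)) (at t within {0..2*pi})"
    for t :: real
    unfolding has_vector_derivative_def
    by (rule derivative_eq_intros refl | simp)+
      (use False in \<open>auto simp: fun_eq_iff scaleR_conv_of_real field_simps\<close>)
  then have "((\<lambda>t. cis (of_int k * t)) has_integral
      (cis (of_int k * (2 * pi)) / (\<i> * of_int k) - cis (of_int k * 0) / (\<i> * of_int k))) {0..2*pi}"
    by (intro fundamental_theorem_of_calculus) auto
  moreover have "cis (of_int k * (2 * pi)) = 1"
    using cis_multiple_2pi[of "of_int k"] by (simp add: mult.commute)
  ultimately have "integral {0..2*pi} (\<lambda>t. cis (of_int k * t)) = 0"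
    by (simp add: integral_unique)
  then show ?thesis
    using False lebesgue_integral_eq_integral[OF integrable_circ_continuous[OF cont]]
    by (simp add: circle_mean_def)
qed simp

lemma circle_mean_cis_power:
  "circle_mean (\<lambda>t. cis t ^ n * cnj (cis t ^ m)) = of_bool (n = m)"
proof -
  have "cis t ^ n * cnj (cis t ^ m) = cis (of_int (int n - int m) * t)" for t
    by (simp add: Complex.DeMoivre cis_cnj cis_mult left_diff_distrib)
  then show ?thesis
    by (simp only: circle_mean_cis_int) simp
qed

lemma continuous_on_cis_series:
  fixes a :: "nat \<Rightarrow> complex"
  assumes "summable (\<lambda>n. cmod (a n))"
  shows "continuous_on UNIV (\<lambda>t. \<Sum>n. a n * cis t ^ n)"
proof (rule uniform_limit_theorem)
  show "uniform_limit UNIV (\<lambda>N t. \<Sum>n<N. a n * cis t ^ n) (\<lambda>t. \<Sum>n. a n * cis t ^ n) sequentially"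
    by (rule Weierstrass_m_test[OF _ assms]) (simp add: norm_mult norm_power)
qed (auto intro!: always_eventually continuous_intros)

lemma cis_series_bound:
  fixes a :: "nat \<Rightarrow> complex"
  assumes "summable (\<lambda>n. cmod (a n))"
  shows "cmod (\<Sum>n. a n * cis t ^ n) \<le> (\<Sum>n. cmod (a n))"
  using summable_norm[of "\<lambda>n. a n * cis t ^ n"] assms by (simp add: norm_mult norm_power)

lemma circle_mean_cis_series:
  fixes a :: "nat \<Rightarrow> complex"
  assumes a: "summable (\<lambda>n. cmod (a n))" and h: "integrable circ h"
  shows "(\<lambda>n. a n * circle_mean (\<lambda>t. cis t ^ n * h t))
      sums circle_mean (\<lambda>t. (\<Sum>n. a n * cis t ^ n) * h t)"
proof -
  have cis: "(\<lambda>t. cis t ^ n) \<in> borel_measurable circ" for n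
    by (intro measurable_circ_continuous continuous_intros)
  have h': "h \<in> borel_measurable circ"
    using h by auto
  have "(\<lambda>n. circle_mean (\<lambda>t. a n * (cis t ^ n * h t)))
      sums circle_mean (\<lambda>t. \<Sum>n. a n * (cis t ^ n * h t))"
  proof (rule circle_mean_suminf(1)[where M = "\<lambda>n. cmod (a n)" and g = "\<lambda>t. cmod (h t)"])
    show "(\<lambda>t. a n * (cis t ^ n * h t)) \<in> borel_measurable circ" for n
      by (intro borel_measurable_times cis h' borel_measurable_const)
  qed (use h a in \<open>simp_all add: norm_mult norm_power\<close>)
  moreover have "(\<Sum>n. a n * (cis t ^ n * h t)) = (\<Sum>n. a n * cis t ^ n) * h t" for t
  proof -
    have "summable (\<lambda>n. a n * cis t ^ n)"
      by (rule summable_norm_cancel) (simp add: norm_mult norm_power a)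
    then show ?thesis
      by (subst suminf_mult2) (auto simp: mult_ac)
  qed
  ultimately show ?thesis
    by (simp add: circle_mean_mult_right)
qed

lemma sums_of_bool_mult: "(\<lambda>n. of_bool (n = m) * f n) sums f m" for f :: "nat \<Rightarrow> complex"
proof -
  have "(\<lambda>n. of_bool (n = m) * f n) = (\<lambda>n. if n = m then f n else 0)"
    by auto
  then show ?thesis
    using sums_single[of m f] by simp
qed

lemma summable_cmod_of_bool: "summable (\<lambda>n::nat. cmod (of_bool (n = m)))"
  by (rule summable_finite[of "{m}"]) auto

lemma circle_mean_cis_power_cnj_series:
  fixes b :: "nat \<Rightarrow> complex"
  assumes b: "summable (\<lambda>n. cmod (b n))"
  shows "circle_mean (\<lambda>t. cis t ^ n * cnj (\<Sum>m. b m * cis t ^ m)) = cnj (b n)"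
proof -
  have "(\<lambda>m. b m * circle_mean (\<lambda>t. cis t ^ m * cnj (cis t ^ n)))
    sums circle_mean (\<lambda>t. (\<Sum>m. b m * cis t ^ m) * cnj (cis t ^ n))"
    by (rule circle_mean_cis_series[OF b]) (intro integrable_circ_continuous continuous_intros)
  moreover have "(\<lambda>m. b m * circle_mean (\<lambda>t. cis t ^ m * cnj (cis t ^ n))) sums b n"
    unfolding circle_mean_cis_power using sums_of_bool_mult[of n b] by (simp add: mult.commute)
  ultimately have "circle_mean (\<lambda>t. (\<Sum>m. b m * cis t ^ m) * cnj (cis t ^ n)) = b n"
    by (rule sums_unique2)
  then have "cnj (circle_mean (\<lambda>t. (\<Sum>m. b m * cis t ^ m) * cnj (cis t ^ n))) = cnj (b n)"
    by simp
  then show ?thesis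
    unfolding circle_mean_cnj[symmetric] by (simp add: mult.commute)
qed

lemma circle_mean_parseval:
  fixes a b :: "nat \<Rightarrow> complex"
  assumes a: "summable (\<lambda>n. cmod (a n))" and b: "summable (\<lambda>n. cmod (b n))"
  shows "(\<lambda>n. a n * cnj (b n)) sums
    circle_mean (\<lambda>t. (\<Sum>n. a n * cis t ^ n) * cnj (\<Sum>n. b n * cis t ^ n))"
proof -
  have "integrable circ (\<lambda>t. cnj (\<Sum>m. b m * cis t ^ m))"
    by (intro integrable_circ_continuous continuous_on_cnj continuous_on_cis_series b)
  from circle_mean_cis_series[OF a this] show ?thesis
    by (simp only: circle_mean_cis_power_cnj_series[OF b])
qed

lemma circle_mean_analytic_mult:
  fixes a b :: "nat \<Rightarrow> complex"
  assumes a: "summable (\<lambda>n. cmod (a n))" and b: "summable (\<lambda>n. cmod (b n))"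
  shows "circle_mean (\<lambda>t. (\<Sum>n. a n * cis t ^ n) * (\<Sum>n. b n * cis t ^ n)) = a 0 * b 0"
proof -
  have "circle_mean (\<lambda>t. cis t ^ n * (\<Sum>m. b m * cis t ^ m)) = of_bool (n = 0) * b 0" for n
  proof -
    have "(\<lambda>m. b m * circle_mean (\<lambda>t. cis t ^ m * cis t ^ n))
      sums circle_mean (\<lambda>t. (\<Sum>m. b m * cis t ^ m) * cis t ^ n)"
      by (rule circle_mean_cis_series[OF b]) (intro integrable_circ_continuous continuous_intros)
    moreover have "circle_mean (\<lambda>t. cis t ^ m * cis t ^ n) = of_bool (m = 0 \<and> n = 0)" for m
      using circle_mean_cis_power[of "m + n" 0] by (simp add: power_add)
    moreover have "(\<lambda>m. b m * of_bool (m = 0 \<and> n = 0)) sums (of_bool (n = 0) * b 0)"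
      using sums_mult[OF sums_of_bool_mult[of 0 b], of "of_bool (n = 0)"] by (simp add: of_bool_conj mult_ac)
    ultimately show ?thesis
      by (simp add: mult.commute sums_unique2)
  qed
  moreover have "integrable circ (\<lambda>t. (\<Sum>m. b m * cis t ^ m))"
    by (intro integrable_circ_continuous continuous_on_cis_series b)
  from circle_mean_cis_series[OF a this]
  have "(\<lambda>n. a n * circle_mean (\<lambda>t. cis t ^ n * (\<Sum>m. b m * cis t ^ m))) sums
      circle_mean (\<lambda>t. (\<Sum>n. a n * cis t ^ n) * (\<Sum>n. b n * cis t ^ n))" .
  ultimately have "(\<lambda>n. a n * (of_bool (n = 0) * b 0)) sums
      circle_mean (\<lambda>t. (\<Sum>n. a n * cis t ^ n) * (\<Sum>n. b n * cis t ^ n))"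
    by simp
  moreover have "(\<lambda>n. a n * (of_bool (n = 0) * b 0)) sums (a 0 * b 0)"
    using sums_of_bool_mult[of 0 "\<lambda>n. a n * b 0"] by (simp add: mult_ac)
  ultimately show ?thesis
    by (rule sums_unique2)
qed

subsection \<open>Power series on the disc\<close>

definition radius :: "nat \<Rightarrow> real" where
  "radius k = 1 - 1 / real (k + 2)"

lemma radius_bounds: "0 \<le> radius k" "radius k < 1"
  by (auto simp: radius_def)

lemma tendsto_radius: "radius \<longlonglongrightarrow> 1"
  unfolding radius_def using LIMSEQ_ignore_initial_segment[OF lim_1_over_n, of 2]
  by (intro tendsto_eq_rhs[OF tendsto_diff[OF tendsto_const]]) auto

lemma radius_at_left: "filterlim radius (at_left 1) sequentially"
  using tendsto_radius less_imp_neq[OF radius_bounds(2)] radius_bounds(2)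
  by (auto simp: filterlim_at intro!: always_eventually)

lemma eventually_at_left_1: "\<forall>\<^sub>F r in at_left (1::real). 0 < r \<and> r < 1"
  unfolding eventually_at_left_field by (rule exI[of _ 0]) auto

lemma powser_summable_cmod:
  fixes a :: "nat \<Rightarrow> complex"
  assumes "\<And>z. cmod z < 1 \<Longrightarrow> summable (\<lambda>n. a n * z ^ n)" and "cmod z < 1"
  shows "summable (\<lambda>n. cmod (a n * z ^ n))"
proof -
  define r where "r = (cmod z + 1) / 2"
  show ?thesis
  proof (rule powser_insidea)
    show "summable (\<lambda>n. a n * of_real r ^ n)" "norm z < norm (complex_of_real r)"
      using assms by (auto simp: r_def)
  qed
qed

lemma powser_circle:
  "(\<Sum>n. a n * (of_real r * cis t) ^ n) = (\<Sum>n. (a n * of_real r ^ n) * cis t ^ n)"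
  by (simp add: power_mult_distrib mult.assoc)

lemma powser_parseval:
  fixes a :: "nat \<Rightarrow> complex"
  assumes a: "\<And>z. cmod z < 1 \<Longrightarrow> (\<lambda>n. a n * z ^ n) sums g z" and r: "0 \<le> r" "r < 1"
  shows "(\<lambda>n. (cmod (a n))\<^sup>2 * r ^ (2 * n)) sums circle_mean (\<lambda>t. (cmod (g (of_real r * cis t)))\<^sup>2)"
proof -
  have s: "summable (\<lambda>n. cmod (a n * of_real r ^ n))"
    using a r by (intro powser_summable_cmod) (auto simp: sums_iff)
  have "g (of_real r * cis t) = (\<Sum>n. (a n * of_real r ^ n) * cis t ^ n)" for t
    using a[of "of_real r * cis t"] r unfolding powser_circle[symmetric] by (simp add: sums_iff norm_mult)
  then have "(\<lambda>n. (a n * of_real r ^ n) * cnj (a n * of_real r ^ n)) sums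
      circle_mean (\<lambda>t. g (of_real r * cis t) * cnj (g (of_real r * cis t)))"
    using circle_mean_parseval[OF s s] by simp
  moreover have "(a n * of_real r ^ n) * cnj (a n * of_real r ^ n)
      = complex_of_real ((cmod (a n))\<^sup>2 * r ^ (2 * n))" for n
    using r unfolding complex_norm_square[symmetric]
    by (simp add: norm_mult norm_power power_mult_distrib power_mult mult.commute[of 2 n])
  moreover have "g w * cnj (g w) = complex_of_real ((cmod (g w))\<^sup>2)" for w
    by (simp only: complex_norm_square[symmetric] of_real_power)
  ultimately have "(\<lambda>n. complex_of_real ((cmod (a n))\<^sup>2 * r ^ (2 * n))) sums
      complex_of_real (circle_mean (\<lambda>t. (cmod (g (of_real r * cis t)))\<^sup>2))"
    by (simp only: circle_mean_of_real)
  then show ?thesis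
    by (rule sums_of_real_iff[THEN iffD1])
qed

lemma powser_coeff_zero:
  fixes a :: "nat \<Rightarrow> complex"
  assumes "\<And>z. cmod z < 1 \<Longrightarrow> (\<lambda>n. a n * z ^ n) sums 0"
  shows "a n = 0"
proof -
  have s: "(\<lambda>n. (cmod (a n))\<^sup>2 * (1/2) ^ (2 * n)) sums 0"
    using powser_parseval[of a "\<lambda>_. 0" "1/2", OF assms] by simp
  then have "(cmod (a n))\<^sup>2 * (1/2) ^ (2 * n) = 0"
    using suminf_eq_zero_iff[OF sums_summable[OF s]] sums_unique[OF s] by auto
  then show ?thesis
    by simp
qed

lemma summable_sq_of_circle_means:
  fixes a :: "nat \<Rightarrow> complex"
  assumes a: "\<And>z. cmod z < 1 \<Longrightarrow> (\<lambda>n. a n * z ^ n) sums g z"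
    and bound: "\<And>r. 0 \<le> r \<Longrightarrow> r < 1 \<Longrightarrow> circle_mean (\<lambda>t. (cmod (g (of_real r * cis t)))\<^sup>2) \<le> C"
  shows "summable (\<lambda>n. (cmod (a n))\<^sup>2)" "(\<Sum>n. (cmod (a n))\<^sup>2) \<le> C"
proof -
  have le: "(\<Sum>n<N. (cmod (a n))\<^sup>2) \<le> C" for N
  proof (rule tendsto_upperbound)
    show "((\<lambda>r. \<Sum>n<N. (cmod (a n))\<^sup>2 * r ^ (2 * n)) \<longlongrightarrow> (\<Sum>n<N. (cmod (a n))\<^sup>2)) (at_left 1)"
      by (auto intro!: tendsto_eq_intros)
    show "\<forall>\<^sub>F r in at_left 1. (\<Sum>n<N. (cmod (a n))\<^sup>2 * r ^ (2 * n)) \<le> C"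
      unfolding eventually_at_left_field
    proof (intro exI[of _ 0] conjI allI impI)
      fix r :: real assume r: "0 < r" "r < 1"
      have "(\<Sum>n<N. (cmod (a n))\<^sup>2 * r ^ (2 * n)) \<le> (\<Sum>n. (cmod (a n))\<^sup>2 * r ^ (2 * n))"
        using powser_parseval[OF a, of r] r by (intro sum_le_suminf) (auto simp: sums_iff)
      also have "\<dots> \<le> C"
        using powser_parseval[OF a, of r] bound[of r] r by (simp add: sums_iff)
      finally show "(\<Sum>n<N. (cmod (a n))\<^sup>2 * r ^ (2 * n)) \<le> C" .
    qed simp
  qed simp
  then show "summable (\<lambda>n. (cmod (a n))\<^sup>2)"
    by (intro bounded_imp_summable[where B = C])
      (auto simp: lessThan_Suc_atMost[symmetric] simp del: sum.lessThan_Suc)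
  then show "(\<Sum>n. (cmod (a n))\<^sup>2) \<le> C"
    using le by (rule suminf_le_const)
qed

lemma holomorphic_disc_powser:
  assumes "g holomorphic_on ball 0 1"
  obtains a where "\<And>z. cmod z < 1 \<Longrightarrow> (\<lambda>n. a n * z ^ n) sums g z"
  using holomorphic_power_series[OF assms] that[of "\<lambda>n. (deriv ^^ n) g 0 / fact n"] by simp

lemma powser_holomorphic_disc:
  assumes "\<And>z. cmod z < 1 \<Longrightarrow> (\<lambda>n. a n * z ^ n) sums g z"
  shows "g holomorphic_on ball 0 1"
  using power_series_analytic[of 0 1 a g] assms by (simp add: analytic_imp_holomorphic)

lemma holomorphic_circle_continuous:
  assumes "g holomorphic_on ball 0 1" "0 \<le> r" "r < 1"
  shows "continuous_on UNIV (\<lambda>t. g (of_real r * cis t))"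
  by (rule continuous_on_compose2[OF holomorphic_on_imp_continuous_on[OF assms(1)]])
    (use assms in \<open>auto intro!: continuous_intros simp: norm_mult\<close>)

section \<open>Multiplication operators on Hardy spaces\<close>

lift_definition hardy_shift :: "'a::complex_hilbert hardy \<Rightarrow> 'a hardy"
  is "\<lambda>a n. case n of 0 \<Rightarrow> 0 | Suc m \<Rightarrow> a m"
  by (subst summable_Suc_iff[symmetric]) simp

lift_definition hardy_trunc :: "nat \<Rightarrow> 'a::complex_hilbert hardy \<Rightarrow> 'a hardy"
  is "\<lambda>N a n. if n < N then a n else 0"
  by (rule summable_finite[of "{..<_}"]) auto

lift_definition hardy_const :: "'a \<Rightarrow> 'a::complex_hilbert hardy"
  is "\<lambda>x n. if n = 0 then x else 0"
  by (rule summable_finite[of "{0}"]) auto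

lemma hardy_coeff_shift [simp]:
  "hardy_coeff (hardy_shift f) 0 = 0" "hardy_coeff (hardy_shift f) (Suc n) = hardy_coeff f n"
  by (simp_all add: hardy_shift.rep_eq)

lemma backward_shift_shift [simp]: "backward_shift (hardy_shift f) = f"
  by (rule hardy_eqI) (simp add: backward_shift.rep_eq)

lemma norm_hardy_shift [simp]: "norm (hardy_shift f) = norm f"
proof -
  have "(norm (hardy_shift f))\<^sup>2 = (norm f)\<^sup>2"
    unfolding norm_hardy_sq using suminf_split_head[OF summable_hardy[of "hardy_shift f"]] by simp
  then show ?thesis
    by simp
qed

lemma norm_backward_shift_le: "norm (backward_shift f) \<le> norm f"
proof -
  have "(norm (backward_shift f))\<^sup>2 \<le> (norm f)\<^sup>2"
    unfolding norm_hardy_sq using suminf_split_head[OF summable_hardy[of f]]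
    by (simp add: backward_shift.rep_eq)
  then show ?thesis
    by simp
qed

lemma bounded_clinear_hardy_shift: "bounded_clinear hardy_shift"
  by (rule bounded_clinearI[where K = 1])
    (auto intro!: hardy_eqI simp: hardy_shift.rep_eq hardy_coeff_simps hardy_coeff_scaleC split: nat.split)

lemma bounded_clinear_backward_shift: "bounded_clinear backward_shift"
  by (rule bounded_clinearI[where K = 1])
    (auto intro!: hardy_eqI simp: backward_shift.rep_eq hardy_coeff_simps hardy_coeff_scaleC
      norm_backward_shift_le)

lemma cinner_hardy_shift: "cinner (hardy_shift f) g = cinner f (backward_shift g)"
proof -
  have "(\<Sum>n. cinner (hardy_coeff (hardy_shift f) (Suc n)) (hardy_coeff g (Suc n)))
      = (\<Sum>n. cinner (hardy_coeff (hardy_shift f) n) (hardy_coeff g n))"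
    using suminf_split_head[OF summable_cinner[OF summable_hardy[of "hardy_shift f"] summable_hardy[of g]]]
    by simp
  then show ?thesis
    by (simp add: cinner_hardy.rep_eq backward_shift.rep_eq)
qed

lemma hardy_trunc_tendsto: "(\<lambda>N. hardy_trunc N f) \<longlonglongrightarrow> f"
proof -
  have sq: "(norm (f - hardy_trunc N f))\<^sup>2 = (norm f)\<^sup>2 - (\<Sum>n<N. (norm (hardy_coeff f n))\<^sup>2)" for N
  proof -
    have "(norm (f - hardy_trunc N f))\<^sup>2
        = (\<Sum>n. (norm (hardy_coeff f n))\<^sup>2 - (if n \<in> {..<N} then (norm (hardy_coeff f n))\<^sup>2 else 0))"
      unfolding norm_hardy_sq by (intro suminf_cong) (auto simp: hardy_coeff_simps hardy_trunc.rep_eq)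
    also have "\<dots> = (norm f)\<^sup>2 - (\<Sum>n<N. (norm (hardy_coeff f n))\<^sup>2)"
      unfolding norm_hardy_sq
      by (rule sums_unique[symmetric], rule sums_diff[OF summable_sums[OF summable_hardy]])
        (rule sums_If_finite_set, simp)
    finally show ?thesis .
  qed
  have "(\<lambda>N. \<Sum>n<N. (norm (hardy_coeff f n))\<^sup>2) \<longlonglongrightarrow> (norm f)\<^sup>2"
    unfolding norm_hardy_sq using summable_hardy[of f] by (rule summable_LIMSEQ)
  then have "(\<lambda>N. (norm f)\<^sup>2 - (\<Sum>n<N. (norm (hardy_coeff f n))\<^sup>2)) \<longlonglongrightarrow> (norm f)\<^sup>2 - (norm f)\<^sup>2"
    by (intro tendsto_diff tendsto_const)
  then have "(\<lambda>N. (norm (f - hardy_trunc N f))\<^sup>2) \<longlonglongrightarrow> 0"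
    by (simp add: sq)
  then have "(\<lambda>N. norm (f - hardy_trunc N f)) \<longlonglongrightarrow> 0"
    using tendsto_real_sqrt by fastforce
  then have "(\<lambda>N. f - hardy_trunc N f) \<longlonglongrightarrow> 0"
    by (rule tendsto_norm_zero_cancel)
  then have "(\<lambda>N. f - (f - hardy_trunc N f)) \<longlonglongrightarrow> f - 0"
    by (intro tendsto_diff tendsto_const)
  then show ?thesis
    by simp
qed

lemma hardy_eval_trunc: "hardy_eval (hardy_trunc N f) z = (\<Sum>n<N. z ^ n *\<^sub>C hardy_coeff f n)"
proof -
  have "(\<lambda>n. if n \<in> {..<N} then z ^ n *\<^sub>C hardy_coeff f n else 0)
      = (\<lambda>n. z ^ n *\<^sub>C hardy_coeff (hardy_trunc N f) n)"
    by (auto simp: hardy_trunc.rep_eq)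
  then show ?thesis
    unfolding hardy_eval_def using sums_If_finite_set[of "{..<N}" "\<lambda>n. z ^ n *\<^sub>C hardy_coeff f n"]
    by (simp add: sums_iff)
qed

lemma hardy_eval_add:
  "cmod z < 1 \<Longrightarrow> hardy_eval (f + g) z = hardy_eval f z + hardy_eval g z"
  using sums_add[OF hardy_eval_sums[of z f] hardy_eval_sums[of z g]] hardy_eval_sums[of z "f + g"]
  by (simp add: hardy_coeff_simps scaleC_add_right sums_unique2)

lemma hardy_eval_scaleC:
  assumes "cmod z < 1"
  shows "hardy_eval (c *\<^sub>C f) z = c *\<^sub>C hardy_eval f z"
proof -
  have "(\<lambda>n. z ^ n *\<^sub>C hardy_coeff (c *\<^sub>C f) n) sums (c *\<^sub>C hardy_eval f z)"
    using bounded_linear.sums[OF bounded_linear_scaleC[of c] hardy_eval_sums[OF assms, of f]]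
    by (simp add: hardy_coeff_scaleC scaleC_scaleC mult.commute)
  then show ?thesis
    using hardy_eval_sums[OF assms, of "c *\<^sub>C f"] sums_unique2 by blast
qed

lemma hardy_eval_diff:
  "cmod z < 1 \<Longrightarrow> hardy_eval (f - g) z = hardy_eval f z - hardy_eval g z"
  using hardy_eval_add[of z "f - g" g] by simp

lemma hardy_eval_shift:
  assumes "cmod z < 1"
  shows "hardy_eval (hardy_shift f) z = z *\<^sub>C hardy_eval f z"
proof -
  have "(\<lambda>n. z ^ Suc n *\<^sub>C hardy_coeff (hardy_shift f) (Suc n)) sums (z *\<^sub>C hardy_eval f z)"
    using bounded_linear.sums[OF bounded_linear_scaleC[of z] hardy_eval_sums[OF assms, of f]]
    by (simp add: scaleC_scaleC)
  then have "(\<lambda>n. z ^ n *\<^sub>C hardy_coeff (hardy_shift f) n) sums (z *\<^sub>C hardy_eval f z)"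
    using sums_Suc_iff[of "\<lambda>n. z ^ n *\<^sub>C hardy_coeff (hardy_shift f) n"] by simp
  then show ?thesis
    using hardy_eval_sums[OF assms, of "hardy_shift f"] sums_unique2 by blast
qed

lemma hardy_eval_const: "hardy_eval (hardy_const x) z = x"
proof -
  have "(\<lambda>n. z ^ n *\<^sub>C hardy_coeff (hardy_const x) n) = (\<lambda>n. if n = 0 then x else 0)"
    by (auto simp: hardy_const.rep_eq scaleC_one)
  then show ?thesis
    using sums_single[of 0 "\<lambda>_. x"] by (simp add: hardy_eval_def sums_iff)
qed

lemma norm_hardy_eval_le:
  assumes "cmod z < 1"
  shows "norm (hardy_eval f z) \<le> norm f / (1 - cmod z)"
proof -
  have s: "summable (\<lambda>n. cmod z ^ n * norm f)"
    using assms by (intro summable_mult2 summable_geometric) simp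
  have le: "norm (z ^ n *\<^sub>C hardy_coeff f n) \<le> cmod z ^ n * norm f" for n
    by (simp add: norm_scaleC norm_power mult_left_mono norm_coeff_le)
  have "norm (hardy_eval f z) \<le> (\<Sum>n. cmod z ^ n * norm f)"
    unfolding hardy_eval_def by (rule norm_suminf_le[OF le s])
  also have "\<dots> = norm f / (1 - cmod z)"
    using assms by (subst suminf_mult2[symmetric]) (auto simp: suminf_geometric summable_geometric)
  finally show ?thesis .
qed

lemma hardy_eval_sums_complex:
  assumes "cmod z < 1"
  shows "(\<lambda>n. hardy_coeff f n * z ^ n) sums hardy_eval f z"
  using hardy_eval_sums[OF assms, of f] by (simp add: scaleC_complex_def mult.commute)

lemma holomorphic_hardy_eval: "hardy_eval f holomorphic_on ball 0 1" for f :: "complex hardy"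
  using powser_holomorphic_disc[OF hardy_eval_sums_complex] .

lemma hardy_eval_inject:
  fixes f g :: "complex hardy"
  assumes "\<And>z. cmod z < 1 \<Longrightarrow> hardy_eval f z = hardy_eval g z"
  shows "f = g"
proof (rule hardy_eqI)
  fix n
  have "(\<lambda>n. hardy_coeff (f - g) n * z ^ n) sums 0" if "cmod z < 1" for z
    using hardy_eval_sums_complex[OF that, of "f - g"] assms[OF that] by (simp add: hardy_eval_diff that)
  then have "hardy_coeff (f - g) n = 0"
    by (rule powser_coeff_zero)
  then show "hardy_coeff f n = hardy_coeff g n"
    by (simp add: hardy_coeff_simps)
qed

lemma continuous_on_hardy_eval_circle:
  fixes f :: "'a::complex_hilbert hardy"
  assumes r: "0 \<le> r" "r < 1"
  shows "continuous_on UNIV (\<lambda>t. hardy_eval f (of_real r * cis t))"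
  unfolding hardy_eval_def
proof (rule uniform_limit_theorem)
  show "uniform_limit UNIV (\<lambda>N t. \<Sum>n<N. (of_real r * cis t) ^ n *\<^sub>C hardy_coeff f n)
      (\<lambda>t. \<Sum>n. (of_real r * cis t) ^ n *\<^sub>C hardy_coeff f n) sequentially"
  proof (rule Weierstrass_m_test)
    show "norm ((of_real r * cis t) ^ n *\<^sub>C hardy_coeff f n) \<le> r ^ n * norm f" for n t
      using r by (simp add: norm_scaleC norm_power norm_mult mult_left_mono norm_coeff_le)
    show "summable (\<lambda>n. r ^ n * norm f)"
      using r by (intro summable_mult2 summable_geometric) simp
  qed
  show "\<forall>\<^sub>F N in sequentially. continuous_on UNIV
      (\<lambda>t. \<Sum>n<N. (of_real r * cis t) ^ n *\<^sub>C hardy_coeff f n)"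
    by (intro always_eventually allI continuous_on_sum bounded_linear.continuous_on[OF bounded_linear_scaleC_left])
      (intro continuous_intros)
qed simp

lemma circle_mean_norm_hardy_eval:
  fixes f :: "'a::complex_hilbert hardy"
  assumes r: "0 \<le> r" "r < 1"
  shows "circle_mean (\<lambda>t. (norm (hardy_eval f (of_real r * cis t)))\<^sup>2) \<le> (norm f)\<^sup>2"
proof -
  define z where "z t = of_real r * cis t" for t
  have z: "cmod (z t) < 1" "cmod (z t) = r" for t
    using r by (auto simp: z_def norm_mult)
  have coeff: "summable (\<lambda>m. cmod (of_real r ^ m * cinner (hardy_coeff f m) x))" for x
  proof (rule summable_comparison_test)
    show "\<exists>N. \<forall>m\<ge>N. norm (cmod (of_real r ^ m * cinner (hardy_coeff f m) x)) \<le> r ^ m * (norm f * norm x)"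
      using r by (auto simp: norm_mult norm_power
          intro!: mult_left_mono order_trans[OF norm_cinner_le] mult_right_mono norm_coeff_le)
    show "summable (\<lambda>m. r ^ m * (norm f * norm x))"
      using r by (intro summable_mult2 summable_geometric) simp
  qed
  have eval: "cinner (hardy_eval f (z t)) x = (\<Sum>m. (of_real r ^ m * cinner (hardy_coeff f m) x) * cis t ^ m)"
    for t x
  proof -
    have "(\<lambda>m. cinner (z t ^ m *\<^sub>C hardy_coeff f m) x) sums cinner (hardy_eval f (z t)) x"
      by (rule bounded_linear.sums[OF bounded_linear_cinner_left hardy_eval_sums[OF z(1)]])
    then show ?thesis
      by (simp add: sums_iff cinner_scaleC_left z_def power_mult_distrib mult_ac)
  qed
  have mean_coeff: "circle_mean (\<lambda>t. cis t ^ n * cinner (hardy_coeff f n) (hardy_eval f (z t)))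
      = of_real (r ^ n * (norm (hardy_coeff f n))\<^sup>2)" for n
  proof -
    have "circle_mean (\<lambda>t. cis t ^ n * cnj (cinner (hardy_eval f (z t)) (hardy_coeff f n)))
        = cnj (of_real r ^ n * cinner (hardy_coeff f n) (hardy_coeff f n))"
      unfolding eval by (rule circle_mean_cis_power_cnj_series[OF coeff])
    then show ?thesis
      by (simp add: cinner_commute[of "hardy_coeff f n" "hardy_eval f (z _)"] cinner_self)
  qed
  have cont: "continuous_on UNIV (\<lambda>t. hardy_eval f (z t))"
    unfolding z_def by (rule continuous_on_hardy_eval_circle[OF r])
  have "(\<lambda>n. circle_mean (\<lambda>t. of_real r ^ n * (cis t ^ n * cinner (hardy_coeff f n) (hardy_eval f (z t)))))
      sums circle_mean (\<lambda>t. \<Sum>n. of_real r ^ n * (cis t ^ n * cinner (hardy_coeff f n) (hardy_eval f (z t))))"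
  proof (rule circle_mean_suminf(1)[where M = "\<lambda>n. r ^ n * (norm f * (norm f / (1 - r)))" and g = "\<lambda>_. 1"])
    have "continuous_on UNIV (\<lambda>t. cinner (hardy_coeff f n) (hardy_eval f (z t)))" for n
      by (rule bounded_linear.continuous_on[OF bounded_linear_cinner_right cont])
    then show "(\<lambda>t. of_real r ^ n * (cis t ^ n * cinner (hardy_coeff f n) (hardy_eval f (z t))))
        \<in> borel_measurable circ" for n
      by (intro measurable_circ_continuous continuous_intros)
    have "cmod (cinner (hardy_coeff f n) (hardy_eval f (z t))) \<le> norm f * (norm f / (1 - r))" for n t
      using norm_hardy_eval_le[OF z(1), of f t] z(2) r
      by (intro order_trans[OF norm_cinner_le] mult_mono norm_coeff_le) auto
    then show "cmod (of_real r ^ n * (cis t ^ n * cinner (hardy_coeff f n) (hardy_eval f (z t))))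
        \<le> r ^ n * (norm f * (norm f / (1 - r))) * 1" for n t
      using r mult_left_mono[of "cmod (cinner (hardy_coeff f n) (hardy_eval f (z t)))"
          "norm f * (norm f / (1 - r))" "r ^ n"] by (simp add: norm_mult norm_power)
    show "summable (\<lambda>n. r ^ n * (norm f * (norm f / (1 - r))))"
      using r by (intro summable_mult2 summable_geometric) simp
  qed simp
  moreover have "(\<Sum>n. of_real r ^ n * (cis t ^ n * cinner (hardy_coeff f n) (hardy_eval f (z t))))
      = of_real ((norm (hardy_eval f (z t)))\<^sup>2)" for t
    using eval[of t "hardy_eval f (z t)"] by (simp add: cinner_self mult_ac)
  ultimately have "(\<lambda>n. complex_of_real (r ^ n * (r ^ n * (norm (hardy_coeff f n))\<^sup>2)))
      sums complex_of_real (circle_mean (\<lambda>t. (norm (hardy_eval f (z t)))\<^sup>2))"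
    unfolding circle_mean_of_real[symmetric]
    by (simp only: circle_mean_mult_right mean_coeff of_real_mult of_real_power)
  then have s: "(\<lambda>n. r ^ n * (r ^ n * (norm (hardy_coeff f n))\<^sup>2))
      sums circle_mean (\<lambda>t. (norm (hardy_eval f (z t)))\<^sup>2)"
    by (rule sums_of_real_iff[THEN iffD1])
  have "r ^ n * (r ^ n * (norm (hardy_coeff f n))\<^sup>2) \<le> (norm (hardy_coeff f n))\<^sup>2" for n
  proof -
    have "r ^ n * r ^ n \<le> 1 * 1"
      using r by (intro mult_mono) (auto simp: power_le_one)
    then show ?thesis
      using mult_right_mono[of "r ^ n * r ^ n" 1 "(norm (hardy_coeff f n))\<^sup>2"] by (simp add: mult.assoc)
  qed
  then have "circle_mean (\<lambda>t. (norm (hardy_eval f (z t)))\<^sup>2) \<le> (\<Sum>n. (norm (hardy_coeff f n))\<^sup>2)"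
    unfolding sums_unique[OF s] by (intro suminf_le sums_summable[OF s] summable_hardy)
  then show ?thesis
    unfolding norm_hardy_sq z_def .
qed

lemma hardy_of_holomorphic:
  assumes g: "g holomorphic_on ball 0 1" and "0 \<le> C"
    and bound: "\<And>r. 0 \<le> r \<Longrightarrow> r < 1 \<Longrightarrow> circle_mean (\<lambda>t. (cmod (g (of_real r * cis t)))\<^sup>2) \<le> C\<^sup>2"
  obtains h where "norm h \<le> C" "\<And>z. cmod z < 1 \<Longrightarrow> hardy_eval h z = g z"
proof -
  obtain a where a: "\<And>z. cmod z < 1 \<Longrightarrow> (\<lambda>n. a n * z ^ n) sums g z"
    using holomorphic_disc_powser[OF g] by metis
  note s = summable_sq_of_circle_means[of a g "C\<^sup>2", OF a bound]
  have coeff: "hardy_coeff (Hardy a) = a"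
    using s(1) by (simp add: Hardy_inverse)
  have "(norm (Hardy a))\<^sup>2 \<le> C\<^sup>2"
    using s(2) unfolding norm_hardy_sq coeff by simp
  then have "norm (Hardy a) \<le> C"
    using \<open>0 \<le> C\<close> by (rule power2_le_imp_le)
  moreover have "hardy_eval (Hardy a) z = g z" if "cmod z < 1" for z
    using hardy_eval_sums_complex[OF that, of "Hardy a"] a[OF that] unfolding coeff by (rule sums_unique2)
  ultimately show thesis
    by (rule that)
qed

locale analytic_contraction =
  fixes B :: "complex \<Rightarrow> 'd::complex_hilbert \<Rightarrow> complex"
  assumes bounded: "cmod z < 1 \<Longrightarrow> bounded_clinear (B z)"
    and contraction: "cmod z < 1 \<Longrightarrow> cmod (B z x) \<le> norm x"
    and holomorphic: "(\<lambda>z. B z x) holomorphic_on ball 0 1"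
begin

lemma holomorphic_apply: "(\<lambda>z. B z (hardy_eval f z)) holomorphic_on ball 0 1"
proof (rule holomorphic_uniform_sequence)
  show "(\<lambda>z. B z (hardy_eval (hardy_trunc N f) z)) holomorphic_on ball 0 1" for N
  proof (rule holomorphic_transform)
    show "(\<lambda>z. \<Sum>n<N. z ^ n * B z (hardy_coeff f n)) holomorphic_on ball 0 1"
      by (intro holomorphic_intros holomorphic)
    show "(\<Sum>n<N. z ^ n * B z (hardy_coeff f n)) = B z (hardy_eval (hardy_trunc N f) z)"
      if "z \<in> ball 0 1" for z
      using that by (simp add: hardy_eval_trunc bounded_clinear_sum[OF bounded]
          bounded_clinear_scaleC[OF bounded] scaleC_complex_def)
  qed
next
  fix x :: complex assume x: "x \<in> ball 0 1"
  define d where "d = (1 - cmod x) / 2"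
  have d: "0 < d" "\<And>y. y \<in> cball x d \<Longrightarrow> cmod y \<le> 1 - d"
  proof -
    show "cmod y \<le> 1 - d" if "y \<in> cball x d" for y
      using that norm_triangle_ineq2[of y x] by (simp add: d_def dist_norm norm_minus_commute field_simps)
  qed (use x in \<open>simp add: d_def\<close>)
  then have sub: "cball x d \<subseteq> ball 0 1"
    by fastforce
  have "uniform_limit (cball x d) (\<lambda>N z. B z (hardy_eval (hardy_trunc N f) z))
      (\<lambda>z. B z (hardy_eval f z)) sequentially"
  proof (rule uniform_limitI)
    fix e :: real assume "e > 0"
    have lim: "(\<lambda>N. norm (hardy_trunc N f - f) / d) \<longlonglongrightarrow> 0"
      using tendsto_divide[OF tendsto_norm_zero[OF LIM_zero[OF hardy_trunc_tendsto[of f]]] tendsto_const[of d]] d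
      by simp
    have le: "dist (B z (hardy_eval (hardy_trunc N f) z)) (B z (hardy_eval f z))
        \<le> norm (hardy_trunc N f - f) / d" if z: "z \<in> cball x d" for z N
    proof -
      have z1: "cmod z < 1" "cmod z \<le> 1 - d"
        using z sub d(2) by auto
      have "dist (B z (hardy_eval (hardy_trunc N f) z)) (B z (hardy_eval f z))
          = cmod (B z (hardy_eval (hardy_trunc N f - f) z))"
        by (simp add: dist_norm hardy_eval_diff bounded_clinear_diff[OF bounded] z1)
      also have "\<dots> \<le> norm (hardy_trunc N f - f) / (1 - cmod z)"
        using contraction[OF z1(1)] norm_hardy_eval_le[OF z1(1)] order_trans by blast
      also have "\<dots> \<le> norm (hardy_trunc N f - f) / d"
        using z1 d by (intro divide_left_mono) auto
      finally show ?thesis .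
    qed
    have "\<forall>\<^sub>F N in sequentially. norm (hardy_trunc N f - f) / d < e"
      using order_tendstoD(2)[OF lim \<open>e > 0\<close>] .
    then show "\<forall>\<^sub>F N in sequentially. \<forall>z\<in>cball x d.
        dist (B z (hardy_eval (hardy_trunc N f) z)) (B z (hardy_eval f z)) < e"
      by eventually_elim (use le order_le_less_trans in blast)
  qed
  then show "\<exists>d>0. cball x d \<subseteq> ball 0 1 \<and> uniform_limit (cball x d)
      (\<lambda>N z. B z (hardy_eval (hardy_trunc N f) z)) (\<lambda>z. B z (hardy_eval f z)) sequentially"
    using d sub by blast
qed simp

lemma mult_op_exists:
  obtains g where "norm g \<le> norm f" "\<And>z. cmod z < 1 \<Longrightarrow> hardy_eval g z = B z (hardy_eval f z)"
proof (rule hardy_of_holomorphic[OF holomorphic_apply norm_ge_zero])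
  fix r :: real assume r: "0 \<le> r" "r < 1"
  have le: "(cmod (B (of_real r * cis t) (hardy_eval f (of_real r * cis t))))\<^sup>2
      \<le> (norm (hardy_eval f (of_real r * cis t)))\<^sup>2" for t
    using r by (intro power_mono contraction) (auto simp: norm_mult)
  have "circle_mean (\<lambda>t. (cmod (B (of_real r * cis t) (hardy_eval f (of_real r * cis t))))\<^sup>2)
      \<le> circle_mean (\<lambda>t. (norm (hardy_eval f (of_real r * cis t)))\<^sup>2)"
    by (rule circle_mean_mono)
      (intro integrable_circ_continuous continuous_intros
        holomorphic_circle_continuous[OF holomorphic_apply] continuous_on_hardy_eval_circle r AE_I2 le)+
  also have "\<dots> \<le> (norm f)\<^sup>2"
    by (rule circle_mean_norm_hardy_eval[OF r])
  finally show "circle_mean (\<lambda>t. (cmod (B (of_real r * cis t) (hardy_eval f (of_real r * cis t))))\<^sup>2)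
      \<le> (norm f)\<^sup>2" .
qed (rule that)

lemma mult_op_eqI:
  assumes "\<And>z. cmod z < 1 \<Longrightarrow> hardy_eval g z = B z (hardy_eval f z)"
  shows "mult_op B f = g"
  unfolding mult_op_def
  by (rule the_equality) (auto simp: assms intro!: hardy_eval_inject)

lemma hardy_eval_mult_op:
  "cmod z < 1 \<Longrightarrow> hardy_eval (mult_op B f) z = B z (hardy_eval f z)"
  by (metis mult_op_exists mult_op_eqI)

lemma norm_mult_op_le: "norm (mult_op B f) \<le> norm f"
  by (metis mult_op_exists mult_op_eqI)

lemma bounded_clinear_mult_op: "bounded_clinear (mult_op B)"
proof (rule bounded_clinearI[where K = 1])
  show "mult_op B (f + g) = mult_op B f + mult_op B g" for f g
    by (rule mult_op_eqI) (simp add: hardy_eval_add hardy_eval_mult_op bounded_clinear_add[OF bounded])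
  show "mult_op B (c *\<^sub>C f) = c *\<^sub>C mult_op B f" for c f
    by (rule mult_op_eqI) (simp add: hardy_eval_scaleC hardy_eval_mult_op bounded_clinear_scaleC[OF bounded])
qed (simp add: norm_mult_op_le)

lemma mult_op_shift: "mult_op B (hardy_shift f) = hardy_shift (mult_op B f)"
  by (rule mult_op_eqI) (simp add: hardy_eval_shift hardy_eval_mult_op bounded_clinear_scaleC[OF bounded])

end

lemma schur_class_analytic_contraction:
  fixes B :: "complex \<Rightarrow> 'd::complex_hilbert \<Rightarrow> complex"
  assumes "B \<in> schur_class"
  shows "analytic_contraction B"
proof
  show bc: "bounded_clinear (B z)" if "cmod z < 1" for z
    using assms that by (auto simp: schur_class_def)
  show "cmod (B z x) \<le> norm x" if "cmod z < 1" for z x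
    using assms that by (auto simp: schur_class_def)
  show "(\<lambda>z. B z x) holomorphic_on ball 0 1" for x
  proof (rule holomorphic_onI)
    fix z :: complex assume z: "z \<in> ball 0 1"
    then obtain D where D: "bounded_clinear D"
      "((\<lambda>h. onorm (\<lambda>x. inverse h *\<^sub>C (B (z + h) x - B z x) - D x)) \<longlongrightarrow> 0) (at 0)"
      using assms unfolding schur_class_def by blast
    have "((\<lambda>h. inverse h * (B (z + h) x - B z x) - D x) \<longlongrightarrow> 0) (at 0)"
    proof (rule Lim_null_comparison)
      show "((\<lambda>h. onorm (\<lambda>x. inverse h *\<^sub>C (B (z + h) x - B z x) - D x) * norm x) \<longlongrightarrow> 0) (at 0)"
        using tendsto_mult_right[OF D(2), of "norm x"] by simp
      have "\<forall>\<^sub>F h in at 0. h \<in> ball 0 (1 - cmod z)"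
        using z by (intro eventually_at_in_open') auto
      then show "\<forall>\<^sub>F h in at 0. norm (inverse h * (B (z + h) x - B z x) - D x)
          \<le> onorm (\<lambda>x. inverse h *\<^sub>C (B (z + h) x - B z x) - D x) * norm x"
      proof eventually_elim
        case (elim h)
        then have "cmod (z + h) < 1"
          using norm_triangle_ineq[of z h] by simp
        then have "bounded_linear (\<lambda>x. inverse h *\<^sub>C (B (z + h) x - B z x) - D x)"
          using bc[of "z + h"] bc[of z] z D(1) unfolding bounded_clinear_def
          by (intro bounded_linear_sub bounded_linear_compose[OF bounded_linear_scaleC]) auto
        from onorm[OF this, of x] show ?case
          by (simp add: scaleC_complex_def)
      qed
    qed
    then have "((\<lambda>h. (B (z + h) x - B z x) / h) \<longlongrightarrow> D x) (at 0)"
      by (subst LIM_zero_iff[symmetric]) (simp add: divide_inverse mult.commute)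
    then have "((\<lambda>z. B z x) has_field_derivative D x) (at z)"
      by (simp add: DERIV_def)
    then show "(\<lambda>z. B z x) field_differentiable at z within ball 0 1"
      using field_differentiable_at_within field_differentiable_def by blast
  qed
qed

lemma analytic_contraction_scalar:
  assumes "\<phi> holomorphic_on ball 0 1" "\<And>z. cmod z < 1 \<Longrightarrow> cmod (\<phi> z) \<le> 1"
  shows "analytic_contraction (\<lambda>z x. \<phi> z * x)"
proof
  show "cmod (\<phi> z * x) \<le> norm x" if "cmod z < 1" for z x
    using assms(2)[OF that] by (simp add: norm_mult mult_left_le_one_le)
  then show "bounded_clinear (\<lambda>x. \<phi> z * x)" if "cmod z < 1" for z
    using that by (intro bounded_clinearI[where K = 1]) (auto simp: distrib_left scaleC_complex_def)
qed (intro holomorphic_intros assms)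

section \<open>Radial limits of bounded holomorphic functions\<close>

lemma AE_summable_of_integrals:
  fixes F :: "nat \<Rightarrow> 'b \<Rightarrow> 'a::{banach, second_countable_topology}"
  assumes F: "\<And>k. integrable M (F k)" and s: "summable (\<lambda>k. \<integral>x. norm (F k x) \<partial>M)"
  shows "AE x in M. summable (\<lambda>k. norm (F k x))"
proof -
  have [measurable]: "F k \<in> borel_measurable M" for k
    by (rule borel_measurable_integrable[OF F])
  have "(\<integral>\<^sup>+x. (\<Sum>k. ennreal (norm (F k x))) \<partial>M) = (\<Sum>k. \<integral>\<^sup>+x. ennreal (norm (F k x)) \<partial>M)"
    by (rule nn_integral_suminf) measurable
  also have "\<dots> = (\<Sum>k. ennreal (\<integral>x. norm (F k x) \<partial>M))"
    by (intro suminf_cong nn_integral_eq_integral integrable_norm F) simp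
  also have "\<dots> \<noteq> \<infinity>"
    by (subst suminf_ennreal2[OF _ s]) auto
  finally have "AE x in M. (\<Sum>k. ennreal (norm (F k x))) \<noteq> \<infinity>"
    by (intro nn_integral_PInf_AE) auto
  then show ?thesis
    by eventually_elim (simp add: summable_suminf_not_top)
qed

lemma sums_integral_lebesgue_on:
  fixes F :: "nat \<Rightarrow> real \<Rightarrow> complex"
  assumes F: "\<And>k. integrable lebesgue (F k)" and s: "summable (\<lambda>k. \<integral>x. norm (F k x) \<partial>lebesgue)"
    and S: "S \<in> sets lebesgue"
  shows "(\<lambda>k. integral\<^sup>L (lebesgue_on S) (F k)) sums integral\<^sup>L (lebesgue_on S) (\<lambda>x. \<Sum>k. F k x)"
proof (rule sums_integral)
  show int: "integrable (lebesgue_on S) (F k)" for k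
    using F[of k] S Lebesgue_Measure.integrable_restrict_UNIV[OF S, of "F k"]
      integrable_mult_indicator[OF S F[of k]] by (simp add: indicator_scaleR_eq_if)
  have "AE x in lebesgue. summable (\<lambda>k. norm (F k x))"
    by (rule AE_summable_of_integrals[OF F s])
  then show "AE x in lebesgue_on S. summable (\<lambda>k. norm (F k x))"
    using S by (simp add: AE_restrict_space_iff) (auto elim: eventually_mono)
  have "(\<integral>x. norm (F k x) \<partial>lebesgue_on S) \<le> (\<integral>x. norm (F k x) \<partial>lebesgue)" for k
    using integral_mono_lebesgue_on_AE[where T = UNIV and S = S
        and f = "\<lambda>x. norm (F k x)" and g = "\<lambda>x. norm (F k x)"] F[of k] S
    by (simp add: lebesgue_on_UNIV_eq)
  then show "summable (\<lambda>k. \<integral>x. norm (F k x) \<partial>lebesgue_on S)"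
    by (intro summable_comparison_test[OF _ s]) auto
qed

text \<open>The left derivative is the right derivative of the reflected function.\<close>

lemma AE_has_vector_derivative_integral:
  fixes h :: "real \<Rightarrow> complex"
  assumes h: "integrable lebesgue h"
    and G: "\<And>s t. a \<le> s \<Longrightarrow> s \<le> t \<Longrightarrow> t \<le> b \<Longrightarrow> integral {s..t} h = G t - G s"
  shows "AE t in lebesgue_on {a..b}. (G has_vector_derivative h t) (at t)"
proof -
  have hU: "h integrable_on UNIV"
    using h by (rule integrable_on_lebesgue)
  then have int: "h integrable_on cbox c d" for c d
    by (rule integrable_on_subcbox) simp
  have "(\<lambda>x. h (- x)) integrable_on cbox c d" for c d
    using int[of "-d" "-c"] integrable_reflect[of h "-c" "-d"] by simp
  then obtain N1 N2 where N: "negligible N1" "negligible N2"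
    and r: "\<And>x e. x \<notin> N1 \<Longrightarrow> 0 < e \<Longrightarrow> \<exists>d>0. \<forall>k. 0 < k \<and> k < d \<longrightarrow>
        norm (integral (cbox x (x + k *\<^sub>R One)) h /\<^sub>R k ^ DIM(real) - h x) < e"
    and l: "\<And>x e. x \<notin> N2 \<Longrightarrow> 0 < e \<Longrightarrow> \<exists>d>0. \<forall>k. 0 < k \<and> k < d \<longrightarrow>
        norm (integral (cbox x (x + k *\<^sub>R One)) (\<lambda>x. h (- x)) /\<^sub>R k ^ DIM(real) - h (- x)) < e"
    using integrable_ccontinuous_explicit[of h, OF int]
      integrable_ccontinuous_explicit[of "\<lambda>x. h (- x)"] by metis
  have "negligible (uminus ` N2)"
    by (intro negligible_differentiable_image_negligible N(2) derivative_intros order_refl)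
  then have "negligible (N1 \<union> uminus ` N2 \<union> {a, b})"
    using N(1) by (intro negligible_Un) auto
  then have "AE t in lebesgue. t \<notin> N1 \<union> uminus ` N2 \<union> {a, b}"
    using AE_not_in negligible_iff_null_sets by blast
  then have "AE t in lebesgue. t \<in> {a..b} \<longrightarrow> (G has_vector_derivative h t) (at t)"
  proof eventually_elim
    case (elim t)
    show ?case
    proof
      assume "t \<in> {a..b}"
      with elim have t: "a < t" "t < b" "t \<notin> N1" "- t \<notin> N2"
        by (auto simp: image_iff)
      show "(G has_vector_derivative h t) (at t)"
        unfolding has_vector_derivative_def has_derivative_at_alt
      proof (intro conjI allI impI bounded_linear_scaleR_left)
        fix e :: real assume e: "0 < e"
        obtain d1 where d1: "d1 > 0" "\<And>k. 0 < k \<Longrightarrow> k < d1 \<Longrightarrow> norm (integral {t..t + k} h /\<^sub>R k - h t) < e"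
          using r[OF t(3) e] by auto
        obtain d2 where d2: "d2 > 0"
          "\<And>k. 0 < k \<Longrightarrow> k < d2 \<Longrightarrow> norm (integral {- t..- t + k} (\<lambda>x. h (- x)) /\<^sub>R k - h t) < e"
          using l[OF t(4) e] by auto
        define d where "d = min (min d1 d2) (min (t - a) (b - t))"
        have d: "d > 0" "d \<le> d1" "d \<le> d2" "d \<le> t - a" "d \<le> b - t"
          using d1 d2 t by (auto simp: d_def)
        have scale: "norm (v - k *\<^sub>R w) \<le> e * k" if "norm (v /\<^sub>R k - w) < e" "k > 0" for v w :: complex and k
        proof -
          have "v - k *\<^sub>R w = k *\<^sub>R (v /\<^sub>R k - w)"
            using that(2) by (simp add: scaleR_diff_right)
          then show ?thesis
            using that by (simp add: mult.commute[of e])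
        qed
        have "norm (G y - G t - (y - t) *\<^sub>R h t) \<le> e * norm (y - t)" if y: "norm (y - t) < d" for y
        proof (cases y t rule: linorder_cases)
          case less
          define k where "k = t - y"
          have k: "0 < k" "k < d2" "a \<le> t - k"
            using less y d by (auto simp: k_def)
          have "integral {- t..- t + k} (\<lambda>x. h (- x)) = integral {t - k..t} h"
            using Henstock_Kurzweil_Integration.integral_reflect_real[of t "t - k" h] by (simp add: add.commute)
          also have "\<dots> = G t - G y"
            using G[of y t] k t less by (simp add: k_def)
          finally have "norm ((G t - G y) - k *\<^sub>R h t) \<le> e * k"
            using d2(2)[OF k(1,2)] k(1) by (intro scale) auto
          then show ?thesis
            using less norm_minus_commute[of "G y - G t" "(y - t) *\<^sub>R h t"]
              norm_minus_cancel[of "(G t - G y) - k *\<^sub>R h t"]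
            by (simp add: k_def algebra_simps)
        next
          case greater
          define k where "k = y - t"
          have k: "0 < k" "k < d1" "t + k \<le> b"
            using greater y d by (auto simp: k_def)
          have "integral {t..t + k} h = G y - G t"
            using G[of t y] k t greater by (simp add: k_def)
          then have "norm ((G y - G t) - k *\<^sub>R h t) \<le> e * k"
            using d1(2)[OF k(1,2)] k(1) by (intro scale) auto
          then show ?thesis
            using greater by (simp add: k_def)
        qed simp
        then show "\<exists>d>0. \<forall>y. norm (y - t) < d \<longrightarrow> norm (G y - G t - (y - t) *\<^sub>R h t) \<le> e * norm (y - t)"
          using d(1) by blast
      qed
    qed
  qed
  then show ?thesis
    by (simp add: AE_restrict_space_iff)
qed

lemma summable_primitive_coeffs:
  fixes a :: "nat \<Rightarrow> complex"
  assumes "summable (\<lambda>n. (cmod (a n))\<^sup>2)"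
  shows "summable (\<lambda>n. cmod (a n / of_nat (Suc n)))"
proof (rule summable_comparison_test)
  have "cmod (a n / of_nat (Suc n)) \<le> (cmod (a n))\<^sup>2 + inverse (of_nat (Suc n)) ^ 2" for n
  proof -
    define x y where "x = cmod (a n)" and "y = inverse (real (Suc n))"
    have "0 \<le> x * y" "2 * (x * y) \<le> x\<^sup>2 + y\<^sup>2"
      using zero_le_power2[of "x - y"]
      by (auto simp: x_def y_def power2_diff simp del: of_nat_Suc)
    then have "x * y \<le> x\<^sup>2 + y\<^sup>2"
      by linarith
    then show ?thesis
      by (simp add: x_def y_def norm_mult norm_inverse norm_of_nat divide_inverse del: of_nat_Suc)
  qed
  then show "\<exists>N. \<forall>n\<ge>N. norm (cmod (a n / of_nat (Suc n))) \<le> (cmod (a n))\<^sup>2 + inverse (of_nat (Suc n)) ^ 2"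
    by auto
  show "summable (\<lambda>n. (cmod (a n))\<^sup>2 + inverse (real (Suc n)) ^ 2)"
    using inverse_power_summable[of 2, where 'a = real]
    summable_Suc_iff[of "\<lambda>n. inverse (real n ^ 2)"]
    by (intro summable_add assms) (simp add: power_inverse del: of_nat_Suc)
qed

text \<open>Along suitable blocks the partial sums of the derived series converge absolutely almost
  everywhere, so the primitive is an indefinite integral.\<close>

lemma AE_primitive_differentiable:
  fixes a :: "nat \<Rightarrow> complex"
  assumes a: "summable (\<lambda>n. (cmod (a n))\<^sup>2)"
  defines "G \<equiv> \<lambda>t. \<Sum>n. a n / of_nat (Suc n) * cis t ^ Suc n"
  shows "AE t in circ. \<exists>c. (G has_vector_derivative c) (at t)"
proof -
  have "\<exists>M. \<forall>m\<ge>M. \<forall>n. norm (\<Sum>i=m..<n. (cmod (a i))\<^sup>2) < (1 / 4) ^ k" for k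
    using a unfolding summable_Cauchy by simp
  then obtain M where M: "\<And>k m n. m \<ge> M k \<Longrightarrow> norm (\<Sum>i=m..<n. (cmod (a i))\<^sup>2) < (1 / 4) ^ k"
    by metis
  define N where "N = rec_nat 0 (\<lambda>k n. n + M k + 1)"
  have N: "N 0 = 0" "N (Suc k) = N k + M k + 1" for k
    by (simp_all add: N_def)
  have N_mono: "N k \<le> N (Suc k)" "M k \<le> N (Suc k)" for k
    by (simp_all add: N)
  have N_lim: "filterlim N at_top sequentially"
  proof (rule filterlim_subseq)
    show "strict_mono N"
      by (intro strict_mono_Suc_iff[THEN iffD2]) (simp add: N)
  qed
  define F where "F k t = \<i> * cis t * (\<Sum>n=N k..<N (Suc k). a n * cis t ^ n)" for k t
  define P where "P k t = (\<Sum>n<N k. a n / of_nat (Suc n) * cis t ^ Suc n)" for k t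
  have F_cont: "continuous_on UNIV (F k)" for k
    unfolding F_def by (intro continuous_intros)
  have P_deriv: "((\<lambda>t. P (Suc k) t - P k t) has_vector_derivative F k t) (at t within S)" for k t S
  proof -
    have term_deriv: "((\<lambda>t. a n / of_nat (Suc n) * cis t ^ Suc n) has_vector_derivative (\<i> * cis t * (a n * cis t ^ n))) (at t within S)" for n
      unfolding has_vector_derivative_def
      by (rule derivative_eq_intros refl | simp del: of_nat_Suc)+
        (auto simp: fun_eq_iff scaleR_conv_of_real field_simps simp del: of_nat_Suc)
    have "P (Suc k) t - P k t = (\<Sum>n=N k..<N (Suc k). a n / of_nat (Suc n) * cis t ^ Suc n)" for t
      unfolding P_def using sum_diff_nat_ivl[of 0 "N k" "N (Suc k)"] N_mono
      by (simp add: lessThan_atLeast0 del: of_nat_Suc)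
    then show ?thesis
      unfolding F_def sum_distrib_left
      by (simp only:) (intro has_vector_derivative_sum term_deriv)
  qed
  have mean_sq: "circle_mean (\<lambda>t. (cmod (F k t))\<^sup>2) = (\<Sum>n=N k..<N (Suc k). (cmod (a n))\<^sup>2)" for k
  proof -
    define b where "b n = (if n \<in> {N k..<N (Suc k)} then a n else 0)" for n
    have sb: "(\<lambda>n. f (b n) n) sums (\<Sum>n=N k..<N (Suc k). f (a n) n)" if "\<And>n. f 0 n = 0"
      for f :: "complex \<Rightarrow> nat \<Rightarrow> 'z::real_normed_vector"
    proof -
      have "(\<lambda>n. f (b n) n) = (\<lambda>n. if n \<in> {N k..<N (Suc k)} then f (a n) n else 0)"
        using that by (auto simp: b_def)
      then show ?thesis
        using sums_If_finite_set[of "{N k..<N (Suc k)}" "\<lambda>n. f (a n) n"] by simp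
    qed
    have "summable (\<lambda>n. cmod (b n))"
      using sb[of "\<lambda>x _. cmod x"] by (simp add: sums_iff)
    from circle_mean_parseval[OF this this]
    have "(\<lambda>n. b n * cnj (b n)) sums circle_mean (\<lambda>t. (\<Sum>n. b n * cis t ^ n) * cnj (\<Sum>n. b n * cis t ^ n))" .
    moreover have "(\<Sum>n. b n * cis t ^ n) = (\<Sum>n=N k..<N (Suc k). a n * cis t ^ n)" for t
      using sb[of "\<lambda>x n. x * cis t ^ n"] by (simp add: sums_iff)
    moreover have "(\<Sum>n=N k..<N (Suc k). a n * cis t ^ n) * cnj (\<Sum>n=N k..<N (Suc k). a n * cis t ^ n)
        = of_real ((cmod (F k t))\<^sup>2)" for t
      by (simp only: F_def norm_mult norm_ii norm_cis mult_1_left complex_norm_square[symmetric] of_real_power)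
    ultimately have "(\<lambda>n. b n * cnj (b n)) sums of_real (circle_mean (\<lambda>t. (cmod (F k t))\<^sup>2))"
      by (simp only: circle_mean_of_real)
    moreover have "(\<lambda>n. b n * cnj (b n)) sums (\<Sum>n=N k..<N (Suc k). a n * cnj (a n))"
      using sb[of "\<lambda>x _. x * cnj x"] by simp
    ultimately have "complex_of_real (circle_mean (\<lambda>t. (cmod (F k t))\<^sup>2)) = (\<Sum>n=N k..<N (Suc k). a n * cnj (a n))"
      by (rule sums_unique2)
    also have "\<dots> = of_real (\<Sum>n=N k..<N (Suc k). (cmod (a n))\<^sup>2)"
      by (simp only: of_real_sum of_real_power complex_norm_square[symmetric])
    finally show ?thesis
      by (simp only: of_real_eq_iff)
  qed
  have mean_le: "circle_mean (\<lambda>t. cmod (F (Suc k) t)) \<le> (1 / 2) ^ k" for k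
  proof -
    define e :: real where "e = (1 / 2) ^ k"
    have e: "e > 0" "e\<^sup>2 = (1 / 4) ^ k"
      by (simp_all add: e_def power2_eq_square flip: power_mult_distrib)
    have "x \<le> (1 / 2) * e + (1 / (2 * e)) * x\<^sup>2" for x
      using zero_le_power2[of "x - e"] e(1) by (simp add: field_simps power2_eq_square)
    then have "circle_mean (\<lambda>t. cmod (F (Suc k) t)) \<le> circle_mean (\<lambda>t. (1 / 2) * e + (1 / (2 * e)) * (cmod (F (Suc k) t))\<^sup>2)"
      by (intro circle_mean_mono integrable_circ_continuous continuous_intros F_cont AE_I2)
    also have "\<dots> = (1 / 2) * e + (1 / (2 * e)) * circle_mean (\<lambda>t. (cmod (F (Suc k) t))\<^sup>2)"
      by (subst circle_mean_add)
        (auto intro!: integrable_circ_continuous continuous_intros F_cont simp: circle_mean_mult_right simp del: times_divide_eq_left)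
    also have "\<dots> \<le> (1 / 2) * e + (1 / (2 * e)) * e\<^sup>2"
      unfolding mean_sq e(2) using M[OF N_mono(2), of k "N (Suc (Suc k))"] e(1)
      by (intro add_left_mono mult_left_mono) auto
    also have "\<dots> = e"
      using e(1) by (simp add: power2_eq_square)
    finally show ?thesis
      by (simp add: e_def)
  qed
  define F' where "F' k t = (if t \<in> {0..2*pi} then F k t else 0)" for k t
  have F'_int: "integrable lebesgue (F' k)" for k
    unfolding F'_def using integrable_circ_continuous[OF F_cont[of k]] by (subst Lebesgue_Measure.integrable_restrict_UNIV) auto
  have F'_norm: "(\<integral>t. norm (F' k t) \<partial>lebesgue) = 2 * pi * circle_mean (\<lambda>t. cmod (F k t))" for k
  proof -
    have "(\<lambda>t. norm (F' k t)) = (\<lambda>t. if t \<in> {0..2*pi} then cmod (F k t) else 0)"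
      by (auto simp: F'_def)
    then show ?thesis
      using Lebesgue_Measure.integral_restrict_UNIV[of "{0..2*pi}" "\<lambda>t. cmod (F k t)"] by (simp add: circle_mean_def)
  qed
  have F'_summable: "summable (\<lambda>k. \<integral>t. norm (F' k t) \<partial>lebesgue)"
  proof (subst summable_Suc_iff[symmetric], rule summable_comparison_test)
    show "\<exists>N. \<forall>n\<ge>N. norm (\<integral>t. norm (F' (Suc n) t) \<partial>lebesgue) \<le> 2 * pi * (1 / 2) ^ n"
      unfolding F'_norm using mean_le by (auto simp: abs_mult circle_mean_nonneg)
    show "summable (\<lambda>n. 2 * pi * (1 / 2) ^ n)"
      by (intro summable_mult summable_geometric) simp
  qed
  define h where "h t = (\<Sum>k. F' k t)" for t
  have h_int: "integrable lebesgue h"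
    unfolding h_def
    by (rule integrable_suminf[OF F'_int AE_summable_of_integrals[OF F'_int F'_summable] F'_summable])
  have "integral {s..t} h = G t - G s" if st: "0 \<le> s" "s \<le> t" "t \<le> 2 * pi" for s t
  proof -
    have FP: "integral\<^sup>L (lebesgue_on {s..t}) (F' k) = (P (Suc k) t - P (Suc k) s) - (P k t - P k s)" for k
    proof -
      have "integral\<^sup>L (lebesgue_on {s..t}) (F' k) = integral\<^sup>L (lebesgue_on {s..t}) (F k)"
        using st by (intro Bochner_Integration.integral_cong) (auto simp: F'_def)
      also have "\<dots> = integral {s..t} (F k)"
        using continuous_on_subset[OF F_cont]
        by (intro lebesgue_integral_eq_integral continuous_imp_integrable_real) auto
      also have "\<dots> = (P (Suc k) t - P k t) - (P (Suc k) s - P k s)"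
        by (intro integral_unique fundamental_theorem_of_calculus st P_deriv)
      also have "\<dots> = (P (Suc k) t - P (Suc k) s) - (P k t - P k s)"
        by simp
      finally show ?thesis .
    qed
    have "(\<lambda>k. (P (Suc k) t - P (Suc k) s) - (P k t - P k s)) sums integral\<^sup>L (lebesgue_on {s..t}) h"
      using sums_integral_lebesgue_on[OF F'_int F'_summable, of "{s..t}"]
      unfolding FP h_def[abs_def] by simp
    moreover have "(\<lambda>k. (P (Suc k) t - P (Suc k) s) - (P k t - P k s)) sums ((G t - G s) - (P 0 t - P 0 s))"
    proof (rule telescope_sums)
      have "(\<lambda>k. P k t) \<longlonglongrightarrow> G t" for t
      proof -
        have "summable (\<lambda>n. a n / of_nat (Suc n) * cis t ^ Suc n)"
          by (rule summable_norm_cancel, simp only: norm_mult norm_power norm_cis power_one mult_1_right)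
            (rule summable_primitive_coeffs[OF a])
        from filterlim_compose[OF summable_LIMSEQ[OF this] N_lim] show ?thesis
          by (simp add: P_def G_def)
      qed
      then show "(\<lambda>k. P k t - P k s) \<longlonglongrightarrow> G t - G s"
        by (intro tendsto_diff)
    qed
    ultimately have "integral\<^sup>L (lebesgue_on {s..t}) h = G t - G s"
      using sums_unique2 by (fastforce simp: P_def N)
    moreover have "integrable (lebesgue_on {s..t}) h"
      using integrable_mult_indicator[of "{s..t}" lebesgue h, OF _ h_int] Lebesgue_Measure.integrable_restrict_UNIV[of "{s..t}" h]
      by (simp add: indicator_scaleR_eq_if)
    ultimately show ?thesis
      by (simp add: lebesgue_integral_eq_integral)
  qed
  from AE_has_vector_derivative_integral[OF h_int this]
  show ?thesis
    by (rule AE_mp) auto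
qed

text \<open>The kernel \<open>w / (1 - w)\<^sup>2\<close> alone is too large near \<open>1\<close>; subtracting its conjugate, which
  annihilates analytic functions, gives the tangential derivative of the Poisson kernel.\<close>

definition dpoisson :: "complex \<Rightarrow> complex" where
  "dpoisson w = w / (1 - w)\<^sup>2 - cnj (w / (1 - w)\<^sup>2)"

lemma dpoisson_bounds:
  fixes u :: complex
  assumes u: "cmod u = 1" and r: "0 \<le> r" "r < 1"
  defines "s \<equiv> cmod (u - 1)" and "w \<equiv> of_real r * u"
  shows "cmod (dpoisson w) * s \<le> 8 * ((1 - r\<^sup>2) / (cmod (1 - w))\<^sup>2)"
    and "cmod (dpoisson w) * s ^ 3 \<le> 32 * (1 - r\<^sup>2)"
proof -
  have w: "cmod w = r"
    using u r by (simp add: w_def norm_mult)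
  have ne: "1 - w \<noteq> 0"
    using w r by auto
  define d where "d = cmod (1 - w)"
  have d: "d > 0"
    using ne by (simp add: d_def)
  have "cmod (u - 1) \<le> cmod (u - w) + cmod (1 - w)"
    using norm_triangle_ineq4[of "u - w" "1 - w"] by simp
  also have "cmod (u - w) = 1 - r"
  proof -
    have "u - w = of_real (1 - r) * u"
      by (simp add: w_def algebra_simps)
    then show ?thesis
      using u r by (simp only: norm_mult norm_of_real) simp
  qed
  also have "1 - r \<le> d"
    using norm_triangle_ineq2[of 1 w] w by (simp add: d_def)
  finally have s: "s \<le> 2 * d" "0 \<le> s"
    by (simp_all add: s_def d_def)
  have wc: "w * cnj w = of_real (r\<^sup>2)"
    using w by (simp add: complex_norm_square[symmetric] del: of_real_power)
  have dc: "(1 - w) * cnj (1 - w) = of_real (d\<^sup>2)"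
    by (simp only: d_def complex_norm_square)
  have nec: "1 - cnj w \<noteq> 0"
    using ne by (metis complex_cnj_diff complex_cnj_one complex_cnj_zero_iff)
  have "dpoisson w = (w * (1 - cnj w)\<^sup>2 - cnj w * (1 - w)\<^sup>2) / ((1 - w) * (1 - cnj w))\<^sup>2"
  proof -
    have "p / x\<^sup>2 - q / y\<^sup>2 = (p * y\<^sup>2 - q * x\<^sup>2) / (x * y)\<^sup>2" if "x \<noteq> 0" "y \<noteq> 0" for p q x y :: complex
      using that by (simp add: field_simps)
    from this[OF ne nec, of w "cnj w"] show ?thesis
      by (simp add: dpoisson_def)
  qed
  also have "w * (1 - cnj w)\<^sup>2 - cnj w * (1 - w)\<^sup>2 = (w - cnj w) * (1 - w * cnj w)"
    by (simp add: power2_eq_square algebra_simps)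
  also have "\<dots> / ((1 - w) * (1 - cnj w))\<^sup>2 = (w - cnj w) * of_real (1 - r\<^sup>2) / of_real (d ^ 4)"
    using dc wc by simp
  finally have "dpoisson w = (w - cnj w) * of_real (1 - r\<^sup>2) / of_real (d ^ 4)" .
  then have "cmod (dpoisson w) = cmod (w - cnj w) * (1 - r\<^sup>2) / d ^ 4"
    using r d by (simp only: norm_mult norm_divide norm_of_real) (simp add: power_le_one abs_of_nonneg)
  also have "\<dots> \<le> 2 * s * (1 - r\<^sup>2) / d ^ 4"
  proof -
    have "cmod (w - cnj w) = r * cmod (u - cnj u)"
    proof -
      have "w - cnj w = of_real r * (u - cnj u)"
        by (simp add: w_def algebra_simps)
      then show ?thesis
        using r by (simp add: norm_mult del: complex_diff_cnj)
    qed
    also have "\<dots> \<le> 1 * cmod (u - cnj u)"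
      using r by (intro mult_right_mono) auto
    also have "\<dots> \<le> cmod (u - 1) + cmod (cnj (u - 1))"
      using norm_triangle_ineq4[of "u - 1" "cnj (u - 1)"] by simp
    finally have "cmod (w - cnj w) \<le> 2 * s"
      by (simp add: s_def del: complex_cnj_diff)
    then show ?thesis
      using r d by (intro divide_right_mono mult_right_mono) (auto simp: power_le_one)
  qed
  finally have le: "cmod (dpoisson w) \<le> 2 * s * (1 - r\<^sup>2) / d ^ 4" .
  have r2: "0 \<le> 1 - r\<^sup>2"
    using r by (simp add: power_le_one)
  have "cmod (dpoisson w) * s \<le> 2 * s * (1 - r\<^sup>2) / d ^ 4 * s"
    using le s by (intro mult_right_mono)
  also have "\<dots> = 2 * (1 - r\<^sup>2) / d ^ 4 * s\<^sup>2"
    by (simp add: power2_eq_square)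
  also have "\<dots> \<le> 2 * (1 - r\<^sup>2) / d ^ 4 * (2 * d)\<^sup>2"
    using r2 d s by (intro mult_left_mono power_mono) auto
  also have "\<dots> = 8 * ((1 - r\<^sup>2) / d\<^sup>2)"
    using d by (simp add: field_simps power_mult_distrib flip: power_add)
  finally show "cmod (dpoisson w) * s \<le> 8 * ((1 - r\<^sup>2) / (cmod (1 - w))\<^sup>2)"
    by (simp add: d_def)
  have "cmod (dpoisson w) * s ^ 3 \<le> 2 * s * (1 - r\<^sup>2) / d ^ 4 * s ^ 3"
    using le s by (intro mult_right_mono) auto
  also have "\<dots> = 2 * (1 - r\<^sup>2) / d ^ 4 * s ^ 4"
    by (simp add: power_numeral_reduce)
  also have "\<dots> \<le> 2 * (1 - r\<^sup>2) / d ^ 4 * (2 * d) ^ 4"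
    using r2 d s by (intro mult_left_mono power_mono) auto
  also have "\<dots> = 32 * (1 - r\<^sup>2)"
    using d by (simp add: field_simps power_mult_distrib)
  finally show "cmod (dpoisson w) * s ^ 3 \<le> 32 * (1 - r\<^sup>2)" .
qed

lemma circle_mean_dpoisson:
  fixes A :: "nat \<Rightarrow> complex"
  assumes A: "summable (\<lambda>n. cmod (A n))" and z: "cmod z < 1"
  shows "(\<lambda>n. A n * (of_nat n * z ^ n)) sums
    circle_mean (\<lambda>t. (\<Sum>n. A n * cis t ^ n) * dpoisson (z * cnj (cis t)))"
proof -
  define b where "b n = cnj (of_nat n * z ^ n)" for n
  have sums: "(\<lambda>n. of_nat n * w ^ n) sums (w / (1 - w)\<^sup>2)" if "cmod w < 1" for w :: complex
  proof -
    have "(\<lambda>n. w * (of_nat (Suc n) * w ^ n)) sums (w * (1 / (1 - w)\<^sup>2))"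
      by (intro sums_mult geometric_deriv_sums that)
    then show ?thesis
      using sums_Suc_iff[of "\<lambda>n. of_nat n * w ^ n" "w / (1 - w)\<^sup>2"] by (simp add: mult_ac del: of_nat_Suc)
  qed
  have b: "summable (\<lambda>n. cmod (b n))"
    unfolding b_def complex_mod_cnj using sums_summable[OF sums] z by (intro powser_summable_cmod) auto
  have q: "cnj (z * cnj (cis t) / (1 - z * cnj (cis t))\<^sup>2) = (\<Sum>n. b n * cis t ^ n)" for t
  proof -
    have "(\<lambda>n. cnj (of_nat n * (z * cnj (cis t)) ^ n)) sums cnj (z * cnj (cis t) / (1 - z * cnj (cis t))\<^sup>2)"
      by (intro sums_cnj[THEN iffD2] sums) (use z in \<open>simp add: norm_mult\<close>)
    then show ?thesis
      by (simp add: sums_iff b_def power_mult_distrib mult_ac)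
  qed
  have dp: "dpoisson (z * cnj (cis t)) = cnj (\<Sum>n. b n * cis t ^ n) - (\<Sum>n. b n * cis t ^ n)" for t
    unfolding dpoisson_def q[symmetric] by simp
  have int: "integrable circ (\<lambda>t. (\<Sum>n. A n * cis t ^ n) * cnj (\<Sum>n. b n * cis t ^ n))"
      "integrable circ (\<lambda>t. (\<Sum>n. A n * cis t ^ n) * (\<Sum>n. b n * cis t ^ n))"
    by (intro integrable_circ_continuous continuous_on_mult continuous_on_cnj continuous_on_cis_series A b)+
  have "circle_mean (\<lambda>t. (\<Sum>n. A n * cis t ^ n) * dpoisson (z * cnj (cis t)))
      = circle_mean (\<lambda>t. (\<Sum>n. A n * cis t ^ n) * cnj (\<Sum>n. b n * cis t ^ n))"
    unfolding dp right_diff_distrib using circle_mean_analytic_mult[OF A b]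
    by (subst circle_mean_diff[OF int]) (simp add: b_def)
  then show ?thesis
    using circle_mean_parseval[OF A b] by (simp add: b_def)
qed

lemma circle_mean_poisson_kernel:
  assumes z: "cmod z < 1"
  shows "circle_mean (\<lambda>t. (1 - (cmod z)\<^sup>2) / (cmod (1 - z * cnj (cis t)))\<^sup>2) = 1"
proof -
  define b where "b n = cnj (z ^ n)" for n
  have b: "summable (\<lambda>n. cmod (b n))"
    using z by (simp add: b_def norm_power summable_geometric)
  have "1 / (1 - cnj z * cis t) = (\<Sum>n. b n * cis t ^ n)" for t
    using suminf_geometric[of "cnj z * cis t"] z by (simp add: norm_mult b_def power_mult_distrib)
  moreover have "cmod (1 - z * cnj (cis t)) = cmod (1 - cnj z * cis t)" for t
    using complex_mod_cnj[of "1 - z * cnj (cis t)"] by simp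
  ultimately have "of_real (1 / (cmod (1 - z * cnj (cis t)))\<^sup>2) = (\<Sum>n. b n * cis t ^ n) * cnj (\<Sum>n. b n * cis t ^ n)" for t
    unfolding complex_norm_square[symmetric] by (metis norm_divide norm_one of_real_power power_divide power_one)
  then have "(\<lambda>n. b n * cnj (b n)) sums of_real (circle_mean (\<lambda>t. 1 / (cmod (1 - z * cnj (cis t)))\<^sup>2))"
    using circle_mean_parseval[OF b b] by (simp only: circle_mean_of_real[symmetric])
  moreover have "b n * cnj (b n) = of_real (((cmod z)\<^sup>2) ^ n)" for n
  proof -
    have "b n * cnj (b n) = (z * cnj z) ^ n"
      by (simp add: b_def power_mult_distrib mult.commute)
    also have "z * cnj z = of_real ((cmod z)\<^sup>2)"
      by (simp only: complex_norm_square[symmetric] of_real_power)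
    finally show ?thesis
      by simp
  qed
  ultimately have "(\<lambda>n. ((cmod z)\<^sup>2) ^ n) sums circle_mean (\<lambda>t. 1 / (cmod (1 - z * cnj (cis t)))\<^sup>2)"
    by (simp only: sums_of_real_iff)
  moreover have "(\<lambda>n. ((cmod z)\<^sup>2) ^ n) sums (1 / (1 - (cmod z)\<^sup>2))"
    using z by (intro geometric_sums) (simp add: abs_square_less_1)
  ultimately have "circle_mean (\<lambda>t. 1 / (cmod (1 - z * cnj (cis t)))\<^sup>2) = 1 / (1 - (cmod z)\<^sup>2)"
    by (rule sums_unique2)
  moreover have "1 - (cmod z)\<^sup>2 \<noteq> 0"
    using z by (simp add: abs_square_eq_1)
  ultimately show ?thesis
    using circle_mean_mult_right[of "1 - (cmod z)\<^sup>2" "\<lambda>t. 1 / (cmod (1 - z * cnj (cis t)))\<^sup>2"] by simp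
qed

lemma poisson_kernel_continuous:
  assumes z: "cmod z < 1"
  shows "continuous_on UNIV (\<lambda>t. (1 - (cmod z)\<^sup>2) / (cmod (1 - z * cnj (cis t)))\<^sup>2)"
proof (intro continuous_intros ballI)
  show "(cmod (1 - z * cnj (cis t)))\<^sup>2 \<noteq> 0" for t
    using z by (auto simp: norm_mult dest!: arg_cong[where f = cmod])
qed

lemma chord_cubic_bound:
  fixes E :: "real \<Rightarrow> complex"
  assumes E: "(E has_vector_derivative 0) (at t)" "E t = 0" "continuous_on {0..2*pi} E"
    and t: "0 < t" "t < 2 * pi" and e: "e > 0"
  obtains C where "C \<ge> 0"
    "\<And>x. x \<in> {0..2*pi} \<Longrightarrow> cmod (E x) \<le> e * cmod (cis (t - x) - 1) + C * cmod (cis (t - x) - 1) ^ 3"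
proof -
  have lim1: "((\<lambda>x. cmod (E x) / \<bar>x - t\<bar>) \<longlongrightarrow> 0) (at t)"
  proof -
    have "((\<lambda>y. (1 / \<bar>y - t\<bar>) *\<^sub>R E y) \<longlongrightarrow> 0) (at t)"
      using E(1,2) unfolding has_vector_derivative_def has_derivative_at2 by simp
    from tendsto_norm[OF this] show ?thesis
      by (simp add: divide_inverse mult.commute)
  qed
  have "((\<lambda>x. sin (x - t)) has_field_derivative 1) (at t)"
    by (auto intro!: derivative_eq_intros)
  then have "((\<lambda>x. sin (x - t) / (x - t)) \<longlongrightarrow> 1) (at t)"
    unfolding has_field_derivative_iff by simp
  from tendsto_norm[OF this] have lim2: "((\<lambda>x. \<bar>sin (x - t)\<bar> / \<bar>x - t\<bar>) \<longlongrightarrow> 1) (at t)"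
    by simp
  have "((\<lambda>x. (cmod (E x) / \<bar>x - t\<bar>) / (\<bar>sin (x - t)\<bar> / \<bar>x - t\<bar>)) \<longlongrightarrow> 0 / 1) (at t)"
    by (intro tendsto_divide lim1 lim2) simp
  then have "\<forall>\<^sub>F x in at t. (cmod (E x) / \<bar>x - t\<bar>) / (\<bar>sin (x - t)\<bar> / \<bar>x - t\<bar>) < e"
    using e by (intro order_tendstoD(2)) auto
  moreover have "\<forall>\<^sub>F x in at t. 0 < \<bar>sin (x - t)\<bar> / \<bar>x - t\<bar>"
    using lim2 by (rule order_tendstoD(1)) simp
  moreover have "\<forall>\<^sub>F x in at t. x \<noteq> t"
    by (rule eventually_neq_at_within)
  ultimately have "\<forall>\<^sub>F x in at t. cmod (E x) < e * cmod (cis (t - x) - 1)"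
  proof eventually_elim
    case (elim x)
    then have "cmod (E x) < e * \<bar>sin (x - t)\<bar>"
      by (simp add: zero_less_divide_iff pos_divide_less_eq)
    also have "\<dots> = e * \<bar>Im (cis (t - x) - 1)\<bar>"
      using sin_minus[of "x - t"] by simp
    also have "\<dots> \<le> e * cmod (cis (t - x) - 1)"
      using e by (intro mult_left_mono abs_Im_le_cmod) auto
    finally show ?case .
  qed
  then obtain d where d: "d > 0" "\<And>x. x \<noteq> t \<Longrightarrow> dist x t < d \<Longrightarrow> cmod (E x) < e * cmod (cis (t - x) - 1)"
    unfolding eventually_at by auto
  define S where "S = {0..2*pi} - ball t d"
  have S: "compact S"
    unfolding S_def by (intro compact_diff) auto
  have pos: "cmod (cis (t - x) - 1) > 0" if "x \<in> S" for x
  proof (rule ccontr)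
    assume "\<not> ?thesis"
    then have "cos (t - x) = 1"
      by (simp add: complex_eq_iff)
    then obtain n :: int where n: "t - x = real_of_int n * 2 * pi"
      unfolding cos_one_2pi_int by blast
    have "x \<in> {0..2*pi}" "x \<noteq> t"
      using that d(1) by (auto simp: S_def)
    then have "\<bar>real_of_int n * 2 * pi\<bar> < 2 * pi"
      unfolding n[symmetric] using t by auto
    then have "\<bar>real_of_int n\<bar> * (2 * pi) < 1 * (2 * pi)"
      by (simp add: abs_mult)
    then have "\<bar>real_of_int n\<bar> < 1"
      by (rule mult_right_less_imp_less) simp
    then have "n = 0"
      by simp
    then show False
      using n \<open>x \<noteq> t\<close> by simp
  qed
  have "\<exists>C\<ge>0. \<forall>x\<in>S. cmod (E x) \<le> C * cmod (cis (t - x) - 1) ^ 3"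
  proof (cases "S = {}")
    case False
    have "continuous_on S (\<lambda>x. cmod (E x) / cmod (cis (t - x) - 1) ^ 3)"
      using pos by (intro continuous_intros continuous_on_subset[OF E(3)]) (fastforce simp: S_def)+
    then obtain y where "y \<in> S" "\<And>x. x \<in> S \<Longrightarrow> cmod (E x) / cmod (cis (t - x) - 1) ^ 3 \<le> cmod (E y) / cmod (cis (t - y) - 1) ^ 3"
      using continuous_attains_sup[OF S False] by blast
    then show ?thesis
      using pos by (intro exI[of _ "cmod (E y) / cmod (cis (t - y) - 1) ^ 3"])
        (auto simp: pos_divide_le_eq)
  qed auto
  then obtain C where C: "C \<ge> 0" "\<And>x. x \<in> S \<Longrightarrow> cmod (E x) \<le> C * cmod (cis (t - x) - 1) ^ 3"
    by blast
  show thesis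
  proof (rule that[OF C(1)])
    fix x assume x: "x \<in> {0..2*pi}"
    consider "x = t" | "x \<noteq> t" "dist x t < d" | "x \<in> S"
      using x by (auto simp: S_def dist_commute)
    then show "cmod (E x) \<le> e * cmod (cis (t - x) - 1) + C * cmod (cis (t - x) - 1) ^ 3"
    proof cases
      case 1
      then show ?thesis
        using E(2) by simp
    next
      case 2
      then show ?thesis
        using d(2)[OF 2] C(1) by (simp add: add_increasing2)
    next
      case 3
      then show ?thesis
        using C(2)[OF 3] e by (simp add: add_increasing)
    qed
  qed
qed

lemma radial_limit_of_differentiable:
  fixes a :: "nat \<Rightarrow> complex"
  assumes sq: "summable (\<lambda>n. (cmod (a n))\<^sup>2)"
    and g: "\<And>z. cmod z < 1 \<Longrightarrow> (\<lambda>n. a n * z ^ n) sums g z"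
    and t: "0 < t" "t < 2 * pi"
    and deriv: "((\<lambda>t. \<Sum>n. a n / of_nat (Suc n) * cis t ^ Suc n) has_vector_derivative c) (at t)"
  shows "((\<lambda>r. g (of_real r * cis t)) \<longlongrightarrow> c / (\<i> * cis t)) (at_left 1)"
proof -
  define A where "A n = (case n of 0 \<Rightarrow> 0 | Suc m \<Rightarrow> a m / of_nat (Suc m))" for n
  have A: "summable (\<lambda>n. cmod (A n))"
    using summable_primitive_coeffs[OF sq] by (subst summable_Suc_iff[symmetric]) (simp add: A_def)
  define G where "G x = (\<Sum>n. A n * cis x ^ n)" for x
  have G_eq: "G x = (\<Sum>n. a n / of_nat (Suc n) * cis x ^ Suc n)" for x
  proof -
    have "summable (\<lambda>n. A n * cis x ^ n)"
      by (rule summable_norm_cancel) (simp add: norm_mult norm_power A)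
    from suminf_split_head[OF this] show ?thesis
      by (simp add: G_def A_def del: power_Suc of_nat_Suc)
  qed
  have G_cont: "continuous_on UNIV G"
    unfolding G_def by (rule continuous_on_cis_series[OF A])
  define L where "L x = (cis (x - t) - 1) / \<i>" for x
  define E where "E x = G x - G t - c * L x" for x
  have L_deriv: "(L has_vector_derivative 1) (at t)"
    unfolding has_vector_derivative_def L_def
    by (rule derivative_eq_intros refl | simp add: fun_eq_iff scaleR_conv_of_real field_simps)+
  have "(G has_vector_derivative c) (at t)"
    using deriv by (simp only: G_eq[abs_def])
  then have "(E has_vector_derivative (c - 0 - c * 1)) (at t)"
    unfolding E_def by (intro derivative_intros L_deriv)
  then have E_deriv: "(E has_vector_derivative 0) (at t)"
    by simp
  have E_cont: "continuous_on S E" for S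
    unfolding E_def L_def by (intro continuous_intros continuous_on_subset[OF G_cont] subset_UNIV) simp
  have E_t: "E t = 0"
    by (simp add: E_def L_def)
  define k where "k r x = dpoisson (of_real r * cis t * cnj (cis x))" for r x
  have mean_E: "circle_mean (\<lambda>x. E x * k r x) = (of_real r * cis t) * (g (of_real r * cis t) - c / (\<i> * cis t))"
    and k_cont: "continuous_on UNIV (k r)"
    if r: "0 \<le> r" "r < 1" for r
  proof -
    define z where "z = of_real r * cis t"
    have z: "cmod z < 1"
      using r by (simp add: z_def norm_mult)
    have nz: "z * cnj (cis x) \<noteq> 1" for x
      using z by (auto simp: norm_mult dest!: arg_cong[where f = cmod])
    have k: "k r x = dpoisson (z * cnj (cis x))" for x
      by (simp add: k_def z_def)
    show k_cont: "continuous_on UNIV (k r)"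
      unfolding k[abs_def] dpoisson_def by (intro continuous_intros) (auto simp: nz)
    have 1: "circle_mean (\<lambda>x. G x * k r x) = z * g z"
    proof -
      have "(\<lambda>n. A n * (of_nat n * z ^ n)) sums circle_mean (\<lambda>x. G x * k r x)"
        unfolding G_def k by (rule circle_mean_dpoisson[OF A z])
      moreover have "(\<lambda>n. A (Suc n) * (of_nat (Suc n) * z ^ Suc n)) sums (z * g z)"
        using sums_mult[OF g[OF z], of z] by (simp add: A_def mult_ac del: of_nat_Suc)
      then have "(\<lambda>n. A n * (of_nat n * z ^ n)) sums (z * g z)"
        by (subst (asm) sums_Suc_iff) simp
      ultimately show ?thesis
        by (rule sums_unique2)
    qed
    have 2: "circle_mean (\<lambda>x. cis x ^ m * k r x) = of_nat m * z ^ m" for m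
    proof -
      have "(\<lambda>n. of_bool (n = m) * (of_nat n * z ^ n)) sums circle_mean (\<lambda>x. cis x ^ m * k r x)"
        using circle_mean_dpoisson[OF summable_cmod_of_bool z, of m]
        unfolding k sums_unique[OF sums_of_bool_mult, symmetric] .
      from sums_unique2[OF this sums_of_bool_mult] show ?thesis .
    qed
    have eq: "E x * k r x = G x * k r x - ((G t - c / \<i>) * (cis x ^ 0 * k r x) + (c / \<i>) * cnj (cis t) * (cis x ^ 1 * k r x))" for x
    proof -
      have "cis (x - t) = cis x * cnj (cis t)"
        by (simp add: cis_cnj cis_mult)
      then show ?thesis
        by (simp add: E_def L_def algebra_simps diff_divide_distrib)
    qed
    have cont: "continuous_on UNIV (\<lambda>x. cis x ^ m * k r x)" "continuous_on UNIV (\<lambda>x. G x * k r x)" for m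
      by (intro continuous_intros k_cont G_cont)+
    define H where "H x = (G t - c / \<i>) * (cis x ^ 0 * k r x) + (c / \<i>) * cnj (cis t) * (cis x ^ 1 * k r x)" for x
    have "circle_mean (\<lambda>x. E x * k r x) = circle_mean (\<lambda>x. G x * k r x) - circle_mean H"
      unfolding eq H_def[symmetric]
    proof (rule circle_mean_diff)
      show "integrable circ H"
        unfolding H_def by (intro integrable_circ_continuous continuous_on_add continuous_on_mult_left cont)
    qed (intro integrable_circ_continuous cont)
    also have "circle_mean H = circle_mean (\<lambda>x. (G t - c / \<i>) * (cis x ^ 0 * k r x))
        + circle_mean (\<lambda>x. (c / \<i>) * cnj (cis t) * (cis x ^ 1 * k r x))"
      unfolding H_def
      by (rule circle_mean_add) (intro integrable_circ_continuous continuous_on_mult_left cont)+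
    also have "circle_mean (\<lambda>x. G x * k r x) - \<dots> = z * g z - (c / \<i>) * cnj (cis t) * z"
      unfolding circle_mean_mult_right 1 2 by simp
    also have "cnj (cis t) = 1 / cis t"
      by (simp add: cis_cnj divide_inverse)
    finally show "circle_mean (\<lambda>x. E x * k r x) = (of_real r * cis t) * (g (of_real r * cis t) - c / (\<i> * cis t))"
      by (simp add: z_def algebra_simps)
  qed
  have bound: "cmod (circle_mean (\<lambda>x. E x * k r x)) \<le> e * 8 + C * (32 * (1 - r\<^sup>2))"
    if r: "0 \<le> r" "r < 1" and e: "e \<ge> 0" and C: "C \<ge> 0"
      "\<And>x. x \<in> {0..2*pi} \<Longrightarrow> cmod (E x) \<le> e * cmod (cis (t - x) - 1) + C * cmod (cis (t - x) - 1) ^ 3"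
    for r e C
  proof -
    have k: "k r x = dpoisson (of_real r * cis (t - x))" for x
      by (simp add: k_def cis_cnj cis_mult mult.assoc)
    define p where "p x = (1 - r\<^sup>2) / (cmod (1 - of_real r * cis t * cnj (cis x)))\<^sup>2" for x
    have z: "cmod (of_real r * cis t) < 1" "(cmod (of_real r * cis t))\<^sup>2 = r\<^sup>2"
      using r by (auto simp: norm_mult)
    have p_cont: "continuous_on UNIV p" and p_mean: "circle_mean p = 1"
      using poisson_kernel_continuous[OF z(1)] circle_mean_poisson_kernel[OF z(1)]
      unfolding z(2) p_def[abs_def] by auto
    have p: "p x = (1 - r\<^sup>2) / (cmod (1 - of_real r * cis (t - x)))\<^sup>2" for x
      by (simp add: p_def cis_cnj cis_mult mult.assoc)
    have le: "cmod (E x * k r x) \<le> e * 8 * p x + C * (32 * (1 - r\<^sup>2))" if x: "x \<in> {0..2*pi}" for x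
    proof -
      define s where "s = cmod (cis (t - x) - 1)"
      have "cmod (E x * k r x) \<le> (e * s + C * s ^ 3) * cmod (k r x)"
        unfolding norm_mult s_def by (intro mult_right_mono C(2)[OF x]) simp
      also have "\<dots> = e * (cmod (k r x) * s) + C * (cmod (k r x) * s ^ 3)"
        by (simp add: algebra_simps)
      also have "\<dots> \<le> e * (8 * p x) + C * (32 * (1 - r\<^sup>2))"
        unfolding k p s_def
        by (intro add_mono mult_left_mono dpoisson_bounds[OF _ r] e C(1)) auto
      finally show ?thesis
        by simp
    qed
    have "cmod (circle_mean (\<lambda>x. E x * k r x)) \<le> circle_mean (\<lambda>x. cmod (E x * k r x))"
      by (rule norm_circle_mean_le)
    also have "\<dots> \<le> circle_mean (\<lambda>x. e * 8 * p x + C * (32 * (1 - r\<^sup>2)))"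
      by (intro circle_mean_mono integrable_circ_continuous continuous_intros E_cont k_cont[OF r] p_cont
          AE_I2 le) auto
    also have "\<dots> = e * 8 + C * (32 * (1 - r\<^sup>2))"
      using p_mean by (subst circle_mean_add)
        (auto intro!: integrable_circ_continuous continuous_intros p_cont simp: circle_mean_mult_right)
    finally show ?thesis .
  qed
  have lim: "((\<lambda>r. circle_mean (\<lambda>x. E x * k r x)) \<longlongrightarrow> 0) (at_left 1)"
  proof (rule tendstoI)
    fix e :: real assume e: "e > 0"
    obtain C where C: "C \<ge> 0"
      "\<And>x. x \<in> {0..2*pi} \<Longrightarrow> cmod (E x) \<le> (e / 16) * cmod (cis (t - x) - 1) + C * cmod (cis (t - x) - 1) ^ 3"
      using chord_cubic_bound[OF E_deriv E_t E_cont t, of "e / 16"] e by auto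
    have "((\<lambda>r::real. C * (32 * (1 - r\<^sup>2))) \<longlongrightarrow> C * (32 * (1 - 1\<^sup>2))) (at_left 1)"
      by (intro tendsto_intros)
    then have "\<forall>\<^sub>F r in at_left 1. C * (32 * (1 - r\<^sup>2)) < e / 2"
      using e by (intro order_tendstoD(2)) auto
    with eventually_at_left_1 show "\<forall>\<^sub>F r in at_left 1. dist (circle_mean (\<lambda>x. E x * k r x)) 0 < e"
    proof eventually_elim
      case (elim r)
      then show ?case
        using bound[of r "e / 16" C] C e by (simp add: dist_norm)
    qed
  qed
  note ev = eventually_at_left_1
  have "\<forall>\<^sub>F r in at_left 1. circle_mean (\<lambda>x. E x * k r x)
      = (of_real r * cis t) * (g (of_real r * cis t) - c / (\<i> * cis t))"
    using ev by eventually_elim (simp add: mean_E)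
  from Lim_transform_eventually[OF lim this]
  have lim0: "((\<lambda>r. (of_real r * cis t) * (g (of_real r * cis t) - c / (\<i> * cis t))) \<longlongrightarrow> 0) (at_left 1)" .
  have "((\<lambda>r. (of_real r * cis t) * (g (of_real r * cis t) - c / (\<i> * cis t)) / (of_real r * cis t)) \<longlongrightarrow> 0 / (of_real 1 * cis t)) (at_left 1)"
    by (intro tendsto_divide lim0 tendsto_intros) auto
  moreover have "\<forall>\<^sub>F r in at_left 1. (of_real r * cis t) * (g (of_real r * cis t) - c / (\<i> * cis t)) / (of_real r * cis t)
      = g (of_real r * cis t) - c / (\<i> * cis t)"
    using ev by eventually_elim simp
  ultimately have "((\<lambda>r. g (of_real r * cis t) - c / (\<i> * cis t)) \<longlongrightarrow> 0 / (of_real 1 * cis t)) (at_left 1)"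
    by (rule Lim_transform_eventually)
  then have "((\<lambda>r. g (of_real r * cis t) - c / (\<i> * cis t)) \<longlongrightarrow> 0) (at_left 1)"
    by simp
  then show ?thesis
    by (rule LIM_zero_cancel)
qed

theorem fatou_radial_limit:
  assumes g: "g holomorphic_on ball 0 1" and bound: "\<And>z. cmod z < 1 \<Longrightarrow> cmod (g z) \<le> K"
  shows "AE t in circ. \<exists>w. ((\<lambda>r. g (of_real r * cis t)) \<longlongrightarrow> w) (at_left 1)"
proof -
  obtain a where a: "\<And>z. cmod z < 1 \<Longrightarrow> (\<lambda>n. a n * z ^ n) sums g z"
    using holomorphic_disc_powser[OF g] by metis
  have "circle_mean (\<lambda>t. (cmod (g (of_real r * cis t)))\<^sup>2) \<le> K\<^sup>2" if r: "0 \<le> r" "r < 1" for r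
  proof -
    have "circle_mean (\<lambda>t. (cmod (g (of_real r * cis t)))\<^sup>2) \<le> circle_mean (\<lambda>_. K\<^sup>2)"
      using r by (intro circle_mean_mono integrable_circ_continuous continuous_intros
          holomorphic_circle_continuous[OF g] AE_I2 power_mono bound) (auto simp: norm_mult)
    then show ?thesis
      by simp
  qed
  from summable_sq_of_circle_means(1)[OF a this]
  have sq: "summable (\<lambda>n. (cmod (a n))\<^sup>2)" .
  have "negligible {0, 2*pi}"
    by simp
  then have "AE t in lebesgue. t \<notin> {0, 2*pi}"
    using AE_not_in negligible_iff_null_sets by blast
  then have "AE t in circ. t \<notin> {0, 2*pi}"
    by (simp add: AE_restrict_space_iff) (auto elim: eventually_mono)
  with AE_primitive_differentiable[OF sq] AE_space[of circ]
  show ?thesis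
  proof eventually_elim
    case (elim t)
    then obtain c where "((\<lambda>t. \<Sum>n. a n / of_nat (Suc n) * cis t ^ Suc n) has_vector_derivative c) (at t)"
      by blast
    moreover have "0 < t" "t < 2 * pi"
      using elim by auto
    ultimately show ?case
      using radial_limit_of_differentiable[OF sq a] by blast
  qed
qed

section \<open>Von Neumann's inequality\<close>

locale contraction_op =
  fixes C :: "'a::complex_hilbert \<Rightarrow> 'a"
  assumes bounded_C: "bounded_clinear C"
    and norm_C: "norm (C x) \<le> norm x"
begin

lemma norm_power_le: "norm ((C ^^ n) x) \<le> norm x"
  by (induction n) (auto intro: order_trans[OF norm_C])

lemma power_add: "(C ^^ n) (x + y) = (C ^^ n) x + (C ^^ n) y"
  by (induction n) (auto simp: bounded_clinear_add[OF bounded_C])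

lemma power_scaleC: "(C ^^ n) (c *\<^sub>C x) = c *\<^sub>C (C ^^ n) x"
  by (induction n) (auto simp: bounded_clinear_scaleC[OF bounded_C])

lemma summable_power_series:
  assumes "summable (\<lambda>n. cmod (a n))"
  shows "summable (\<lambda>n. a n *\<^sub>C (C ^^ n) x)"
proof (rule summable_norm_cancel, rule summable_comparison_test)
  show "\<exists>N. \<forall>n\<ge>N. norm (norm (a n *\<^sub>C (C ^^ n) x)) \<le> cmod (a n) * norm x"
    by (auto simp: norm_scaleC mult_left_mono norm_power_le)
  show "summable (\<lambda>n. cmod (a n) * norm x)"
    using assms by (rule summable_mult2)
qed

definition resolvent :: "complex \<Rightarrow> 'a \<Rightarrow> 'a" where
  "resolvent \<zeta> x = (\<Sum>n. \<zeta> ^ n *\<^sub>C (C ^^ n) x)"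

text \<open>The form of the operator-valued Poisson kernel \<open>G + G\<^sup>* - I\<close>, where \<open>G = (I - \<zeta> C)\<^sup>-\<^sup>1\<close>.\<close>

definition poisson_form :: "complex \<Rightarrow> 'a \<Rightarrow> 'a \<Rightarrow> complex" where
  "poisson_form \<zeta> x y = cinner (resolvent \<zeta> x) y + cinner x (resolvent \<zeta> y) - cinner x y"

context
  fixes \<zeta> :: complex
  assumes \<zeta>: "cmod \<zeta> < 1"
begin

lemma resolvent_sums: "(\<lambda>n. \<zeta> ^ n *\<^sub>C (C ^^ n) x) sums resolvent \<zeta> x"
  unfolding resolvent_def using \<zeta>
  by (intro summable_sums summable_power_series) (simp add: norm_power summable_geometric)

lemma resolvent_add: "resolvent \<zeta> (x + y) = resolvent \<zeta> x + resolvent \<zeta> y"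
  using sums_add[OF resolvent_sums[of x] resolvent_sums[of y]] resolvent_sums[of "x + y"]
  by (simp add: power_add scaleC_add_right sums_unique2)

lemma resolvent_scaleC: "resolvent \<zeta> (c *\<^sub>C x) = c *\<^sub>C resolvent \<zeta> x"
proof -
  have "(\<lambda>n. \<zeta> ^ n *\<^sub>C (C ^^ n) (c *\<^sub>C x)) sums (c *\<^sub>C resolvent \<zeta> x)"
    using bounded_linear.sums[OF bounded_linear_scaleC[of c] resolvent_sums[of x]]
    by (simp add: power_scaleC scaleC_scaleC mult.commute)
  then show ?thesis
    using resolvent_sums sums_unique2 by blast
qed

lemma resolvent_eq: "x = resolvent \<zeta> x - \<zeta> *\<^sub>C C (resolvent \<zeta> x)"
proof -
  have "bounded_linear (\<lambda>x. \<zeta> *\<^sub>C C x)"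
    using bounded_C by (intro bounded_linear_compose[OF bounded_linear_scaleC]) (simp add: bounded_clinear_def)
  from bounded_linear.sums[OF this resolvent_sums[of x]]
  have "(\<lambda>n. \<zeta> ^ Suc n *\<^sub>C (C ^^ Suc n) x) sums (\<zeta> *\<^sub>C C (resolvent \<zeta> x))"
    by (simp add: bounded_clinear_scaleC[OF bounded_C] scaleC_scaleC)
  then have "(\<lambda>n. \<zeta> ^ n *\<^sub>C (C ^^ n) x) sums (\<zeta> *\<^sub>C C (resolvent \<zeta> x) + x)"
    using sums_Suc_iff[of "\<lambda>n. \<zeta> ^ n *\<^sub>C (C ^^ n) x"] by (simp add: scaleC_one)
  from sums_unique2[OF resolvent_sums this] have "resolvent \<zeta> x = \<zeta> *\<^sub>C C (resolvent \<zeta> x) + x" .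
  then show ?thesis
    by (metis add_diff_cancel_left')
qed

lemma poisson_form_nonneg: "0 \<le> Re (poisson_form \<zeta> x x)"
proof -
  define v where "v = resolvent \<zeta> x"
  define u where "u = \<zeta> *\<^sub>C C v"
  have x: "x = v - u"
    unfolding v_def u_def by (rule resolvent_eq)
  have "norm u \<le> 1 * norm v"
    unfolding u_def norm_scaleC using \<zeta> by (intro mult_mono norm_C) auto
  then have "(norm u)\<^sup>2 \<le> (norm v)\<^sup>2"
    by (intro power_mono) auto
  moreover have "Re (poisson_form \<zeta> x x) = 2 * Re (cinner v x) - (norm x)\<^sup>2"
    using cinner_commute[of x v] by (simp add: poisson_form_def v_def[symmetric] cinner_self_Re)
  moreover have "\<dots> = (norm v)\<^sup>2 - (norm u)\<^sup>2"
    unfolding x norm_diff_sq by (simp add: cinner_diff_right cinner_self_Re)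
  ultimately show ?thesis
    by simp
qed

lemma poisson_form_bound:
  "2 * cmod (poisson_form \<zeta> x y) \<le> Re (poisson_form \<zeta> x x) + Re (poisson_form \<zeta> y y)"
proof (cases "poisson_form \<zeta> x y = 0")
  case False
  define e where "e = - sgn (poisson_form \<zeta> x y)"
  have e: "cnj e * e = 1" "cnj e * poisson_form \<zeta> x y = - cmod (poisson_form \<zeta> x y)"
  proof -
    have "cmod e = 1"
      using False by (simp add: e_def norm_sgn)
    then show "cnj e * e = 1"
      using complex_norm_square[of e] by (simp add: mult.commute)
    have "cnj (sgn w) * w = cmod w" for w
    proof (cases "w = 0")
      case False
      have "cnj (sgn w) * w = (w * cnj w) / cmod w"
        by (simp add: sgn_eq mult.commute)
      also have "\<dots> = cmod w"
        unfolding complex_norm_square[symmetric] using False by (simp add: power2_eq_square)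
      finally show ?thesis .
    qed simp
    then show "cnj e * poisson_form \<zeta> x y = - cmod (poisson_form \<zeta> x y)"
      by (simp add: e_def)
  qed
  have herm: "poisson_form \<zeta> y x = cnj (poisson_form \<zeta> x y)"
    unfolding poisson_form_def
    by (simp add: cinner_commute[of y "resolvent \<zeta> x"] cinner_commute[of y x]
        cinner_commute[of "resolvent \<zeta> y" x])
  have "poisson_form \<zeta> (x + e *\<^sub>C y) (x + e *\<^sub>C y) = poisson_form \<zeta> x x
      + (cnj e * e) * poisson_form \<zeta> y y + cnj e * poisson_form \<zeta> x y + e * poisson_form \<zeta> y x"
    unfolding poisson_form_def resolvent_add resolvent_scaleC cinner_add_left cinner_add_right
      cinner_scaleC_left cinner_scaleC_right by (simp add: algebra_simps)
  moreover have "e * poisson_form \<zeta> y x = cnj (cnj e * poisson_form \<zeta> x y)"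
    by (simp add: herm)
  ultimately have "Re (poisson_form \<zeta> (x + e *\<^sub>C y) (x + e *\<^sub>C y))
      = Re (poisson_form \<zeta> x x) + Re (poisson_form \<zeta> y y) - 2 * cmod (poisson_form \<zeta> x y)"
    unfolding e by simp
  then show ?thesis
    using poisson_form_nonneg[of "x + e *\<^sub>C y"] by simp
qed (use poisson_form_nonneg[of x] poisson_form_nonneg[of y] in simp)

end

lemma circle_mean_poisson_form:
  fixes a :: "nat \<Rightarrow> complex"
  assumes s: "0 \<le> s" "s < 1" and a: "summable (\<lambda>n. cmod (a n))"
  shows "circle_mean (\<lambda>t. (\<Sum>n. a n * cis t ^ n) * poisson_form (of_real s * cnj (cis t)) x y)
      = cinner (\<Sum>n. (a n * of_real s ^ n) *\<^sub>C (C ^^ n) x) y"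
    and "continuous_on UNIV (\<lambda>t. poisson_form (of_real s * cnj (cis t)) x y)"
proof -
  define b where "b x y n = of_real s ^ n * cinner y ((C ^^ n) x)" for x y n
  have b: "summable (\<lambda>n. cmod (b x y n))" for x y
  proof (rule summable_comparison_test)
    have "cmod (cinner y ((C ^^ n) x)) \<le> norm y * norm x" for n
      using norm_cinner_le[of y "(C ^^ n) x"] mult_left_mono[OF norm_power_le[of n x], of "norm y"]
      by simp
    then show "\<exists>N. \<forall>n\<ge>N. norm (cmod (b x y n)) \<le> s ^ n * (norm y * norm x)"
      using s by (auto simp: b_def norm_mult norm_power intro!: mult_left_mono)
    show "summable (\<lambda>n. s ^ n * (norm y * norm x))"
      using s by (intro summable_mult2 summable_geometric) simp
  qed
  have z: "cmod (of_real s * cnj (cis t)) < 1" for t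
    using s by (simp add: norm_mult)
  have res: "cinner y (resolvent (of_real s * cnj (cis t)) x) = (\<Sum>n. b x y n * cis t ^ n)" for x y t
  proof -
    have "(\<lambda>n. cinner y ((of_real s * cnj (cis t)) ^ n *\<^sub>C (C ^^ n) x)) sums
        cinner y (resolvent (of_real s * cnj (cis t)) x)"
      by (rule bounded_linear.sums[OF bounded_linear_cinner_right resolvent_sums[OF z]])
    then show ?thesis
      by (simp add: sums_iff b_def cinner_scaleC_right power_mult_distrib mult_ac)
  qed
  have form: "poisson_form (of_real s * cnj (cis t)) x y
      = cnj (\<Sum>n. b x y n * cis t ^ n) + (\<Sum>n. b y x n * cis t ^ n) - cinner x y" for t
    unfolding poisson_form_def res[symmetric] by (simp add: cinner_commute[of "resolvent _ x" y])
  show "continuous_on UNIV (\<lambda>t. poisson_form (of_real s * cnj (cis t)) x y)"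
    unfolding form by (intro continuous_intros continuous_on_cnj continuous_on_cis_series b)
  define p where "p t = (\<Sum>n. a n * cis t ^ n)" for t
  have p: "continuous_on UNIV p"
    unfolding p_def by (rule continuous_on_cis_series[OF a])
  have 1: "circle_mean (\<lambda>t. p t * cnj (\<Sum>n. b x y n * cis t ^ n)) = cinner (\<Sum>n. (a n * of_real s ^ n) *\<^sub>C (C ^^ n) x) y"
  proof -
    have "cmod (a n * of_real s ^ n) \<le> cmod (a n)" for n
      using s by (simp add: norm_mult norm_power mult_left_le power_le_one)
    then have "summable (\<lambda>n. cmod (a n * of_real s ^ n))"
      by (intro summable_comparison_test[OF _ a]) auto
    then have "(\<lambda>n. cinner ((a n * of_real s ^ n) *\<^sub>C (C ^^ n) x) y) sums
        cinner (\<Sum>n. (a n * of_real s ^ n) *\<^sub>C (C ^^ n) x) y"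
      by (intro bounded_linear.sums[OF bounded_linear_cinner_left] summable_sums summable_power_series)
    moreover have "cinner ((a n * of_real s ^ n) *\<^sub>C (C ^^ n) x) y = a n * cnj (b x y n)" for n
      by (simp add: b_def cinner_scaleC_left cinner_commute[of y])
    ultimately have "(\<lambda>n. a n * cnj (b x y n)) sums cinner (\<Sum>n. (a n * of_real s ^ n) *\<^sub>C (C ^^ n) x) y"
      by simp
    with circle_mean_parseval[OF a b] show ?thesis
      unfolding p_def by (rule sums_unique2)
  qed
  have 2: "circle_mean (\<lambda>t. p t * (\<Sum>n. b y x n * cis t ^ n)) = a 0 * cinner x y"
    unfolding p_def circle_mean_analytic_mult[OF a b] by (simp add: b_def)
  have 3: "circle_mean (\<lambda>t. p t * cinner x y) = a 0 * cinner x y"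
  proof -
    have "(\<Sum>n. of_bool (n = 0) * cis t ^ n) = 1" for t
      using sums_of_bool_mult[of 0 "\<lambda>n. cis t ^ n"] by (simp add: sums_iff)
    then show ?thesis
      using circle_mean_analytic_mult[OF a summable_cmod_of_bool, of 0]
      by (simp add: circle_mean_mult_left p_def)
  qed
  have c: "continuous_on UNIV (\<lambda>t. p t * cnj (\<Sum>n. b x y n * cis t ^ n))"
      "continuous_on UNIV (\<lambda>t. p t * (\<Sum>n. b y x n * cis t ^ n))" "continuous_on UNIV (\<lambda>t. p t * cinner x y)"
    by (intro continuous_on_mult continuous_on_cnj continuous_on_cis_series continuous_on_const b p)+
  have "circle_mean (\<lambda>t. p t * poisson_form (of_real s * cnj (cis t)) x y)
      = circle_mean (\<lambda>t. p t * cnj (\<Sum>n. b x y n * cis t ^ n) + p t * (\<Sum>n. b y x n * cis t ^ n) - p t * cinner x y)"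
    by (simp only: form distrib_left right_diff_distrib)
  also have "\<dots> = circle_mean (\<lambda>t. p t * cnj (\<Sum>n. b x y n * cis t ^ n))
      + circle_mean (\<lambda>t. p t * (\<Sum>n. b y x n * cis t ^ n)) - circle_mean (\<lambda>t. p t * cinner x y)"
    using c[THEN integrable_circ_continuous]
    by (simp only: circle_mean_diff circle_mean_add Bochner_Integration.integrable_add)
  finally show "circle_mean (\<lambda>t. (\<Sum>n. a n * cis t ^ n) * poisson_form (of_real s * cnj (cis t)) x y)
      = cinner (\<Sum>n. (a n * of_real s ^ n) *\<^sub>C (C ^^ n) x) y"
    unfolding 1 2 3 p_def[symmetric] by simp
qed

theorem von_neumann_inequality:
  fixes a :: "nat \<Rightarrow> complex"
  assumes a: "\<And>z. cmod z < 1 \<Longrightarrow> (\<lambda>n. a n * z ^ n) sums \<phi> z"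
    and bound: "\<And>z. cmod z < 1 \<Longrightarrow> cmod (\<phi> z) \<le> 1"
    and r: "0 \<le> r" "r < 1"
  shows "norm (\<Sum>n. (a n * of_real r ^ n) *\<^sub>C (C ^^ n) x) \<le> norm x"
proof -
  define s where "s = sqrt r"
  have s: "0 \<le> s" "s < 1" "s * s = r"
    using r by (auto simp: s_def real_sqrt_lt_1_iff)
  define b where "b n = a n * of_real s ^ n" for n
  have b: "summable (\<lambda>n. cmod (b n))"
    unfolding b_def using a s by (intro powser_summable_cmod) (auto simp: sums_iff)
  define Y where "Y = (\<Sum>n. (b n * of_real s ^ n) *\<^sub>C (C ^^ n) x)"
  have Y: "Y = (\<Sum>n. (a n * of_real r ^ n) *\<^sub>C (C ^^ n) x)"
    unfolding Y_def b_def s(3)[symmetric] by (simp add: power_mult_distrib mult_ac)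
  define q where "q x y t = poisson_form (of_real s * cnj (cis t)) x y" for x y t
  have z: "cmod (of_real s * cnj (cis t)) < 1" for t
    using s by (simp add: norm_mult)
  have qc: "continuous_on UNIV (q x y)" for x y
    unfolding q_def by (rule circle_mean_poisson_form(2)[OF s(1,2) b])
  have mean_q: "circle_mean (\<lambda>t. Re (q x x t)) = (norm x)\<^sup>2" for x
  proof -
    define d where "d n = (of_bool (n = 0) :: complex)" for n :: nat
    have d: "summable (\<lambda>n. cmod (d n))"
      unfolding d_def by (rule summable_cmod_of_bool)
    have "(\<lambda>n. (d n * of_real s ^ n) *\<^sub>C (C ^^ n) x) = (\<lambda>n. if n = 0 then x else 0)"
      by (auto simp: d_def scaleC_one scaleC_zero_left)
    then have "(\<Sum>n. (d n * of_real s ^ n) *\<^sub>C (C ^^ n) x) = x"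
      using sums_single[of 0 "\<lambda>_. x"] by (simp add: sums_iff)
    moreover have "(\<Sum>n. d n * cis t ^ n) = 1" for t
      using sums_of_bool_mult[of 0 "\<lambda>n. cis t ^ n"] by (simp add: d_def sums_iff)
    ultimately have "circle_mean (\<lambda>t. q x x t) = cinner x x"
      using circle_mean_poisson_form(1)[OF s(1,2) d, of x x] by (simp add: q_def)
    then show ?thesis
      by (simp add: Re_circle_mean integrable_circ_continuous qc cinner_self_Re)
  qed
  have main: "2 * cmod (cinner Y y) \<le> (norm x)\<^sup>2 + (norm y)\<^sup>2" for y
  proof -
    have p: "cmod (\<Sum>n. b n * cis t ^ n) \<le> 1" for t
    proof -
      have "(\<Sum>n. b n * cis t ^ n) = \<phi> (of_real s * cis t)"
        using a[of "of_real s * cis t"] s by (simp add: sums_iff b_def norm_mult power_mult_distrib mult_ac)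
      then show ?thesis
        using bound[of "of_real s * cis t"] s by (simp add: norm_mult)
    qed
    have pc: "continuous_on UNIV (\<lambda>t. \<Sum>n. b n * cis t ^ n)"
      by (rule continuous_on_cis_series[OF b])
    have "2 * cmod (cinner Y y) = 2 * cmod (circle_mean (\<lambda>t. (\<Sum>n. b n * cis t ^ n) * q x y t))"
      unfolding Y_def q_def by (simp only: circle_mean_poisson_form(1)[OF s(1,2) b])
    also have "\<dots> \<le> 2 * circle_mean (\<lambda>t. cmod ((\<Sum>n. b n * cis t ^ n) * q x y t))"
      by (intro mult_left_mono norm_circle_mean_le) simp
    also have "\<dots> = circle_mean (\<lambda>t. 2 * cmod ((\<Sum>n. b n * cis t ^ n) * q x y t))"
      by (simp only: circle_mean_mult_right)
    also have "\<dots> \<le> circle_mean (\<lambda>t. Re (q x x t) + Re (q y y t))"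
    proof (intro circle_mean_mono AE_I2)
      fix t
      have "cmod ((\<Sum>n. b n * cis t ^ n) * q x y t) \<le> 1 * cmod (q x y t)"
        unfolding norm_mult by (intro mult_right_mono p) simp
      then show "2 * cmod ((\<Sum>n. b n * cis t ^ n) * q x y t) \<le> Re (q x x t) + Re (q y y t)"
        using poisson_form_bound[OF z[of t], of x y] by (simp add: q_def)
    qed (intro integrable_circ_continuous continuous_intros qc pc)+
    also have "\<dots> = (norm x)\<^sup>2 + (norm y)\<^sup>2"
      by (subst circle_mean_add) (intro integrable_circ_continuous continuous_intros qc | simp add: mean_q)+
    finally show ?thesis .
  qed
  have "norm Y \<le> norm x"
  proof (cases "Y = 0")
    case False
    define c where "c = norm x / norm Y"
    have "cinner Y (c *\<^sub>R Y) = of_real (c * (norm Y)\<^sup>2)"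
      by (simp add: cinner_scaleR_right cinner_self)
    moreover have "c * (norm Y)\<^sup>2 = norm x * norm Y" "norm (c *\<^sub>R Y) = norm x"
      using False by (auto simp: c_def power2_eq_square)
    ultimately have "2 * (norm x * norm Y) \<le> 2 * (norm x)\<^sup>2"
      using main[of "c *\<^sub>R Y"] by (simp add: norm_mult)
    moreover have "x \<noteq> 0"
      using main[of "(1 / norm Y) *\<^sub>R Y"] main[of Y] main[of "(1/2) *\<^sub>R Y"] False
      by (auto simp: cinner_self cinner_scaleR_right norm_mult power2_eq_square)
    ultimately show ?thesis
      by (simp add: power2_eq_square)
  qed simp
  then show ?thesis
    by (simp only: Y)
qed

end

section \<open>Beurling's theorem\<close>

lemma cinner_shift_shift: "cinner (hardy_shift f) (hardy_shift g) = cinner f g"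
  by (simp add: cinner_hardy_shift)

lemma cinner_shift_funpow:
  "cinner ((hardy_shift ^^ n) f) ((hardy_shift ^^ n) g) = cinner f g"
  by (induction n) (auto simp: cinner_shift_shift)

lemma hardy_eval_shift_funpow:
  "cmod z < 1 \<Longrightarrow> hardy_eval ((hardy_shift ^^ n) f) z = z ^ n * hardy_eval f z"
  by (induction n) (auto simp: hardy_eval_shift scaleC_complex_def)

lemma hardy_eval_sum_shift:
  assumes z: "cmod z < 1"
  shows "hardy_eval (\<Sum>n<N. c n *\<^sub>C (hardy_shift ^^ n) \<theta>) z = (\<Sum>n<N. c n * z ^ n) * hardy_eval \<theta> z"
proof (induction N)
  case 0
  then show ?case
    using hardy_eval_diff[OF z, of 0 0] by simp
next
  case (Suc N)
  then show ?case
    using z by (simp add: hardy_eval_add hardy_eval_scaleC hardy_eval_shift_funpow scaleC_complex_def algebra_simps)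
qed

lemma cinner_hardy_kernel:
  assumes z: "cmod z < 1"
  obtains k where "\<And>f. cinner f k = hardy_eval f z" "(norm k)\<^sup>2 = 1 / (1 - (cmod z)\<^sup>2)"
proof
  have z2: "(cmod z)\<^sup>2 < 1"
    using z by (simp add: abs_square_less_1)
  have sq: "(norm (cnj z ^ n))\<^sup>2 = ((cmod z)\<^sup>2) ^ n" for n
    by (simp add: norm_power power_mult[symmetric] mult.commute)
  define k where "k = Hardy (\<lambda>n. cnj z ^ n)"
  have coeff: "hardy_coeff k = (\<lambda>n. cnj z ^ n)"
    unfolding k_def using z2 by (intro Hardy_inverse) (simp add: sq summable_geometric)
  show "cinner f k = hardy_eval f z" for f
    using hardy_eval_sums_complex[OF z, of f]
    by (simp add: cinner_hardy.rep_eq coeff cinner_complex_def sums_iff)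
  show "(norm k)\<^sup>2 = 1 / (1 - (cmod z)\<^sup>2)"
    using z2 by (simp add: norm_hardy_sq coeff sq suminf_geometric)
qed

lemma sum_diagonal: "(\<Sum>n<N. \<Sum>m<N. f n m * of_bool (n = m)) = (\<Sum>n<N. f n n :: complex)"
  for N :: nat
proof (intro sum.cong refl)
  fix n assume n: "n \<in> {..<N}"
  have "(\<Sum>m<N. f n m * of_bool (n = m)) = (\<Sum>m<N. if n = m then f n m else 0)"
    by (intro sum.cong) auto
  also have "\<dots> = f n n"
    using n by (subst sum.delta') auto
  finally show "(\<Sum>m<N. f n m * of_bool (n = m)) = f n n" .
qed

lemma norm_hardy_eval_le_1:
  fixes \<theta> :: "complex hardy"
  assumes orth: "\<And>n m. cinner ((hardy_shift ^^ n) \<theta>) ((hardy_shift ^^ m) \<theta>) = of_bool (n = m)"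
    and z: "cmod z < 1"
  shows "cmod (hardy_eval \<theta> z) \<le> 1"
proof -
  obtain k where k: "\<And>f. cinner f k = hardy_eval f z" "(norm k)\<^sup>2 = 1 / (1 - (cmod z)\<^sup>2)"
    using cinner_hardy_kernel[OF z] by metis
  have z2: "(cmod z)\<^sup>2 < 1"
    using z by (simp add: abs_square_less_1)
  define A where "A N = (\<Sum>n<N. ((cmod z)\<^sup>2) ^ n)" for N
  have A_lim: "A \<longlonglongrightarrow> (norm k)\<^sup>2"
    unfolding A_def k(2) using geometric_sums[of "(cmod z)\<^sup>2"] z2 by (simp add: sums_def)
  have A0: "0 \<le> A N" for N
    by (simp add: A_def sum_nonneg)
  define h where "h N = (\<Sum>n<N. cnj z ^ n *\<^sub>C (hardy_shift ^^ n) \<theta>)" for N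
  have zz: "z ^ n * cnj z ^ n = of_real (((cmod z)\<^sup>2) ^ n)" for n
  proof -
    have "z ^ n * cnj z ^ n = (z * cnj z) ^ n"
      by (simp add: power_mult_distrib)
    then show ?thesis
      by (simp only: complex_norm_square[symmetric] of_real_power)
  qed
  have "cinner (h N) (h N) = of_real (A N)" for N
  proof -
    have "cinner (h N) (h N) = (\<Sum>n<N. \<Sum>m<N. cnj z ^ n * z ^ m * of_bool (n = m))"
      unfolding h_def cinner_sum_left unfolding cinner_sum_right cinner_scaleC_left cinner_scaleC_right orth
      by (simp add: mult_ac)
    also have "\<dots> = (\<Sum>n<N. z ^ n * cnj z ^ n)"
      unfolding sum_diagonal by (simp add: mult.commute)
    finally show ?thesis
      by (simp only: zz A_def of_real_sum)
  qed
  then have norm_h: "(norm (h N))\<^sup>2 = A N" for N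
    by (simp add: cinner_self_Re)
  have "cinner (h N) k = hardy_eval \<theta> z * of_real (A N)" for N
  proof -
    have "cinner (h N) k = (\<Sum>n<N. z ^ n * cnj z ^ n) * hardy_eval \<theta> z"
      unfolding h_def k(1) hardy_eval_sum_shift[OF z] by (simp add: mult.commute)
    then show ?thesis
      unfolding zz by (simp add: A_def mult.commute)
  qed
  then have "(cmod (hardy_eval \<theta> z))\<^sup>2 * (A N)\<^sup>2 \<le> A N * (norm k)\<^sup>2" for N
    using power_mono[OF norm_cinner_le[of "h N" k], of 2] A0[of N]
    by (simp add: norm_mult power_mult_distrib norm_h)
  moreover have "(\<lambda>N. (cmod (hardy_eval \<theta> z))\<^sup>2 * (A N)\<^sup>2) \<longlonglongrightarrow> (cmod (hardy_eval \<theta> z))\<^sup>2 * ((norm k)\<^sup>2)\<^sup>2"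
    "(\<lambda>N. A N * (norm k)\<^sup>2) \<longlonglongrightarrow> (norm k)\<^sup>2 * (norm k)\<^sup>2"
    by (intro tendsto_intros A_lim)+
  ultimately have "(cmod (hardy_eval \<theta> z))\<^sup>2 * ((norm k)\<^sup>2)\<^sup>2 \<le> (norm k)\<^sup>2 * (norm k)\<^sup>2"
    by (meson LIMSEQ_le)
  moreover have "0 < (norm k)\<^sup>2"
    using z2 by (simp add: k(2))
  ultimately have "(cmod (hardy_eval \<theta> z))\<^sup>2 \<le> 1"
    by (simp add: power2_eq_square[of "(norm k)\<^sup>2"])
  then show ?thesis
    by (simp add: abs_square_le_1)
qed

lemma inner_function_hardy_eval:
  fixes \<theta> :: "complex hardy"
  assumes norm: "norm \<theta> = 1" and bound: "\<And>z. cmod z < 1 \<Longrightarrow> cmod (hardy_eval \<theta> z) \<le> 1"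
  shows "inner_function (hardy_eval \<theta>)"
proof -
  note hol = holomorphic_hardy_eval[of \<theta>]
  define r where "r = radius"
  note r = radius_bounds[folded r_def] and r_lim = tendsto_radius[folded r_def]
    and r_at_left = radius_at_left[folded r_def]
  define f where "f k t = hardy_eval \<theta> (of_real (r k) * cis t)" for k t
  define w where "w t = lim (\<lambda>k. f k t)" for t
  have f_meas: "f k \<in> borel_measurable circ" for k
    unfolding f_def by (intro measurable_circ_continuous holomorphic_circle_continuous[OF hol] r)
  have w_meas: "w \<in> borel_measurable circ"
    unfolding w_def by (intro borel_measurable_lim_metric f_meas)
  have f_le: "cmod (f k t) \<le> 1" for k t
    unfolding f_def using r[of k] by (intro bound) (simp add: norm_mult)
  have fatou: "AE t in circ. \<exists>w. ((\<lambda>r. hardy_eval \<theta> (of_real r * cis t)) \<longlongrightarrow> w) (at_left 1)"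
    by (rule fatou_radial_limit[OF hol bound])
  then have lim: "AE t in circ. ((\<lambda>r. hardy_eval \<theta> (of_real r * cis t)) \<longlongrightarrow> w t) (at_left 1) \<and> f_lim t"
    if "f_lim = (\<lambda>t. (\<lambda>k. f k t) \<longlonglongrightarrow> w t)" for f_lim
  proof eventually_elim
    case (elim t)
    then obtain v where v: "((\<lambda>r. hardy_eval \<theta> (of_real r * cis t)) \<longlongrightarrow> v) (at_left 1)"
      by blast
    have "(\<lambda>k. f k t) \<longlonglongrightarrow> v"
      unfolding f_def by (rule filterlim_compose[OF v r_at_left])
    then show ?case
      using v by (simp add: that w_def limI)
  qed
  note lim = lim[OF refl]
  have w_le: "AE t in circ. cmod (w t) \<le> 1"
    using lim
  proof eventually_elim
    case (elim t)
    then have "(\<lambda>k. cmod (f k t)) \<longlonglongrightarrow> cmod (w t)"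
      by (intro tendsto_norm) blast
    then show ?case
      by (rule LIMSEQ_le_const2) (use f_le in blast)
  qed
  have mean_lim: "(\<lambda>k. circle_mean (\<lambda>t. (cmod (f k t))\<^sup>2)) \<longlonglongrightarrow> circle_mean (\<lambda>t. (cmod (w t))\<^sup>2)"
  proof (rule circle_mean_tendsto[where w = "\<lambda>_. 1"])
    show "AE t in circ. (\<lambda>i. (cmod (f i t))\<^sup>2) \<longlonglongrightarrow> (cmod (w t))\<^sup>2"
      using lim by eventually_elim (intro tendsto_intros, blast)
    show "AE t in circ. norm ((cmod (f i t))\<^sup>2) \<le> 1" for i
      using f_le by (intro AE_I2) (simp add: power_le_one)
  qed (use f_meas w_meas in measurable)
  have partial: "(\<Sum>n<N. (cmod (hardy_coeff \<theta> n))\<^sup>2) \<le> circle_mean (\<lambda>t. (cmod (w t))\<^sup>2)" for N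
  proof (rule LIMSEQ_le[OF _ mean_lim])
    show "(\<lambda>k. \<Sum>n<N. (cmod (hardy_coeff \<theta> n))\<^sup>2 * r k ^ (2 * n)) \<longlonglongrightarrow> (\<Sum>n<N. (cmod (hardy_coeff \<theta> n))\<^sup>2)"
      by (auto intro!: tendsto_eq_intros r_lim)
    have "(\<Sum>n<N. (cmod (hardy_coeff \<theta> n))\<^sup>2 * r k ^ (2 * n)) \<le> circle_mean (\<lambda>t. (cmod (f k t))\<^sup>2)" for k
    proof -
      have s: "(\<lambda>n. (cmod (hardy_coeff \<theta> n))\<^sup>2 * r k ^ (2 * n)) sums circle_mean (\<lambda>t. (cmod (f k t))\<^sup>2)"
        unfolding f_def by (rule powser_parseval[OF hardy_eval_sums_complex r])
      show ?thesis
        unfolding sums_unique[OF s] using r(1)[of k] by (intro sum_le_suminf sums_summable[OF s]) auto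
    qed
    then show "\<exists>K. \<forall>k\<ge>K. (\<Sum>n<N. (cmod (hardy_coeff \<theta> n))\<^sup>2 * r k ^ (2 * n)) \<le> circle_mean (\<lambda>t. (cmod (f k t))\<^sup>2)"
      by blast
  qed
  have "(\<Sum>n. (cmod (hardy_coeff \<theta> n))\<^sup>2) \<le> circle_mean (\<lambda>t. (cmod (w t))\<^sup>2)"
    using partial by (rule suminf_le_const[OF summable_hardy])
  then have "1 \<le> circle_mean (\<lambda>t. (cmod (w t))\<^sup>2)"
    using norm_hardy_sq[of \<theta>] norm by simp
  moreover have w_int: "integrable circ (\<lambda>t. (cmod (w t))\<^sup>2)"
  proof (rule Bochner_Integration.integrable_bound[of _ "\<lambda>_. 1 :: real"])
    show "AE t in circ. norm ((cmod (w t))\<^sup>2) \<le> norm (1 :: real)"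
      using w_le by eventually_elim (simp add: power_le_one)
  qed (use w_meas in measurable)
  ultimately have "circle_mean (\<lambda>t. 1 - (cmod (w t))\<^sup>2) \<le> 0"
    by (subst circle_mean_diff) auto
  then have "(\<integral>t. 1 - (cmod (w t))\<^sup>2 \<partial>circ) \<le> 0"
    using pi_gt_zero by (auto simp: circle_mean_def mult_le_0_iff divide_le_0_iff)
  moreover have nonneg: "AE t in circ. 0 \<le> 1 - (cmod (w t))\<^sup>2"
    using w_le by eventually_elim (simp add: power_le_one)
  ultimately have "(\<integral>t. 1 - (cmod (w t))\<^sup>2 \<partial>circ) = 0"
    using integral_nonneg_AE[OF nonneg] by simp
  then have "AE t in circ. 1 - (cmod (w t))\<^sup>2 = 0"
    using integral_nonneg_eq_0_iff_AE[OF Bochner_Integration.integrable_diff[OF integrable_circ_const w_int] nonneg]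
    by simp
  with lim have "AE t in circ. \<exists>w. ((\<lambda>r. hardy_eval \<theta> (of_real r * cis t)) \<longlongrightarrow> w) (at_left 1) \<and> cmod w = 1"
  proof eventually_elim
    case (elim t)
    then have "(cmod (w t))\<^sup>2 = 1"
      by simp
    then have "cmod (w t) = 1"
      unfolding abs_square_eq_1 by simp
    then show ?case
      using elim by blast
  qed
  moreover have "bounded (hardy_eval \<theta> ` ball 0 1)"
    using bound by (auto simp: bounded_iff intro!: exI[of _ 1])
  ultimately show ?thesis
    unfolding inner_function_def using hol by blast
qed

definition isometric_symbol :: "complex hardy \<Rightarrow> bool" where
  "isometric_symbol \<theta> \<longleftrightarrow>
    (\<forall>n m. cinner ((hardy_shift ^^ n) \<theta>) ((hardy_shift ^^ m) \<theta>) = of_bool (n = m))"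

abbreviation hardy_mult :: "complex hardy \<Rightarrow> complex hardy \<Rightarrow> complex hardy" where
  "hardy_mult \<theta> \<equiv> mult_op (\<lambda>z x. hardy_eval \<theta> z * x)"

lemma isometric_symbol_contraction:
  assumes "isometric_symbol \<theta>"
  shows "analytic_contraction (\<lambda>z x. hardy_eval \<theta> z * x)"
  using assms norm_hardy_eval_le_1 holomorphic_hardy_eval unfolding isometric_symbol_def
  by (intro analytic_contraction_scalar) auto

lemma hardy_mult_trunc:
  assumes "isometric_symbol \<theta>"
  shows "hardy_mult \<theta> (hardy_trunc N f) = (\<Sum>n<N. hardy_coeff f n *\<^sub>C (hardy_shift ^^ n) \<theta>)"
proof -
  interpret analytic_contraction "\<lambda>z x. hardy_eval \<theta> z * x"
    by (rule isometric_symbol_contraction[OF assms])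
  show ?thesis
    by (rule mult_op_eqI)
      (simp add: hardy_eval_sum_shift hardy_eval_trunc scaleC_complex_def sum_distrib_left mult_ac)
qed

lemma hardy_mult_const: "isometric_symbol \<theta> \<Longrightarrow> hardy_mult \<theta> (hardy_const 1) = \<theta>"
  by (rule analytic_contraction.mult_op_eqI[OF isometric_symbol_contraction])
    (auto simp: hardy_eval_const)

lemma hardy_mult_shift_funpow:
  assumes "isometric_symbol \<theta>"
  shows "hardy_mult \<theta> ((hardy_shift ^^ n) (hardy_const 1)) = (hardy_shift ^^ n) \<theta>"
  by (induction n)
    (auto simp: hardy_mult_const assms analytic_contraction.mult_op_shift[OF isometric_symbol_contraction])

lemma norm_hardy_mult:
  assumes iso: "isometric_symbol \<theta>"
  shows "norm (hardy_mult \<theta> f) = norm f"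
proof -
  interpret analytic_contraction "\<lambda>z x. hardy_eval \<theta> z * x"
    by (rule isometric_symbol_contraction[OF iso])
  have trunc: "norm (hardy_mult \<theta> (hardy_trunc N f)) = norm (hardy_trunc N f)" for N
  proof -
    have "cinner (hardy_mult \<theta> (hardy_trunc N f)) (hardy_mult \<theta> (hardy_trunc N f))
        = (\<Sum>n<N. \<Sum>m<N. hardy_coeff f n * cnj (hardy_coeff f m) * of_bool (n = m))"
      unfolding hardy_mult_trunc[OF iso] cinner_sum_left
      unfolding cinner_sum_right cinner_scaleC_left cinner_scaleC_right
      using iso by (simp add: isometric_symbol_def mult_ac)
    also have "\<dots> = (\<Sum>n<N. hardy_coeff f n * cnj (hardy_coeff f n))"
      by (rule sum_diagonal)
    also have "\<dots> = of_real (\<Sum>n<N. (cmod (hardy_coeff f n))\<^sup>2)"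
      by (simp only: of_real_sum of_real_power complex_norm_square[symmetric])
    also have "(\<Sum>n<N. (cmod (hardy_coeff f n))\<^sup>2) = (norm (hardy_trunc N f))\<^sup>2"
    proof -
      have "(\<lambda>n. (norm (hardy_coeff (hardy_trunc N f) n))\<^sup>2) = (\<lambda>n. if n \<in> {..<N} then (cmod (hardy_coeff f n))\<^sup>2 else 0)"
        by (auto simp: hardy_trunc.rep_eq)
      then show ?thesis
        unfolding norm_hardy_sq using sums_If_finite_set[of "{..<N}" "\<lambda>n. (cmod (hardy_coeff f n))\<^sup>2"]
        by (simp add: sums_iff)
    qed
    finally have "(norm (hardy_mult \<theta> (hardy_trunc N f)))\<^sup>2 = (norm (hardy_trunc N f))\<^sup>2"
      by (simp add: cinner_self_Re)
    then show ?thesis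
      by simp
  qed
  have "(\<lambda>N. norm (hardy_mult \<theta> (hardy_trunc N f))) \<longlonglongrightarrow> norm (hardy_mult \<theta> f)"
    by (intro tendsto_norm bounded_clinear_tendsto[OF bounded_clinear_mult_op] hardy_trunc_tendsto)
  moreover have "(\<lambda>N. norm (hardy_trunc N f)) \<longlonglongrightarrow> norm f"
    by (intro tendsto_norm hardy_trunc_tendsto)
  ultimately show ?thesis
    unfolding trunc by (rule LIMSEQ_unique)
qed

lemma cinner_hardy_mult_zero:
  assumes \<theta>: "isometric_symbol \<theta>" and \<phi>: "isometric_symbol \<phi>"
    and orth: "\<And>n m. cinner ((hardy_shift ^^ n) \<theta>) ((hardy_shift ^^ m) \<phi>) = 0"
  shows "cinner (hardy_mult \<theta> f) (hardy_mult \<phi> g) = 0"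
proof -
  interpret T: analytic_contraction "\<lambda>z x. hardy_eval \<theta> z * x"
    by (rule isometric_symbol_contraction[OF \<theta>])
  interpret F: analytic_contraction "\<lambda>z x. hardy_eval \<phi> z * x"
    by (rule isometric_symbol_contraction[OF \<phi>])
  have zero: "cinner (hardy_mult \<theta> (hardy_trunc N f)) (hardy_mult \<phi> (hardy_trunc M g)) = 0" for N M
    unfolding hardy_mult_trunc[OF \<theta>] hardy_mult_trunc[OF \<phi>] cinner_sum_left cinner_sum_right
      cinner_scaleC_left cinner_scaleC_right orth by simp
  have "(\<lambda>N. cinner (hardy_mult \<theta> (hardy_trunc N f)) (hardy_mult \<phi> h))
      \<longlonglongrightarrow> cinner (hardy_mult \<theta> f) (hardy_mult \<phi> h)" for h
    by (intro tendsto_cinner_left bounded_clinear_tendsto[OF T.bounded_clinear_mult_op] hardy_trunc_tendsto)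
  from this[of "hardy_trunc _ g"] have "cinner (hardy_mult \<theta> f) (hardy_mult \<phi> (hardy_trunc M g)) = 0" for M
    unfolding zero by (simp add: LIMSEQ_const_iff)
  moreover have "(\<lambda>M. cinner (hardy_mult \<theta> f) (hardy_mult \<phi> (hardy_trunc M g)))
      \<longlonglongrightarrow> cinner (hardy_mult \<theta> f) (hardy_mult \<phi> g)"
    by (intro tendsto_cinner_right bounded_clinear_tendsto[OF F.bounded_clinear_mult_op] hardy_trunc_tendsto)
  ultimately show ?thesis
    by (simp add: LIMSEQ_const_iff)
qed

text \<open>Two orthogonal wandering vectors \<open>\<theta>, \<phi>\<close> cannot both be nonzero: the product \<open>\<theta>\<phi>\<close> lies in
  both of the orthogonal spaces \<open>\<theta>H\<^sup>2\<close> and \<open>\<phi>H\<^sup>2\<close>.\<close>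

lemma isometric_symbols_not_orthogonal:
  assumes \<theta>: "isometric_symbol \<theta>" and \<phi>: "isometric_symbol \<phi>"
    and orth: "\<And>n m. cinner ((hardy_shift ^^ n) \<theta>) ((hardy_shift ^^ m) \<phi>) = 0"
  shows False
proof -
  have "hardy_mult \<theta> \<phi> = hardy_mult \<phi> \<theta>"
    by (rule analytic_contraction.mult_op_eqI[OF isometric_symbol_contraction[OF \<theta>]])
      (simp add: analytic_contraction.hardy_eval_mult_op[OF isometric_symbol_contraction[OF \<phi>]] mult.commute[of "hardy_eval \<theta> _"])
  then have "cinner (hardy_mult \<theta> \<phi>) (hardy_mult \<theta> \<phi>) = 0"
    using cinner_hardy_mult_zero[OF \<theta> \<phi> orth, of \<phi> \<theta>] by simp
  then have "norm \<phi> = 0"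
    using norm_hardy_mult[OF \<theta>, of \<phi>] by (simp add: cinner_eq_zero_iff)
  moreover have "cinner \<phi> \<phi> = 1"
    using \<phi> unfolding isometric_symbol_def by (metis (mono_tags) funpow_0 of_bool_eq(2))
  ultimately show False
    by simp
qed

locale shift_invariant =
  fixes S :: "complex hardy set"
  assumes subspace: "csubspace S" and closed: "closed S"
    and shift: "f \<in> S \<Longrightarrow> hardy_shift f \<in> S"
begin

definition wandering :: "complex hardy set" where
  "wandering = {w \<in> S. \<forall>f\<in>S. cinner w (hardy_shift f) = 0}"

lemma shift_funpow: "f \<in> S \<Longrightarrow> (hardy_shift ^^ n) f \<in> S"
  by (induction n) (auto intro: shift)

lemma decompose:
  assumes "g \<in> S"
  obtains f w where "f \<in> S" "w \<in> wandering" "g = hardy_shift f + w"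
proof -
  have sub: "csubspace (hardy_shift ` S)"
    by (rule csubspace_image[OF bounded_clinear_hardy_shift subspace])
  have cl: "closed (hardy_shift ` S)"
    unfolding closed_sequential_limits
  proof (intro allI impI, elim conjE)
    fix x l assume x: "\<forall>n. x n \<in> hardy_shift ` S" "x \<longlonglongrightarrow> l"
    have L: "(\<lambda>n. backward_shift (x n)) \<longlonglongrightarrow> backward_shift l"
      by (rule bounded_clinear_tendsto[OF bounded_clinear_backward_shift x(2)])
    have "\<exists>f\<in>S. x n = hardy_shift f" for n
      using x(1) by blast
    then obtain f where f: "\<And>n. f n \<in> S" "\<And>n. x n = hardy_shift (f n)"
      by metis
    have "backward_shift (x n) \<in> S" for n
      by (simp add: f)
    then have "backward_shift l \<in> S"
      using closed_sequentially[OF closed _ L] by simp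
    moreover have "hardy_shift (backward_shift (x n)) = x n" for n
      by (simp add: f)
    then have "x \<longlonglongrightarrow> hardy_shift (backward_shift l)"
      using bounded_clinear_tendsto[OF bounded_clinear_hardy_shift L] by simp
    then have "l = hardy_shift (backward_shift l)"
      using x(2) LIMSEQ_unique by blast
    ultimately show "l \<in> hardy_shift ` S"
      by blast
  qed
  obtain p where p: "p \<in> hardy_shift ` S" "\<And>v. v \<in> hardy_shift ` S \<Longrightarrow> cinner v (g - p) = 0"
    using projection_exists[OF sub cl] by metis
  then obtain f where f: "f \<in> S" "p = hardy_shift f"
    by blast
  have "g - p \<in> wandering"
    unfolding wandering_def
  proof (intro CollectI conjI ballI)
    show "g - p \<in> S"
      using f shift assms by (auto intro: csubspace_diff[OF subspace])
    show "cinner (g - p) (hardy_shift v) = 0" if "v \<in> S" for v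
      using p(2)[of "hardy_shift v"] that cinner_commute[of "g - p"] by simp
  qed
  then show thesis
    using that[OF f(1), of "g - p"] f by simp
qed

lemma wandering_orthogonal:
  assumes "v \<in> wandering" "w \<in> wandering" "n \<noteq> m"
  shows "cinner ((hardy_shift ^^ n) v) ((hardy_shift ^^ m) w) = 0"
proof -
  have less: "cinner ((hardy_shift ^^ n) v) ((hardy_shift ^^ m) w) = 0"
    if "n < m" "v \<in> wandering" "w \<in> wandering" for n m v w
  proof -
    obtain k where "m = n + Suc k"
      using \<open>n < m\<close> less_iff_Suc_add by auto
    then have "(hardy_shift ^^ m) w = (hardy_shift ^^ n) ((hardy_shift ^^ Suc k) w)"
      by (simp only: funpow_add o_apply)
    then have "(hardy_shift ^^ m) w = (hardy_shift ^^ n) (hardy_shift ((hardy_shift ^^ k) w))"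
      by (simp only: funpow.simps o_apply)
    then show ?thesis
      using that shift_funpow unfolding wandering_def by (simp add: cinner_shift_funpow)
  qed
  show ?thesis
    using less[of n m v w] less[of m n w v] assms cinner_commute[of "(hardy_shift ^^ n) v"]
    by (metis complex_cnj_zero linorder_neqE_nat)
qed

lemma isometric_symbol_wandering:
  assumes "w \<in> wandering" "norm w = 1"
  shows "isometric_symbol w"
  unfolding isometric_symbol_def
proof (intro allI)
  show "cinner ((hardy_shift ^^ n) w) ((hardy_shift ^^ m) w) = of_bool (n = m)" for n m
  proof (cases "n = m")
    case True
    then show ?thesis
      unfolding True cinner_shift_funpow using assms(2) by (simp add: cinner_self)
  qed (use wandering_orthogonal[OF assms(1) assms(1), of n m] in simp)
qed

lemma wandering_scaleC: "w \<in> wandering \<Longrightarrow> c *\<^sub>C w \<in> wandering"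
  unfolding wandering_def using subspace by (auto simp: csubspace_def cinner_scaleC_left)

lemma wandering_normalize:
  assumes "w \<in> wandering" "w \<noteq> 0"
  shows "sgn w \<in> wandering" "norm (sgn w) = 1"
proof -
  have "sgn w = of_real (inverse (norm w)) *\<^sub>C w"
    by (simp only: scaleC_of_real sgn_div_norm)
  then show "sgn w \<in> wandering"
    using wandering_scaleC[OF assms(1)] by simp
qed (use assms(2) in \<open>simp add: norm_sgn\<close>)

lemma wandering_dim_one:
  assumes \<theta>: "\<theta> \<in> wandering" "norm \<theta> = 1" and w: "w \<in> wandering"
  shows "w = cinner w \<theta> *\<^sub>C \<theta>"
proof (rule ccontr)
  define \<phi> where "\<phi> = w - cinner w \<theta> *\<^sub>C \<theta>"
  assume "w \<noteq> cinner w \<theta> *\<^sub>C \<theta>"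
  then have ne: "\<phi> \<noteq> 0"
    by (simp add: \<phi>_def)
  have \<phi>: "\<phi> \<in> wandering"
    using w wandering_scaleC[OF \<theta>(1), of "cinner w \<theta>"] subspace unfolding \<phi>_def wandering_def
    by (auto simp: cinner_diff_left intro: csubspace_diff)
  have "cinner \<phi> \<theta> = 0"
    using \<theta>(2) by (simp add: \<phi>_def cinner_diff_left cinner_scaleC_left cinner_self)
  then have "cinner \<theta> (sgn \<phi>) = 0"
    using cinner_commute[of \<theta> \<phi>] by (simp add: sgn_div_norm cinner_scaleR_right)
  then have "cinner ((hardy_shift ^^ n) \<theta>) ((hardy_shift ^^ m) (sgn \<phi>)) = 0" for n m
    using wandering_orthogonal[OF \<theta>(1) wandering_normalize(1)[OF \<phi> ne], of n m]
    by (cases "n = m") (auto simp: cinner_shift_funpow)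
  then show False
    using isometric_symbols_not_orthogonal isometric_symbol_wandering \<theta>
      wandering_normalize[OF \<phi> ne] by blast
qed

lemma trivial_if_wandering_trivial:
  assumes "wandering \<subseteq> {0}" "g \<in> S"
  shows "g = 0"
proof (rule hardy_eqI)
  have "hardy_coeff g n = 0" if "g \<in> S" for n g
    using that
  proof (induction n arbitrary: g)
    case 0
    then show ?case
      using decompose[OF 0] assms(1) by (metis add.right_neutral hardy_coeff_shift(1) singletonD subsetD)
  next
    case (Suc n)
    then show ?case
      using decompose[OF Suc.prems] assms(1) by (metis add.right_neutral hardy_coeff_shift(2) singletonD subsetD)
  qed
  then show "hardy_coeff g n = hardy_coeff 0 n" for n
    using assms(2) by (simp add: hardy_coeff_simps)
qed

lemma orthogonal_to_cyclic:
  assumes \<theta>: "\<theta> \<in> wandering" "norm \<theta> = 1" and g: "g \<in> S" "\<And>k. cinner g ((hardy_shift ^^ k) \<theta>) = 0"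
  shows "g = 0"
proof (rule hardy_eqI)
  have shift_of: "\<exists>f\<in>S. g = hardy_shift f \<and> (\<forall>k. cinner f ((hardy_shift ^^ k) \<theta>) = 0)"
    if g: "g \<in> S" "\<And>k. cinner g ((hardy_shift ^^ k) \<theta>) = 0" for g
  proof -
    obtain f w where fw: "f \<in> S" "w \<in> wandering" "g = hardy_shift f + w"
      using decompose[OF g(1)] .
    have "cinner (hardy_shift f) \<theta> = 0"
      using \<theta>(1) fw(1) cinner_commute[of "hardy_shift f" \<theta>] by (simp add: wandering_def)
    then have "cinner w \<theta> = 0"
      using g(2)[of 0] fw(3) by (simp add: cinner_add_left)
    then have "w = 0"
      using wandering_dim_one[OF \<theta> fw(2)] by (simp add: scaleC_zero_left)
    then have "g = hardy_shift f"
      using fw(3) by simp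
    moreover have "cinner f ((hardy_shift ^^ k) \<theta>) = 0" for k
      using g(2)[of "Suc k"] \<open>g = hardy_shift f\<close> by (simp add: cinner_shift_shift)
    ultimately show ?thesis
      using fw(1) by blast
  qed
  have "hardy_coeff g n = 0" if "g \<in> S" "\<And>k. cinner g ((hardy_shift ^^ k) \<theta>) = 0" for n g
    using that
  proof (induction n arbitrary: g)
    case 0
    then show ?case
      using shift_of[OF 0] by auto
  next
    case (Suc n)
    then show ?case
      using shift_of[OF Suc.prems] by auto
  qed
  then show "hardy_coeff g n = hardy_coeff 0 n" for n
    using g by (simp add: hardy_coeff_simps)
qed

end

lemma closed_orth_complement: "closed (orth_complement N)"
proof -
  have "closed {x. cinner x y = 0}" for y :: 'a
    by (intro closed_Collect_eq continuous_intros
        bounded_linear.continuous_on[OF bounded_linear_cinner_left])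
  moreover have "orth_complement N = (\<Inter>y\<in>N. {x. cinner x y = 0})"
    by (auto simp: orth_complement_def)
  ultimately show ?thesis
    by auto
qed

lemma csubspace_orth_complement: "csubspace (orth_complement N)"
  by (auto simp: csubspace_def orth_complement_def cinner_add_left cinner_scaleC_left)

theorem backward_shift_invariant_model_space:
  fixes N :: "complex hardy set"
  assumes N: "csubspace N" "closed N" and inv: "\<And>f. f \<in> N \<Longrightarrow> backward_shift f \<in> N"
    and proper: "N \<noteq> UNIV"
  obtains \<theta> where "inner_function \<theta>" "N = model_space \<theta>"
proof -
  define S where "S = orth_complement N"
  interpret shift_invariant S
  proof
    show "csubspace S" "closed S"
      unfolding S_def by (rule csubspace_orth_complement closed_orth_complement)+
    show "hardy_shift f \<in> S" if "f \<in> S" for f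
      using that inv by (simp add: S_def orth_complement_def cinner_hardy_shift)
  qed
  have N_iff: "x \<in> N" if "\<And>y. y \<in> S \<Longrightarrow> cinner x y = 0" for x
  proof (rule mem_closed_csubspaceI[OF N])
    fix y assume "\<And>v. v \<in> N \<Longrightarrow> cinner v y = 0"
    then have "y \<in> S"
      by (simp add: S_def orth_complement_def cinner_commute[of y])
    then show "cinner x y = 0"
      by (rule that)
  qed
  have "\<not> wandering \<subseteq> {0}"
  proof
    assume "wandering \<subseteq> {0}"
    then have S0: "y = 0" if "y \<in> S" for y
      using trivial_if_wandering_trivial that by blast
    have "x \<in> N" for x
    proof (rule N_iff)
      show "cinner x y = 0" if "y \<in> S" for y
        using S0[OF that] by simp
    qed
    then show False
      using proper by blast
  qed
  then obtain w where "w \<in> wandering" "w \<noteq> 0"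
    by blast
  then obtain \<theta> where \<theta>: "\<theta> \<in> wandering" "norm \<theta> = 1"
    using wandering_normalize by blast
  note iso = isometric_symbol_wandering[OF \<theta>]
  interpret T: analytic_contraction "\<lambda>z x. hardy_eval \<theta> z * x"
    by (rule isometric_symbol_contraction[OF iso])
  have range_S: "hardy_mult \<theta> f \<in> S" for f
  proof (rule closed_sequentially[OF closed])
    show "hardy_mult \<theta> (hardy_trunc n f) \<in> S" for n
      unfolding hardy_mult_trunc[OF iso] using subspace shift_funpow \<theta>(1)
      by (intro csubspace_sum) (auto simp: csubspace_def wandering_def)
    show "(\<lambda>n. hardy_mult \<theta> (hardy_trunc n f)) \<longlonglongrightarrow> hardy_mult \<theta> f"
      by (intro bounded_clinear_tendsto[OF T.bounded_clinear_mult_op] hardy_trunc_tendsto)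
  qed
  have range_sub: "csubspace (range (hardy_mult \<theta>))"
    by (rule csubspace_range[OF T.bounded_clinear_mult_op])
  have range_closed: "closed (range (hardy_mult \<theta>))"
  proof -
    have "complete (hardy_mult \<theta> ` UNIV)"
      using T.bounded_clinear_mult_op norm_hardy_mult[OF iso]
      by (intro complete_isometric_image[of 1]) (auto simp: bounded_clinear_def subspace_UNIV complete_UNIV)
    then show ?thesis
      by (rule complete_imp_closed)
  qed
  have "N = model_space (hardy_eval \<theta>)"
  proof (intro equalityI subsetI)
    fix x assume x: "x \<in> N"
    have "cinner x (hardy_mult \<theta> f) = 0" for f
      using range_S[of f] x cinner_commute[of x "hardy_mult \<theta> f"] by (simp add: S_def orth_complement_def)
    then show "x \<in> model_space (hardy_eval \<theta>)"
      by (auto simp: model_space_def orth_complement_def)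
  next
    fix x assume "x \<in> model_space (hardy_eval \<theta>)"
    then have x: "cinner x (hardy_mult \<theta> f) = 0" for f
      by (auto simp: model_space_def orth_complement_def)
    show "x \<in> N"
    proof (rule N_iff)
      fix y assume y: "y \<in> S"
      obtain p where p: "p \<in> range (hardy_mult \<theta>)" "\<And>v. v \<in> range (hardy_mult \<theta>) \<Longrightarrow> cinner v (y - p) = 0"
        using projection_exists[OF range_sub range_closed] by metis
      have "y - p \<in> S"
        using y p(1) range_S subspace by (auto intro: csubspace_diff)
      moreover have "cinner (y - p) ((hardy_shift ^^ k) \<theta>) = 0" for k
        unfolding hardy_mult_shift_funpow[OF iso, symmetric]
        using p(2) by (subst cinner_commute) simp
      ultimately have "y - p = 0"
        by (rule orthogonal_to_cyclic[OF \<theta>])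
      then show "cinner x y = 0"
        using p(1) x by auto
    qed
  qed
  moreover have "inner_function (hardy_eval \<theta>)"
    using norm_hardy_eval_le_1 iso
    by (intro inner_function_hardy_eval \<theta>(2)) (auto simp: isometric_symbol_def)
  ultimately show thesis
    using that by blast
qed

section \<open>Boundary values of Schur functions\<close>

lemma tendsto_of_dense:
  fixes f :: "'a::metric_space \<Rightarrow> real \<Rightarrow> complex"
  assumes dense: "closure D = UNIV" and F: "F \<noteq> bot"
    and lip: "\<forall>\<^sub>F r in F. \<forall>x y. cmod (f x r - f y r) \<le> dist x y"
    and lim: "\<And>d. d \<in> D \<Longrightarrow> \<exists>l. ((\<lambda>r. f d r) \<longlongrightarrow> l) F"
  shows "\<exists>l. ((\<lambda>r. f x r) \<longlongrightarrow> l) F"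
proof -
  obtain d where d: "\<And>n. d n \<in> D" "d \<longlonglongrightarrow> x"
    using dense by (metis UNIV_I closure_sequential)
  obtain l where l: "\<And>n. ((\<lambda>r. f (d n) r) \<longlongrightarrow> l n) F"
    using lim[OF d(1)] by metis
  have l_le: "cmod (l m - l n) \<le> dist (d m) (d n)" for m n
  proof (rule tendsto_upperbound[OF _ _ F])
    show "((\<lambda>r. cmod (f (d m) r - f (d n) r)) \<longlongrightarrow> cmod (l m - l n)) F"
      by (intro tendsto_intros l)
    show "\<forall>\<^sub>F r in F. cmod (f (d m) r - f (d n) r) \<le> dist (d m) (d n)"
      using lip by eventually_elim blast
  qed
  have "Cauchy l"
  proof (rule metric_CauchyI)
    fix e :: real assume "e > 0"
    then obtain N where "\<And>m n. m \<ge> N \<Longrightarrow> n \<ge> N \<Longrightarrow> dist (d m) (d n) < e"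
      using LIMSEQ_imp_Cauchy[OF d(2)] unfolding Cauchy_def by metis
    then show "\<exists>N. \<forall>m\<ge>N. \<forall>n\<ge>N. dist (l m) (l n) < e"
      unfolding dist_norm using order_le_less_trans[OF l_le] by blast
  qed
  then obtain L where L: "l \<longlonglongrightarrow> L"
    by (auto simp: Cauchy_convergent_iff convergent_def)
  have "((\<lambda>r. f x r) \<longlongrightarrow> L) F"
  proof (rule tendstoI)
    fix e :: real assume e: "e > 0"
    have "\<forall>\<^sub>F n in sequentially. dist (d n) x < e / 3 \<and> dist (l n) L < e / 3"
      using e by (intro eventually_conj tendstoD[OF d(2)] tendstoD[OF L]) auto
    then obtain n where n: "dist (d n) x < e / 3" "dist (l n) L < e / 3"
      using eventually_happens'[OF sequentially_bot] by blast
    have "\<forall>\<^sub>F r in F. dist (f (d n) r) (l n) < e / 3"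
      using e by (intro tendstoD[OF l]) auto
    with lip show "\<forall>\<^sub>F r in F. dist (f x r) L < e"
    proof eventually_elim
      case (elim r)
      have "dist (f x r) (f (d n) r) \<le> dist (d n) x"
        using elim(1) by (simp add: dist_norm[of "f x r"] dist_commute)
      then show ?case
        using n elim(2) dist_triangle[of "f x r" L "f (d n) r"] dist_triangle[of "f (d n) r" L "l n"]
        by linarith
    qed
  qed
  then show ?thesis
    by blast
qed

context analytic_contraction
begin

lemma AE_boundary_value:
  assumes "separable_space (euclidean :: 'd topology)"
  shows "AE t in circ. \<forall>x. ((\<lambda>r. B (of_real r * cis t) x) \<longlongrightarrow> boundary_value B (cis t) x) (at_left 1)"
proof -
  obtain D :: "'d set" where D: "countable D" "closure D = UNIV"
    using assms by (auto simp: separable_space_def closure_of_UNIV)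
  have "AE t in circ. \<forall>d\<in>D. \<exists>w. ((\<lambda>r. B (of_real r * cis t) d) \<longlongrightarrow> w) (at_left 1)"
    using D(1) by (intro AE_ball_countable[THEN iffD2] ballI fatou_radial_limit[OF holomorphic contraction])
  then show ?thesis
  proof eventually_elim
    case (elim t)
    have lip: "\<forall>\<^sub>F r in at_left 1. \<forall>x y. cmod (B (of_real r * cis t) x - B (of_real r * cis t) y) \<le> dist x y"
      using eventually_at_left_1
    proof eventually_elim
      case (elim r)
      then have z: "cmod (of_real r * cis t) < 1"
        by (simp add: norm_mult)
      show ?case
        using contraction[OF z] by (simp add: bounded_clinear_diff[OF bounded[OF z], symmetric] dist_norm)
    qed
    have "\<exists>w. ((\<lambda>r. B (of_real r * cis t) x) \<longlongrightarrow> w) (at_left 1)" for x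
    proof (rule tendsto_of_dense[where f = "\<lambda>x r. B (of_real r * cis t) x", OF D(2) trivial_limit_at_left_real lip])
      show "\<exists>l. ((\<lambda>r. B (of_real r * cis t) d) \<longlongrightarrow> l) (at_left 1)" if "d \<in> D" for d
        using elim that by blast
    qed
    then show ?case
      unfolding boundary_value_def using tendsto_Lim[OF trivial_limit_at_left_real] by (intro allI) force
  qed
qed

lemma BB_star_bounds:
  assumes lim: "\<And>x. ((\<lambda>r. B (of_real r * cis t) x) \<longlongrightarrow> boundary_value B (cis t) x) (at_left 1)"
  shows "0 \<le> BB_star B (cis t)" "BB_star B (cis t) \<le> 1"
    "(cmod (boundary_value B (cis t) x))\<^sup>2 \<le> BB_star B (cis t) * (norm x)\<^sup>2"
proof -
  define b where "b = boundary_value B (cis t)"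
  have ev: "\<forall>\<^sub>F r in at_left 1. cmod (of_real r * cis t) < 1"
    using eventually_at_left_1 by eventually_elim (simp add: norm_mult)
  note lim = lim[folded b_def]
  have uniq: "l = l'" if "(f \<longlongrightarrow> l) (at_left (1::real))" "(g \<longlongrightarrow> l') (at_left 1)" "\<forall>\<^sub>F r in at_left 1. f r = g r"
    for f g :: "real \<Rightarrow> complex" and l l'
    using tendsto_unique[OF trivial_limit_at_left_real Lim_transform_eventually[OF that(1,3)] that(2)] .
  have bl: "bounded_clinear b"
  proof (rule bounded_clinearI[where K = 1])
    show "b (x + y) = b x + b y" for x y
      by (rule uniq[OF lim tendsto_add[OF lim lim]])
        (use ev in eventually_elim, simp add: bounded_clinear_add[OF bounded])
    show "b (c *\<^sub>C x) = c *\<^sub>C b x" for c x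
      unfolding scaleC_complex_def
      by (rule uniq[OF lim tendsto_mult[OF tendsto_const lim]])
        (use ev in eventually_elim, simp add: bounded_clinear_scaleC[OF bounded] scaleC_complex_def)
    show "norm (b x) \<le> 1 * norm x" for x
    proof (rule tendsto_upperbound[OF tendsto_norm[OF lim]])
      show "\<forall>\<^sub>F r in at_left 1. cmod (B (of_real r * cis t) x) \<le> 1 * norm x"
        using ev by eventually_elim (simp add: contraction)
    qed simp
  qed
  define v where "v = adjoint_op b 1"
  have b: "b x = cinner x v" for x
    using adjoint_exists[OF bl, of x 1] by (simp add: v_def cinner_complex_def)
  have BB: "BB_star B (cis t) = (norm v)\<^sup>2"
    unfolding BB_star_def b_def[symmetric] v_def[symmetric] b cinner_self_Re ..
  have "cmod (b v) \<le> 1 * norm v"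
  proof (rule tendsto_upperbound[OF tendsto_norm[OF lim]])
    show "\<forall>\<^sub>F r in at_left 1. cmod (B (of_real r * cis t) v) \<le> 1 * norm v"
      using ev by eventually_elim (simp add: contraction)
  qed simp
  then have "norm v * norm v \<le> 1 * norm v"
    by (simp add: b cinner_self norm_mult power2_eq_square)
  then have "norm v \<le> 1"
    by (cases "v = 0") auto
  then show "0 \<le> BB_star B (cis t)" "BB_star B (cis t) \<le> 1"
    by (simp_all add: BB power_le_one)
  show "(cmod (boundary_value B (cis t) x))\<^sup>2 \<le> BB_star B (cis t) * (norm x)\<^sup>2"
    using power_mono[OF norm_cinner_le[of x v], of 2]
    by (simp add: BB b_def[symmetric] b power_mult_distrib mult.commute)
qed

end

lemma hardy_trunc_circle:
  fixes f :: "complex hardy"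
  shows "summable (\<lambda>n. cmod (hardy_coeff (hardy_trunc N f) n))"
    and "hardy_eval (hardy_trunc N f) (cis t) = (\<Sum>n. hardy_coeff (hardy_trunc N f) n * cis t ^ n)"
proof -
  show "summable (\<lambda>n. cmod (hardy_coeff (hardy_trunc N f) n))"
    by (rule summable_finite[of "{..<N}"]) (auto simp: hardy_trunc.rep_eq)
qed (simp add: hardy_eval_def scaleC_complex_def mult.commute)

lemma continuous_on_hardy_trunc_circle:
  fixes f :: "complex hardy"
  shows "continuous_on UNIV (\<lambda>t. hardy_eval (hardy_trunc N f) (cis t))"
  unfolding hardy_trunc_circle(2) by (rule continuous_on_cis_series[OF hardy_trunc_circle(1)])

lemma circle_mean_hardy_trunc:
  fixes f :: "complex hardy"
  shows "circle_mean (\<lambda>t. (cmod (hardy_eval (hardy_trunc N f) (cis t)))\<^sup>2) = (norm (hardy_trunc N f))\<^sup>2"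
proof -
  define a where "a = hardy_coeff (hardy_trunc N f)"
  have "(\<lambda>n. a n * cnj (a n)) sums
      circle_mean (\<lambda>t. hardy_eval (hardy_trunc N f) (cis t) * cnj (hardy_eval (hardy_trunc N f) (cis t)))"
    unfolding a_def hardy_trunc_circle(2) by (rule circle_mean_parseval[OF hardy_trunc_circle(1) hardy_trunc_circle(1)])
  then have "(\<lambda>n. complex_of_real ((cmod (a n))\<^sup>2)) sums
      complex_of_real (circle_mean (\<lambda>t. (cmod (hardy_eval (hardy_trunc N f) (cis t)))\<^sup>2))"
    unfolding circle_mean_of_real[symmetric] by (simp only: complex_norm_square[symmetric] of_real_power)
  then have "(\<lambda>n. (cmod (a n))\<^sup>2) sums circle_mean (\<lambda>t. (cmod (hardy_eval (hardy_trunc N f) (cis t)))\<^sup>2)"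
    by (rule sums_of_real_iff[THEN iffD1])
  then show ?thesis
    unfolding norm_hardy_sq a_def[symmetric] by (rule sums_unique)
qed

context analytic_contraction
begin

lemma mult_op_boundary_bound:
  fixes f :: "complex hardy" and N :: nat and F :: "real \<Rightarrow> complex"
  assumes sep: "separable_space (euclidean :: 'd topology)"
    and \<beta>: "\<beta> \<in> borel_measurable circ" "AE t in circ. BB_star B (cis t) = \<beta> t"
  defines "F \<equiv> \<lambda>t. hardy_eval (hardy_trunc N f) (cis t)"
  shows "2 * cmod (cinner (mult_op B (hardy_trunc M h)) (hardy_trunc N f))
    \<le> circle_mean (\<lambda>t. \<beta> t * (cmod (F t))\<^sup>2) + (norm (hardy_trunc M h))\<^sup>2"
proof -
  define r where "r = radius"
  note r = radius_bounds[folded r_def] and r_lim = tendsto_radius[folded r_def]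
    and r_at_left = radius_at_left[folded r_def]
  have z: "cmod (of_real (r k) * cis t) < 1" for k t
    using r[of k] by (simp add: norm_mult)
  define p where "p = hardy_trunc M h"
  define g where "g = mult_op B p"
  define q where "q t = hardy_eval p (cis t)" for t
  define P where "P = (\<Sum>n<M. norm (hardy_coeff h n))"
  have p_lim: "(\<lambda>k. hardy_eval p (of_real (r k) * cis t)) \<longlonglongrightarrow> q t" for t
  proof -
    note sc = bounded_linear.tendsto[OF bounded_linear_scaleC_left]
    have "(\<lambda>k. (of_real (r k) * cis t) ^ n) \<longlonglongrightarrow> (of_real 1 * cis t) ^ n" for n
      by (intro tendsto_intros r_lim)
    then show ?thesis
      unfolding q_def p_def hardy_eval_trunc by (intro tendsto_sum sc) simp
  qed
  have p_le: "norm (hardy_eval p (of_real (r k) * cis t)) \<le> P" for k t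
    unfolding p_def hardy_eval_trunc P_def
    using r[of k] by (intro sum_norm_le) (simp add: norm_scaleC norm_power norm_mult mult_left_le_one_le power_le_one)
  have q_le: "norm (q t) \<le> P" for t
    by (rule LIMSEQ_le_const2[OF tendsto_norm[OF p_lim]]) (use p_le in blast)
  have q_cont: "continuous_on UNIV q"
    unfolding q_def p_def hardy_eval_trunc
    by (intro continuous_on_sum bounded_linear.continuous_on[OF bounded_linear_scaleC_left] continuous_intros)
  have F_cont: "continuous_on UNIV F"
    unfolding F_def by (rule continuous_on_hardy_trunc_circle)
  define G where "G k t = hardy_eval g (of_real (r k) * cis t)" for k t
  have G_cont: "continuous_on UNIV (G k)" for k
    unfolding G_def by (rule holomorphic_circle_continuous[OF holomorphic_hardy_eval r])
  have G_eq: "G k t = B (of_real (r k) * cis t) (hardy_eval p (of_real (r k) * cis t))" for k t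
    unfolding G_def g_def by (rule hardy_eval_mult_op[OF z])
  have G_le: "cmod (G k t) \<le> P" for k t
    unfolding G_eq by (rule order_trans[OF contraction[OF z] p_le])
  define L where "L t = lim (\<lambda>k. G k t)" for t
  have G_meas: "G k \<in> borel_measurable circ" for k
    by (rule measurable_circ_continuous[OF G_cont])
  have L_meas: "L \<in> borel_measurable circ"
    unfolding L_def by (intro borel_measurable_lim_metric G_meas)
  have L: "AE t in circ. (\<lambda>k. G k t) \<longlonglongrightarrow> L t \<and> (cmod (L t))\<^sup>2 \<le> \<beta> t * (norm (q t))\<^sup>2 \<and> 0 \<le> \<beta> t \<and> \<beta> t \<le> 1"
    using AE_boundary_value[OF sep] \<beta>(2)
  proof eventually_elim
    case (elim t)
    have "(\<lambda>k. G k t) \<longlonglongrightarrow> boundary_value B (cis t) (q t)"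
    proof (rule Lim_transform)
      show "(\<lambda>k. B (of_real (r k) * cis t) (q t)) \<longlonglongrightarrow> boundary_value B (cis t) (q t)"
        using elim(1) by (intro filterlim_compose[OF _ r_at_left]) blast
      show "(\<lambda>k. G k t - B (of_real (r k) * cis t) (q t)) \<longlonglongrightarrow> 0"
      proof (rule Lim_null_comparison)
        show "\<forall>\<^sub>F k in sequentially. norm (G k t - B (of_real (r k) * cis t) (q t))
            \<le> norm (hardy_eval p (of_real (r k) * cis t) - q t)"
          unfolding G_eq bounded_clinear_diff[OF bounded[OF z], symmetric]
          by (intro always_eventually allI contraction[OF z])
        show "(\<lambda>k. norm (hardy_eval p (of_real (r k) * cis t) - q t)) \<longlonglongrightarrow> 0"
          by (intro tendsto_norm_zero LIM_zero p_lim)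
      qed
    qed
    moreover from this have "L t = boundary_value B (cis t) (q t)"
      unfolding L_def by (rule limI)
    ultimately show ?case
      using BB_star_bounds[of t] elim by simp
  qed
  have mean_G: "(\<lambda>k. circle_mean (\<lambda>t. G k t * cnj (F t))) \<longlonglongrightarrow> cinner g (hardy_trunc N f)"
  proof -
    define a where "a n = hardy_coeff g n" for n
    define b where "b = hardy_coeff (hardy_trunc N f)"
    have b0: "b n = 0" if "n \<ge> N" for n
      using that by (simp add: b_def hardy_trunc.rep_eq)
    have sum: "(\<lambda>n. c n * cnj (b n)) sums (\<Sum>n<N. c n * cnj (b n))" for c
      by (rule sums_finite) (auto simp: b0)
    have "circle_mean (\<lambda>t. G k t * cnj (F t)) = (\<Sum>n<N. (a n * of_real (r k) ^ n) * cnj (b n))" for k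
    proof -
      have sm: "summable (\<lambda>n. cmod (a n * of_real (r k) ^ n))"
        unfolding a_def using hardy_eval_sums_complex[of _ g] r[of k]
        by (intro powser_summable_cmod) (auto simp: sums_iff)
      have G_sum: "G k t = (\<Sum>n. (a n * of_real (r k) ^ n) * cis t ^ n)" for t
        unfolding powser_circle[symmetric] G_def a_def using hardy_eval_sums_complex[OF z, of g] by (simp add: sums_iff)
      have "(\<lambda>n. (a n * of_real (r k) ^ n) * cnj (b n)) sums circle_mean (\<lambda>t. G k t * cnj (F t))"
        unfolding G_sum F_def hardy_trunc_circle(2) b_def
        by (rule circle_mean_parseval[OF sm hardy_trunc_circle(1)])
      from sums_unique2[OF this sum] show ?thesis .
    qed
    moreover have "(\<lambda>k. \<Sum>n<N. (a n * of_real (r k) ^ n) * cnj (b n)) \<longlonglongrightarrow> (\<Sum>n<N. (a n * of_real 1 ^ n) * cnj (b n))"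
      by (intro tendsto_intros r_lim)
    moreover have "cinner g (hardy_trunc N f) = (\<Sum>n<N. (a n * of_real 1 ^ n) * cnj (b n))"
      using sum[of a] by (simp add: cinner_hardy.rep_eq cinner_complex_def a_def b_def sums_iff)
    ultimately show ?thesis
      by simp
  qed
  obtain K where K: "\<And>t. cmod (F t) \<le> K"
    unfolding F_def hardy_trunc_circle(2) using cis_series_bound[OF hardy_trunc_circle(1)] by blast
  have F_meas: "F \<in> borel_measurable circ"
    by (rule measurable_circ_continuous[OF F_cont])
  have "(\<lambda>k. circle_mean (\<lambda>t. G k t * cnj (F t))) \<longlonglongrightarrow> circle_mean (\<lambda>t. L t * cnj (F t))"
  proof (rule circle_mean_tendsto[where w = "\<lambda>_. P * K"])
    show "AE t in circ. (\<lambda>k. G k t * cnj (F t)) \<longlonglongrightarrow> L t * cnj (F t)"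
      using L by eventually_elim (intro tendsto_intros, blast)
    show "AE t in circ. norm (G k t * cnj (F t)) \<le> P * K" for k
      unfolding norm_mult complex_mod_cnj
      using order_trans[OF norm_ge_zero G_le] by (intro AE_I2 mult_mono G_le K) auto
    show "(\<lambda>t. G k t * cnj (F t)) \<in> borel_measurable circ" for k
      by (intro measurable_circ_continuous continuous_intros G_cont F_cont)
    show "(\<lambda>t. L t * cnj (F t)) \<in> borel_measurable circ"
      by (intro borel_measurable_times L_meas measurable_circ_continuous continuous_intros F_cont)
  qed simp
  then have eq: "cinner g (hardy_trunc N f) = circle_mean (\<lambda>t. L t * cnj (F t))"
    using mean_G LIMSEQ_unique by blast
  have int1: "integrable circ (\<lambda>t. \<beta> t * (cmod (F t))\<^sup>2)"
  proof (rule Bochner_Integration.integrable_bound)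
    show "integrable circ (\<lambda>t. (cmod (F t))\<^sup>2)"
      by (intro integrable_circ_continuous continuous_intros F_cont)
    show "(\<lambda>t. \<beta> t * (cmod (F t))\<^sup>2) \<in> borel_measurable circ"
      using \<beta>(1) F_meas by measurable
    show "AE t in circ. norm (\<beta> t * (cmod (F t))\<^sup>2) \<le> norm ((cmod (F t))\<^sup>2)"
      using L by eventually_elim (simp add: abs_mult mult_left_le_one_le)
  qed
  have int2: "integrable circ (\<lambda>t. (norm (q t))\<^sup>2)"
    by (intro integrable_circ_continuous continuous_intros q_cont)
  have "2 * cmod (cinner g (hardy_trunc N f)) \<le> 2 * circle_mean (\<lambda>t. cmod (L t * cnj (F t)))"
    unfolding eq by (intro mult_left_mono norm_circle_mean_le) simp
  also have "\<dots> = circle_mean (\<lambda>t. 2 * cmod (L t * cnj (F t)))"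
    by (simp only: circle_mean_mult_right)
  also have "\<dots> \<le> circle_mean (\<lambda>t. \<beta> t * (cmod (F t))\<^sup>2 + (norm (q t))\<^sup>2)"
  proof (rule circle_mean_mono)
    show "integrable circ (\<lambda>t. \<beta> t * (cmod (F t))\<^sup>2 + (norm (q t))\<^sup>2)"
      by (rule Bochner_Integration.integrable_add[OF int1 int2])
    show le: "AE t in circ. 2 * cmod (L t * cnj (F t)) \<le> \<beta> t * (cmod (F t))\<^sup>2 + (norm (q t))\<^sup>2"
      using L
    proof eventually_elim
      case (elim t)
      define x where "x = sqrt (\<beta> t) * cmod (F t)"
      have e: "(cmod (L t))\<^sup>2 \<le> \<beta> t * (norm (q t))\<^sup>2" "0 \<le> \<beta> t"
        using elim by blast+
      then have "cmod (L t) \<le> sqrt (\<beta> t) * norm (q t)"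
        by - (rule power2_le_imp_le; simp add: power_mult_distrib)
      from mult_right_mono[OF this, of "cmod (F t)"]
      have "cmod (L t) * cmod (F t) \<le> x * norm (q t)"
        by (simp add: x_def mult_ac)
      moreover have "2 * (x * norm (q t)) \<le> x\<^sup>2 + (norm (q t))\<^sup>2"
        using zero_le_power2[of "x - norm (q t)"] by (simp add: power2_diff)
      moreover have "x\<^sup>2 = \<beta> t * (cmod (F t))\<^sup>2"
        using e by (simp add: x_def power_mult_distrib)
      ultimately show ?case
        by (simp add: norm_mult)
    qed
    show "integrable circ (\<lambda>t. 2 * cmod (L t * cnj (F t)))"
    proof (rule Bochner_Integration.integrable_bound)
      show "integrable circ (\<lambda>t. \<beta> t * (cmod (F t))\<^sup>2 + (norm (q t))\<^sup>2)"
        by (rule Bochner_Integration.integrable_add[OF int1 int2])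
      show "(\<lambda>t. 2 * cmod (L t * cnj (F t))) \<in> borel_measurable circ"
        unfolding norm_mult complex_mod_cnj using L_meas F_meas by measurable
      show "AE t in circ. norm (2 * cmod (L t * cnj (F t))) \<le> norm (\<beta> t * (cmod (F t))\<^sup>2 + (norm (q t))\<^sup>2)"
        using le by eventually_elim simp
    qed
  qed
  also have "\<dots> = circle_mean (\<lambda>t. \<beta> t * (cmod (F t))\<^sup>2) + circle_mean (\<lambda>t. (norm (q t))\<^sup>2)"
    by (rule circle_mean_add[OF int1 int2])
  also have "circle_mean (\<lambda>t. (norm (q t))\<^sup>2) \<le> (norm p)\<^sup>2"
  proof (rule LIMSEQ_le_const2)
    show "(\<lambda>k. circle_mean (\<lambda>t. (norm (hardy_eval p (of_real (r k) * cis t)))\<^sup>2)) \<longlonglongrightarrow> circle_mean (\<lambda>t. (norm (q t))\<^sup>2)"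
    proof (rule circle_mean_tendsto[where w = "\<lambda>_. P\<^sup>2"])
      show "AE t in circ. (\<lambda>k. (norm (hardy_eval p (of_real (r k) * cis t)))\<^sup>2) \<longlonglongrightarrow> (norm (q t))\<^sup>2"
        by (intro AE_I2 tendsto_intros p_lim)
      show "AE t in circ. norm ((norm (hardy_eval p (of_real (r k) * cis t)))\<^sup>2) \<le> P\<^sup>2" for k
        using p_le by (intro AE_I2) (simp add: power_mono)
      show "(\<lambda>t. (norm (hardy_eval p (of_real (r k) * cis t)))\<^sup>2) \<in> borel_measurable circ" for k
        by (intro measurable_circ_continuous continuous_intros continuous_on_hardy_eval_circle r)
      show "(\<lambda>t. (norm (q t))\<^sup>2) \<in> borel_measurable circ"
        by (intro measurable_circ_continuous continuous_intros q_cont)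
    qed simp
    show "\<exists>K. \<forall>k\<ge>K. circle_mean (\<lambda>t. (norm (hardy_eval p (of_real (r k) * cis t)))\<^sup>2) \<le> (norm p)\<^sup>2"
      using circle_mean_norm_hardy_eval[OF r] by blast
  qed
  finally show ?thesis
    by (simp add: g_def p_def)
qed

lemma norm_adjoint_mult_op_le:
  assumes sep: "separable_space (euclidean :: 'd topology)"
    and \<beta>: "\<beta> \<in> borel_measurable circ" "AE t in circ. BB_star B (cis t) = \<beta> t"
  shows "(norm (adjoint_op (mult_op B) (hardy_trunc N f)))\<^sup>2
    \<le> circle_mean (\<lambda>t. \<beta> t * (cmod (hardy_eval (hardy_trunc N f) (cis t)))\<^sup>2)"
proof -
  define h where "h = adjoint_op (mult_op B) (hardy_trunc N f)"
  have "2 * cmod (cinner (mult_op B h) (hardy_trunc N f))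
      \<le> circle_mean (\<lambda>t. \<beta> t * (cmod (hardy_eval (hardy_trunc N f) (cis t)))\<^sup>2) + (norm h)\<^sup>2"
  proof (rule LIMSEQ_le)
    show "(\<lambda>M. 2 * cmod (cinner (mult_op B (hardy_trunc M h)) (hardy_trunc N f)))
        \<longlonglongrightarrow> 2 * cmod (cinner (mult_op B h) (hardy_trunc N f))"
      by (intro tendsto_intros tendsto_cinner_left bounded_clinear_tendsto[OF bounded_clinear_mult_op] hardy_trunc_tendsto)
    show "(\<lambda>M. circle_mean (\<lambda>t. \<beta> t * (cmod (hardy_eval (hardy_trunc N f) (cis t)))\<^sup>2) + (norm (hardy_trunc M h))\<^sup>2)
        \<longlonglongrightarrow> circle_mean (\<lambda>t. \<beta> t * (cmod (hardy_eval (hardy_trunc N f) (cis t)))\<^sup>2) + (norm h)\<^sup>2"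
      by (intro tendsto_intros hardy_trunc_tendsto)
  qed (use mult_op_boundary_bound[OF sep \<beta>] in blast)
  moreover have "cinner (mult_op B h) (hardy_trunc N f) = of_real ((norm h)\<^sup>2)"
    by (simp only: adjoint_exists[OF bounded_clinear_mult_op] h_def[symmetric] cinner_self)
  ultimately show ?thesis
    by (simp add: h_def norm_power)
qed

end

section \<open>Outer functions\<close>

definition herglotz_kernel :: "complex \<Rightarrow> real \<Rightarrow> complex" where
  "herglotz_kernel z t = (1 + z * cnj (cis t)) / (1 - z * cnj (cis t))"

definition herglotz :: "(real \<Rightarrow> real) \<Rightarrow> complex \<Rightarrow> complex" where
  "herglotz k z = circle_mean (\<lambda>t. herglotz_kernel z t * of_real (k t))"

abbreviation poisson_kernel :: "complex \<Rightarrow> real \<Rightarrow> real" where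
  "poisson_kernel z t \<equiv> (1 - (cmod z)\<^sup>2) / (cmod (1 - z * cnj (cis t)))\<^sup>2"

context
  fixes z :: complex
  assumes z: "cmod z < 1"
begin

lemma Re_herglotz_kernel: "Re (herglotz_kernel z t) = poisson_kernel z t"
proof -
  define w where "w = z * cnj (cis t)"
  have w: "cmod w = cmod z"
    by (simp add: w_def norm_mult)
  then have ne: "1 - w \<noteq> 0"
    using z by auto
  have "(1 + w) / (1 - w) = ((1 + w) * cnj (1 - w)) / of_real ((cmod (1 - w))\<^sup>2)"
    using ne by (subst complex_div_cnj) simp
  then have "Re ((1 + w) / (1 - w)) = Re ((1 + w) * cnj (1 - w)) / (cmod (1 - w))\<^sup>2"
    by (simp only: Re_divide_of_real)
  also have "Re ((1 + w) * cnj (1 - w)) = 1 - (cmod w)\<^sup>2"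
    unfolding cmod_power2 by (simp add: power2_eq_square algebra_simps)
  finally show ?thesis
    by (simp add: herglotz_kernel_def w_def norm_mult)
qed

lemma herglotz_kernel_continuous: "continuous_on UNIV (herglotz_kernel z)"
  unfolding herglotz_kernel_def
proof (intro continuous_intros ballI)
  show "1 - z * cnj (cis t) \<noteq> 0" for t
    using z by (auto simp: norm_mult dest!: arg_cong[where f = cmod])
qed

lemma herglotz_kernel_bound: "cmod (herglotz_kernel z t) \<le> 2 / (1 - cmod z)"
proof -
  have "cmod (1 + z * cnj (cis t)) \<le> 2" "1 - cmod z \<le> cmod (1 - z * cnj (cis t))"
    using norm_triangle_ineq[of 1 "z * cnj (cis t)"] norm_triangle_ineq2[of 1 "z * cnj (cis t)"] z
    by (auto simp: norm_mult)
  then show ?thesis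
    unfolding herglotz_kernel_def norm_divide using z by (intro frac_le) auto
qed

lemma poisson_kernel_nonneg: "0 \<le> poisson_kernel z t"
  using z by (simp add: power_le_one)

lemma poisson_kernel_bound: "\<bar>poisson_kernel z t\<bar> \<le> 2 / (1 - cmod z)"
  using abs_Re_le_cmod[of "herglotz_kernel z t"] herglotz_kernel_bound[of t]
  unfolding Re_herglotz_kernel by simp

lemma integrable_poisson:
  assumes "integrable circ k"
  shows "integrable circ (\<lambda>t. poisson_kernel z t * k t)"
  using poisson_kernel_bound
  by (intro integrable_circ_mult_bounded[OF assms] measurable_circ_continuous poisson_kernel_continuous z) auto

lemma integrable_herglotz:
  assumes "integrable circ k"
  shows "integrable circ (\<lambda>t. herglotz_kernel z t * of_real (k t))"
  using assms herglotz_kernel_bound herglotz_kernel_continuous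
  by (intro integrable_circ_mult_bounded measurable_circ_continuous) auto

lemma Re_herglotz:
  assumes k: "integrable circ k"
  shows "Re (herglotz k z) = circle_mean (\<lambda>t. poisson_kernel z t * k t)"
  unfolding herglotz_def Re_circle_mean[OF integrable_herglotz[OF k], symmetric]
  by (simp add: Re_herglotz_kernel)

lemma herglotz_diff:
  assumes "integrable circ k" "integrable circ l"
  shows "herglotz (\<lambda>t. k t - l t) z = herglotz k z - herglotz l z"
  unfolding herglotz_def of_real_diff right_diff_distrib
  by (rule circle_mean_diff[OF integrable_herglotz integrable_herglotz]) (use assms in auto)

lemma norm_herglotz_le:
  assumes k: "integrable circ k"
  shows "cmod (herglotz k z) \<le> 2 / (1 - cmod z) * circle_mean (\<lambda>t. \<bar>k t\<bar>)"
proof -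
  have "cmod (herglotz k z) \<le> circle_mean (\<lambda>t. cmod (herglotz_kernel z t * of_real (k t)))"
    unfolding herglotz_def by (rule norm_circle_mean_le)
  also have "\<dots> \<le> circle_mean (\<lambda>t. 2 / (1 - cmod z) * \<bar>k t\<bar>)"
    using k herglotz_kernel_bound
    by (intro circle_mean_mono AE_I2 integrable_norm integrable_herglotz)
      (auto simp: norm_mult mult_right_mono simp del: times_divide_eq_left)
  finally show ?thesis
    by (simp only: circle_mean_mult_right)
qed

lemma Re_herglotz_nonneg:
  assumes "integrable circ k" "\<And>t. 0 \<le> k t"
  shows "0 \<le> Re (herglotz k z)"
  unfolding Re_herglotz[OF assms(1)] using poisson_kernel_nonneg assms(2)
  by (intro circle_mean_nonneg AE_I2 mult_nonneg_nonneg)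

lemma Re_herglotz_le:
  assumes "integrable circ k" "\<And>t. k t \<le> K"
  shows "Re (herglotz k z) \<le> K"
proof -
  have "Re (herglotz k z) \<le> circle_mean (\<lambda>t. poisson_kernel z t * K)"
    unfolding Re_herglotz[OF assms(1)]
    by (intro circle_mean_mono integrable_poisson assms AE_I2 mult_left_mono poisson_kernel_nonneg) auto
  also have "\<dots> = K"
    using circle_mean_poisson_kernel[OF z] by (simp only: circle_mean_mult_left mult_1_left)
  finally show ?thesis .
qed

lemma exp_Re_herglotz_le:
  assumes k: "integrable circ k" and ek: "integrable circ (\<lambda>t. exp (k t))"
  shows "exp (Re (herglotz k z)) \<le> Re (herglotz (\<lambda>t. exp (k t)) z)"
proof -
  define c where "c = Re (herglotz k z)"
  have "exp c = exp c * (1 - c) + exp c * circle_mean (\<lambda>t. poisson_kernel z t * k t)"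
    unfolding c_def Re_herglotz[OF k] by (simp only: right_diff_distrib)
  also have "\<dots> = circle_mean (\<lambda>t. exp c * (1 - c) * poisson_kernel z t) + circle_mean (\<lambda>t. exp c * (poisson_kernel z t * k t))"
    unfolding circle_mean_mult_right circle_mean_poisson_kernel[OF z] by (simp only: mult_1_right)
  also have "\<dots> = circle_mean (\<lambda>t. exp c * (1 - c) * poisson_kernel z t + exp c * (poisson_kernel z t * k t))"
    by (rule circle_mean_add[symmetric]; rule Bochner_Integration.integrable_mult_right)
      (intro integrable_circ_continuous poisson_kernel_continuous z, rule integrable_poisson[OF k])
  also have "\<dots> \<le> circle_mean (\<lambda>t. poisson_kernel z t * exp (k t))"
  proof (rule circle_mean_mono)
    show "AE t in circ. exp c * (1 - c) * poisson_kernel z t + exp c * (poisson_kernel z t * k t) \<le> poisson_kernel z t * exp (k t)"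
    proof (rule AE_I2)
      fix t
      have "exp c * (1 + (k t - c)) \<le> exp c * exp (k t - c)"
        by (intro mult_left_mono exp_ge_add_one_self) simp
      also have "\<dots> = exp (k t)"
        by (simp flip: exp_add)
      finally have "poisson_kernel z t * (exp c * (1 + (k t - c))) \<le> poisson_kernel z t * exp (k t)"
        by (intro mult_left_mono poisson_kernel_nonneg)
      moreover have "p * (e * (1 + (x - c))) = e * (1 - c) * p + e * (p * x)" for p e x :: real
        by (simp add: algebra_simps)
      ultimately show "exp c * (1 - c) * poisson_kernel z t + exp c * (poisson_kernel z t * k t) \<le> poisson_kernel z t * exp (k t)"
        by (simp only:)
    qed
    show "integrable circ (\<lambda>t. exp c * (1 - c) * poisson_kernel z t + exp c * (poisson_kernel z t * k t))"
      by (intro Bochner_Integration.integrable_add Bochner_Integration.integrable_mult_right integrable_poisson k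
          integrable_circ_continuous poisson_kernel_continuous z)
  qed (rule integrable_poisson[OF ek])
  finally show ?thesis
    unfolding c_def Re_herglotz[OF ek] .
qed

end

definition herglotz_coeff :: "(real \<Rightarrow> real) \<Rightarrow> nat \<Rightarrow> complex" where
  "herglotz_coeff k n = (if n = 0 then 1 else 2) * circle_mean (\<lambda>t. cnj (cis t) ^ n * of_real (k t))"

lemma herglotz_sums:
  assumes k: "integrable circ k" and z: "cmod z < 1"
  shows "(\<lambda>n. herglotz_coeff k n * z ^ n) sums herglotz k z"
proof -
  define e where "e n = (if n = 0 then 1 else 2 :: complex)" for n :: nat
  have kern: "(\<lambda>n. e n * (z * cnj (cis t)) ^ n) sums herglotz_kernel z t" for t
  proof -
    define w where "w = z * cnj (cis t)"
    have w: "cmod w < 1"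
      using z by (simp add: w_def norm_mult)
    then have ne: "1 - w \<noteq> 0"
      by auto
    have "(\<lambda>n. 2 * w ^ n - (if n = 0 then 1 else 0)) sums (2 * (1 / (1 - w)) - 1)"
      by (intro sums_diff sums_mult geometric_sums w) (use sums_single[of 0 "\<lambda>_. 1 :: complex"] in simp)
    moreover have "2 * w ^ n - (if n = 0 then 1 else 0) = e n * w ^ n" for n
      by (simp add: e_def)
    moreover have "2 * (1 / (1 - w)) - 1 = herglotz_kernel z t"
      using ne by (simp add: herglotz_kernel_def w_def field_simps)
    ultimately show ?thesis
      by (simp add: w_def)
  qed
  have k_meas: "(\<lambda>t. complex_of_real (k t)) \<in> borel_measurable circ"
    using borel_measurable_integrable[OF k] by measurable
  have "(\<lambda>n. circle_mean (\<lambda>t. e n * (z * cnj (cis t)) ^ n * of_real (k t)))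
      sums circle_mean (\<lambda>t. \<Sum>n. e n * (z * cnj (cis t)) ^ n * of_real (k t))"
  proof (rule circle_mean_suminf(1)[where M = "\<lambda>n. 2 * cmod z ^ n" and g = "\<lambda>t. \<bar>k t\<bar>"])
    show "(\<lambda>t. e n * (z * cnj (cis t)) ^ n * of_real (k t)) \<in> borel_measurable circ" for n
      by (rule borel_measurable_times[OF _ k_meas]) (intro measurable_circ_continuous continuous_intros)
    show "cmod (e n * (z * cnj (cis t)) ^ n * of_real (k t)) \<le> 2 * cmod z ^ n * \<bar>k t\<bar>" for n t
      by (auto simp: e_def norm_mult norm_power intro!: mult_right_mono)
    show "summable (\<lambda>n. 2 * cmod z ^ n)"
      using z by (intro summable_mult summable_geometric) simp
    show "integrable circ (\<lambda>t. \<bar>k t\<bar>)"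
      using k by simp
  qed
  moreover have "(\<Sum>n. e n * (z * cnj (cis t)) ^ n * of_real (k t)) = herglotz_kernel z t * of_real (k t)" for t
    using sums_mult2[OF kern[of t], of "of_real (k t)"] by (simp add: sums_iff)
  moreover have "circle_mean (\<lambda>t. e n * (z * cnj (cis t)) ^ n * of_real (k t)) = herglotz_coeff k n * z ^ n" for n
  proof -
    have "e n * (z * cnj (cis t)) ^ n * of_real (k t) = (e n * z ^ n) * (cnj (cis t) ^ n * of_real (k t))" for t
      by (simp add: power_mult_distrib)
    then show ?thesis
      by (simp only: circle_mean_mult_right) (simp add: herglotz_coeff_def e_def)
  qed
  ultimately show ?thesis
    by (simp add: herglotz_def)
qed

lemma holomorphic_herglotz: "integrable circ k \<Longrightarrow> herglotz k holomorphic_on ball 0 1"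
  by (rule powser_holomorphic_disc[OF herglotz_sums])

lemma circle_mean_Re_herglotz:
  assumes k: "integrable circ k" and r: "0 \<le> r" "r < 1"
  shows "circle_mean (\<lambda>s. of_real (Re (herglotz k (of_real r * cis s))) * (cis s ^ i * cnj (cis s ^ j)))
    = of_real (r ^ (max i j - min i j)) * circle_mean (\<lambda>t. of_real (k t) * (cis t ^ i * cnj (cis t ^ j)))"
proof -
  define c where "c n = herglotz_coeff k n * of_real r ^ n" for n
  have c: "summable (\<lambda>n. cmod (c n))"
    unfolding c_def using herglotz_sums[OF k] r by (intro powser_summable_cmod) (auto simp: sums_iff)
  define W where "W s = herglotz k (of_real r * cis s)" for s
  have W_eq: "W s = (\<Sum>n. c n * cis s ^ n)" for s
    unfolding W_def c_def powser_circle[symmetric]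
    using herglotz_sums[OF k, of "of_real r * cis s"] r by (simp add: sums_iff norm_mult)
  have W_cont: "continuous_on UNIV W"
    unfolding W_def by (rule holomorphic_circle_continuous[OF holomorphic_herglotz[OF k] r])
  have mean_W: "circle_mean (\<lambda>s. W s * (cis s ^ i * cnj (cis s ^ j))) = (if i \<le> j then c (j - i) else 0)" for i j
  proof -
    have "(\<lambda>n. c n * circle_mean (\<lambda>s. cis s ^ n * (cis s ^ i * cnj (cis s ^ j))))
        sums circle_mean (\<lambda>s. W s * (cis s ^ i * cnj (cis s ^ j)))"
      unfolding W_eq by (rule circle_mean_cis_series[OF c]) (intro integrable_circ_continuous continuous_intros)
    moreover have "circle_mean (\<lambda>s. cis s ^ n * (cis s ^ i * cnj (cis s ^ j))) = of_bool (n + i = j)" for n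
      using circle_mean_cis_power[of "n + i" j] by (simp add: power_add mult.assoc)
    ultimately have 1: "(\<lambda>n. c n * of_bool (n + i = j)) sums circle_mean (\<lambda>s. W s * (cis s ^ i * cnj (cis s ^ j)))"
      by simp
    show ?thesis
    proof (cases "i \<le> j")
      case True
      then have "(\<lambda>n. c n * of_bool (n + i = j)) = (\<lambda>n. if n = j - i then c n else 0)"
        by (auto simp: fun_eq_iff)
      then show ?thesis
        using sums_unique2[OF 1] sums_single[of "j - i" c] True by auto
    next
      case False
      then have "(\<lambda>n. c n * of_bool (n + i = j)) = (\<lambda>_. 0)"
        by (auto simp: fun_eq_iff)
      then show ?thesis
        using sums_unique2[OF 1] sums_zero False by auto
    qed
  qed
  define V where "V i j = circle_mean (\<lambda>t. of_real (k t) * (cis t ^ i * cnj (cis t ^ j)))" for i j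
  have cis_shift: "cis t ^ i * cnj (cis t ^ (i + n)) = cnj (cis t) ^ n" for t i n
  proof -
    have "cis t * cnj (cis t) = 1"
      by (simp add: cis_cnj cis_mult)
    then have "cis t ^ i * cnj (cis t) ^ i = 1"
      unfolding power_mult_distrib[symmetric] by simp
    then show ?thesis
      by (simp add: power_add)
  qed
  have V_ge: "V i (i + n) = circle_mean (\<lambda>t. cnj (cis t) ^ n * of_real (k t))" for i n
    unfolding V_def cis_shift by (simp add: mult.commute)
  have V_cnj: "cnj (V i j) = V j i" for i j
    unfolding V_def circle_mean_cnj[symmetric] by (simp add: mult_ac)
  define U where "U i j = circle_mean (\<lambda>s. of_real (Re (W s)) * (cis s ^ i * cnj (cis s ^ j)))" for i j
  have U_cnj: "cnj (U i j) = U j i" for i j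
    unfolding U_def circle_mean_cnj[symmetric] by (simp add: mult_ac)
  have U: "U i j = (circle_mean (\<lambda>s. W s * (cis s ^ i * cnj (cis s ^ j)))
      + cnj (circle_mean (\<lambda>s. W s * (cis s ^ j * cnj (cis s ^ i))))) / 2" for i j
  proof -
    have "of_real (Re (W s)) * (cis s ^ i * cnj (cis s ^ j))
        = (1 / 2) * (W s * (cis s ^ i * cnj (cis s ^ j)) + cnj (W s * (cis s ^ j * cnj (cis s ^ i))))" for s
    proof -
      have "of_real (Re (W s)) = (1 / 2) * (W s + cnj (W s))"
        by (simp add: complex_add_cnj)
      then show ?thesis
        by (simp only:) (simp add: algebra_simps)
    qed
    then have "U i j = (1 / 2) * circle_mean (\<lambda>s. W s * (cis s ^ i * cnj (cis s ^ j)) + cnj (W s * (cis s ^ j * cnj (cis s ^ i))))"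
      unfolding U_def by (simp only: circle_mean_mult_right)
    also have "circle_mean (\<lambda>s. W s * (cis s ^ i * cnj (cis s ^ j)) + cnj (W s * (cis s ^ j * cnj (cis s ^ i))))
        = circle_mean (\<lambda>s. W s * (cis s ^ i * cnj (cis s ^ j))) + circle_mean (\<lambda>s. cnj (W s * (cis s ^ j * cnj (cis s ^ i))))"
      by (rule circle_mean_add) (intro integrable_circ_continuous continuous_on_cnj continuous_on_mult W_cont continuous_intros)+
    finally show ?thesis
      by (simp only: circle_mean_cnj) simp
  qed
  have le: "U i (i + n) = of_real (r ^ n) * V i (i + n)" for i n
  proof (cases "n = 0")
    case True
    have "cnj (V i i) = V i i"
      by (rule V_cnj)
    moreover have "c 0 = V i i"
      using V_ge[of i 0] by (simp add: c_def herglotz_coeff_def)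
    ultimately show ?thesis
      unfolding U mean_W using True by simp
  next
    case False
    then show ?thesis
      unfolding U mean_W V_ge by (simp add: c_def herglotz_coeff_def)
  qed
  have "U i j = of_real (r ^ (max i j - min i j)) * V i j"
  proof (cases "i \<le> j")
    case True
    then show ?thesis
      using le[of i "j - i"] by (simp add: max_def min_def)
  next
    case False
    then have "U j i = of_real (r ^ (i - j)) * V j i"
      using le[of j "i - j"] by simp
    then have "cnj (U j i) = of_real (r ^ (i - j)) * cnj (V j i)"
      by simp
    then show ?thesis
      using False by (simp add: U_cnj V_cnj max_def min_def)
  qed
  then show ?thesis
    by (simp add: U_def V_def W_def)
qed

lemma norm_mult_op_outer_le:
  assumes k: "integrable circ k" "\<And>t. 0 \<le> k t"
  shows "(norm (mult_op (\<lambda>z x. exp (- herglotz k z) * x) (hardy_trunc N f)))\<^sup>2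
    \<le> circle_mean (\<lambda>t. exp (- 2 * k t) * (cmod (hardy_eval (hardy_trunc N f) (cis t)))\<^sup>2)"
proof -
  define v where "v t = exp (- 2 * k t)" for t
  have v: "integrable circ v"
  proof (rule Bochner_Integration.integrable_bound[of _ "\<lambda>_. 1 :: real"])
    show "v \<in> borel_measurable circ"
      unfolding v_def using borel_measurable_integrable[OF k(1)] by measurable
    show "AE t in circ. norm (v t) \<le> norm (1 :: real)"
      using k(2) by (intro AE_I2) (simp add: v_def)
  qed simp
  define a where "a z = exp (- herglotz k z)" for z
  have a_hol: "a holomorphic_on ball 0 1"
    unfolding a_def by (intro holomorphic_intros holomorphic_herglotz k)
  have a_sq: "(cmod (a z))\<^sup>2 \<le> Re (herglotz v z)" if z: "cmod z < 1" for z
  proof -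
    have k2: "integrable circ (\<lambda>t. - 2 * k t)"
      using k(1) by simp
    have "(cmod (a z))\<^sup>2 = exp (- 2 * Re (herglotz k z))"
      by (simp add: a_def norm_exp_eq_Re flip: exp_double)
    also have "- 2 * Re (herglotz k z) = Re (herglotz (\<lambda>t. - 2 * k t) z)"
      unfolding Re_herglotz[OF z k(1)] Re_herglotz[OF z k2] circle_mean_mult_right[symmetric]
      by (intro arg_cong[where f = circle_mean] ext mult.left_commute)
    also have "exp \<dots> \<le> Re (herglotz v z)"
      unfolding v_def by (rule exp_Re_herglotz_le[OF z k2]) (use v in \<open>simp add: v_def[abs_def]\<close>)
    finally show ?thesis .
  qed
  have a_le: "cmod (a z) \<le> 1" if "cmod z < 1" for z
    using Re_herglotz_nonneg[OF that k] by (simp add: a_def norm_exp_eq_Re)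
  interpret analytic_contraction "\<lambda>z x. a z * x"
    by (rule analytic_contraction_scalar[OF a_hol a_le])
  define p where "p = hardy_trunc N f"
  define b where "b = hardy_coeff f"
  define F where "F t = hardy_eval p (cis t)" for t
  have p_eval: "hardy_eval p w = (\<Sum>n<N. b n * w ^ n)" for w
    by (simp add: p_def b_def hardy_eval_trunc scaleC_complex_def mult.commute)
  have sq_expand: "of_real ((cmod (\<Sum>n<N. x n))\<^sup>2) = (\<Sum>i<N. \<Sum>j<N. x i * cnj (x j))" for x :: "nat \<Rightarrow> complex"
    unfolding complex_norm_square of_real_power[symmetric] by (simp only: cnj_sum sum_product)
  define V where "V i j = circle_mean (\<lambda>t. of_real (v t) * (cis t ^ i * cnj (cis t ^ j)))" for i j
  have v_int: "integrable circ (\<lambda>t. of_real (v t) * (cis t ^ i * cnj (cis t ^ j)))" for i j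
  proof -
    have "integrable circ (\<lambda>t. (cis t ^ i * cnj (cis t ^ j)) * complex_of_real (v t))"
      using v by (intro integrable_circ_mult_bounded[where K = 1] measurable_circ_continuous continuous_intros)
        (auto simp: norm_mult norm_power)
    then show ?thesis
      by (simp add: mult.commute)
  qed
  have mean_v: "complex_of_real (circle_mean (\<lambda>t. v t * (cmod (F t))\<^sup>2)) = (\<Sum>i<N. \<Sum>j<N. b i * cnj (b j) * V i j)"
  proof -
    have "of_real (v t * (cmod (F t))\<^sup>2) = (\<Sum>i<N. \<Sum>j<N. (b i * cnj (b j)) * (of_real (v t) * (cis t ^ i * cnj (cis t ^ j))))" for t
      unfolding F_def p_eval of_real_mult sq_expand sum_distrib_left by (intro sum.cong refl) (simp add: mult_ac)
    then have "of_real (circle_mean (\<lambda>t. v t * (cmod (F t))\<^sup>2))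
        = circle_mean (\<lambda>t. \<Sum>i<N. \<Sum>j<N. (b i * cnj (b j)) * (of_real (v t) * (cis t ^ i * cnj (cis t ^ j))))"
      by (simp only: circle_mean_of_real[symmetric])
    also have "\<dots> = (\<Sum>i<N. \<Sum>j<N. circle_mean (\<lambda>t. (b i * cnj (b j)) * (of_real (v t) * (cis t ^ i * cnj (cis t ^ j)))))"
      by (subst circle_mean_sum, intro Bochner_Integration.integrable_sum Bochner_Integration.integrable_mult_right v_int)
        (intro sum.cong refl circle_mean_sum Bochner_Integration.integrable_mult_right v_int)
    finally show ?thesis
      by (simp only: circle_mean_mult_right V_def)
  qed
  define g where "g = mult_op (\<lambda>z x. a z * x) p"
  define X where "X r = (\<Sum>i<N. \<Sum>j<N. b i * cnj (b j) * of_real (r ^ i * r ^ j * r ^ (max i j - min i j)) * V i j)" for r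
  have mean_le: "circle_mean (\<lambda>s. (cmod (hardy_eval g (of_real r * cis s)))\<^sup>2) \<le> Re (X r)"
    if r: "0 \<le> r" "r < 1" for r
  proof -
    have z: "cmod (of_real r * cis s) < 1" for s
      using r by (simp add: norm_mult)
    define W where "W s = Re (herglotz v (of_real r * cis s))" for s
    have W_cont: "continuous_on UNIV W"
      unfolding W_def by (intro continuous_intros holomorphic_circle_continuous[OF holomorphic_herglotz[OF v] r])
    have p_cont: "continuous_on UNIV (\<lambda>s. hardy_eval p (of_real r * cis s))"
      by (rule continuous_on_hardy_eval_circle[OF r])
    have "circle_mean (\<lambda>s. (cmod (hardy_eval g (of_real r * cis s)))\<^sup>2)
        \<le> circle_mean (\<lambda>s. W s * (cmod (hardy_eval p (of_real r * cis s)))\<^sup>2)"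
    proof (intro circle_mean_mono integrable_circ_continuous continuous_intros AE_I2
          continuous_on_hardy_eval_circle r W_cont p_cont)
      show "(cmod (hardy_eval g (of_real r * cis s)))\<^sup>2 \<le> W s * (cmod (hardy_eval p (of_real r * cis s)))\<^sup>2" for s
        unfolding g_def hardy_eval_mult_op[OF z] norm_mult power_mult_distrib W_def
        by (intro mult_right_mono a_sq z) simp
    qed
    also have "\<dots> = Re (X r)"
    proof -
      have "of_real (W s * (cmod (hardy_eval p (of_real r * cis s)))\<^sup>2)
          = (\<Sum>i<N. \<Sum>j<N. (b i * cnj (b j) * of_real (r ^ i * r ^ j)) * (of_real (W s) * (cis s ^ i * cnj (cis s ^ j))))" for s
        unfolding p_eval of_real_mult sq_expand sum_distrib_left
        by (intro sum.cong refl) (simp add: power_mult_distrib mult_ac)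
      then have "complex_of_real (circle_mean (\<lambda>s. W s * (cmod (hardy_eval p (of_real r * cis s)))\<^sup>2))
          = circle_mean (\<lambda>s. \<Sum>i<N. \<Sum>j<N. (b i * cnj (b j) * of_real (r ^ i * r ^ j)) * (of_real (W s) * (cis s ^ i * cnj (cis s ^ j))))"
        by (simp only: circle_mean_of_real[symmetric])
      also have "\<dots> = (\<Sum>i<N. \<Sum>j<N. circle_mean (\<lambda>s. (b i * cnj (b j) * of_real (r ^ i * r ^ j)) * (of_real (W s) * (cis s ^ i * cnj (cis s ^ j)))))"
      proof -
        have "integrable circ (\<lambda>s. of_real (W s) * (cis s ^ i * cnj (cis s ^ j)))" for i j
          by (intro integrable_circ_continuous continuous_intros W_cont)
        then show ?thesis
          by (subst circle_mean_sum, intro Bochner_Integration.integrable_sum Bochner_Integration.integrable_mult_right)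
            (simp, intro sum.cong refl circle_mean_sum Bochner_Integration.integrable_mult_right, simp)
      qed
      also have "\<dots> = X r"
        unfolding circle_mean_mult_right W_def circle_mean_Re_herglotz[OF v r] X_def V_def
        by (intro sum.cong refl) (simp add: mult_ac)
      finally show ?thesis
        by (metis Re_complex_of_real)
    qed
    finally show ?thesis .
  qed
  have "(X \<longlongrightarrow> (\<Sum>i<N. \<Sum>j<N. b i * cnj (b j) * of_real (1 ^ i * 1 ^ j * 1 ^ (max i j - min i j)) * V i j)) (at_left 1)"
    unfolding X_def by (intro tendsto_intros)
  then have "(X \<longlongrightarrow> of_real (circle_mean (\<lambda>t. v t * (cmod (F t))\<^sup>2))) (at_left 1)"
    by (simp add: mean_v)
  then have X_lim: "((\<lambda>r. Re (X r)) \<longlongrightarrow> circle_mean (\<lambda>t. v t * (cmod (F t))\<^sup>2)) (at_left 1)"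
    using tendsto_Re by fastforce
  have "(\<Sum>n<K. (cmod (hardy_coeff g n))\<^sup>2) \<le> circle_mean (\<lambda>t. v t * (cmod (F t))\<^sup>2)" for K
  proof (rule tendsto_le[OF trivial_limit_at_left_real X_lim])
    show "((\<lambda>r. \<Sum>n<K. (cmod (hardy_coeff g n))\<^sup>2 * r ^ (2 * n)) \<longlongrightarrow> (\<Sum>n<K. (cmod (hardy_coeff g n))\<^sup>2)) (at_left 1)"
      by (auto intro!: tendsto_eq_intros)
    show "\<forall>\<^sub>F r in at_left 1. (\<Sum>n<K. (cmod (hardy_coeff g n))\<^sup>2 * r ^ (2 * n)) \<le> Re (X r)"
      using eventually_at_left_1
    proof eventually_elim
      case (elim r)
      then have s: "(\<lambda>n. (cmod (hardy_coeff g n))\<^sup>2 * r ^ (2 * n)) sums circle_mean (\<lambda>s. (cmod (hardy_eval g (of_real r * cis s)))\<^sup>2)"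
        by (intro powser_parseval hardy_eval_sums_complex) auto
      have "(\<Sum>n<K. (cmod (hardy_coeff g n))\<^sup>2 * r ^ (2 * n)) \<le> circle_mean (\<lambda>s. (cmod (hardy_eval g (of_real r * cis s)))\<^sup>2)"
        unfolding sums_unique[OF s] using elim by (intro sum_le_suminf sums_summable[OF s]) auto
      also have "\<dots> \<le> Re (X r)"
        using elim by (intro mean_le) auto
      finally show ?case .
    qed
  qed
  then have "(norm g)\<^sup>2 \<le> circle_mean (\<lambda>t. v t * (cmod (F t))\<^sup>2)"
    unfolding norm_hardy_sq by (intro suminf_le_const summable_hardy)
  then show ?thesis
    by (simp add: g_def p_def F_def v_def a_def)
qed

text \<open>The outer function \<open>a = exp (- w)\<close> with \<open>w\<close> the Herglotz integral of \<open>k\<close> has the approximate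
  inverses \<open>exp w\<^sub>n\<close>, where \<open>w\<^sub>n\<close> is the Herglotz integral of \<open>min k n\<close>.\<close>

lemma herglotz_truncation_tendsto:
  assumes k: "integrable circ k" "\<And>t. 0 \<le> k t" and z: "cmod z < 1"
  shows "(\<lambda>n. herglotz (\<lambda>t. k t - min (k t) (real n)) z) \<longlonglongrightarrow> 0"
proof (rule Lim_null_comparison)
  have meas: "(\<lambda>t. k t - min (k t) (real n)) \<in> borel_measurable circ" for n
    using borel_measurable_integrable[OF k(1)] by measurable
  have int: "integrable circ (\<lambda>t. k t - min (k t) (real n))" for n
    by (rule Bochner_Integration.integrable_bound[OF k(1) meas]) (use k(2) in \<open>auto intro!: AE_I2\<close>)
  show "\<forall>\<^sub>F n in sequentially. norm (herglotz (\<lambda>t. k t - min (k t) (real n)) z)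
      \<le> 2 / (1 - cmod z) * circle_mean (\<lambda>t. \<bar>k t - min (k t) (real n)\<bar>)"
    by (intro always_eventually allI norm_herglotz_le z int)
  have "(\<lambda>n. circle_mean (\<lambda>t. \<bar>k t - min (k t) (real n)\<bar>)) \<longlonglongrightarrow> circle_mean (\<lambda>t. 0)"
  proof (rule circle_mean_tendsto[where w = k])
    show "AE t in circ. (\<lambda>n. \<bar>k t - min (k t) (real n)\<bar>) \<longlonglongrightarrow> 0"
    proof (intro AE_I2 tendsto_eventually)
      fix t
      show "\<forall>\<^sub>F n in sequentially. \<bar>k t - min (k t) (real n)\<bar> = 0"
        unfolding eventually_sequentially
        by (intro exI[of _ "nat \<lceil>k t\<rceil>"] allI impI) linarith
    qed
    show "AE t in circ. norm \<bar>k t - min (k t) (real n)\<bar> \<le> k t" for n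
      using k(2) by (intro AE_I2) auto
    show "(\<lambda>t. \<bar>k t - min (k t) (real n)\<bar>) \<in> borel_measurable circ" for n
      using meas[of n] by measurable
  qed (use k in auto)
  from tendsto_mult[OF tendsto_const this, of "2 / (1 - cmod z)"]
  show "(\<lambda>n. 2 / (1 - cmod z) * circle_mean (\<lambda>t. \<bar>k t - min (k t) (real n)\<bar>)) \<longlonglongrightarrow> 0"
    by simp
qed

section \<open>Invariant subspaces of de Branges--Rovnyak spaces\<close>

lemma cinner_shift_funpow_left:
  "cinner f ((hardy_shift ^^ j) g) = cinner ((backward_shift ^^ j) f) g"
proof (induction j arbitrary: f)
  case (Suc j)
  have *: "cinner f (hardy_shift h) = cinner (backward_shift f) h" for f h :: "'a hardy"
    by (metis cinner_commute cinner_hardy_shift)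
  have "(hardy_shift ^^ Suc j) g = hardy_shift ((hardy_shift ^^ j) g)"
    "(backward_shift ^^ Suc j) f = (backward_shift ^^ j) (backward_shift f)"
    by (simp_all add: funpow_swap1)
  then show ?case
    by (simp only: * Suc)
qed simp

lemma hardy_coeff_backward_shift_funpow:
  "hardy_coeff ((backward_shift ^^ j) f) n = hardy_coeff f (n + j)"
  by (induction j arbitrary: n) (simp_all add: backward_shift.rep_eq)

lemma cinner_hardy_const: "cinner f (hardy_const 1) = hardy_coeff f 0" for f :: "complex hardy"
proof -
  have "(\<lambda>n. cinner (hardy_coeff f n) (hardy_coeff (hardy_const 1) n)) = (\<lambda>n. if n = 0 then hardy_coeff f n else 0)"
    by (auto simp: hardy_const.rep_eq cinner_complex_def)
  then show ?thesis
    unfolding cinner_hardy.rep_eq using sums_single[of 0 "hardy_coeff f"] by (simp add: sums_iff)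
qed

lemma hardy_coeff_eq_cinner:
  fixes f :: "complex hardy"
  shows "hardy_coeff f j = cinner f ((hardy_shift ^^ j) (hardy_const 1))"
  by (simp add: cinner_shift_funpow_left cinner_hardy_const hardy_coeff_backward_shift_funpow)

lemma bounded_linear_hardy_coeff: "bounded_linear (\<lambda>f. hardy_coeff f j)"
  by (rule bounded_linear_intro[of _ 1]) (auto simp: hardy_coeff_simps norm_coeff_le)

lemma cinner_hardy_trunc_right:
  fixes f g :: "complex hardy"
  shows "cinner f (hardy_trunc N g) = (\<Sum>n<N. hardy_coeff f n * cnj (hardy_coeff g n))"
proof -
  have "(\<lambda>n. cinner (hardy_coeff f n) (hardy_coeff (hardy_trunc N g) n))
      = (\<lambda>n. if n \<in> {..<N} then hardy_coeff f n * cnj (hardy_coeff g n) else 0)"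
    by (auto simp: hardy_trunc.rep_eq cinner_complex_def)
  then show ?thesis
    unfolding cinner_hardy.rep_eq
    using sums_If_finite_set[of "{..<N}" "\<lambda>n. hardy_coeff f n * cnj (hardy_coeff g n)"]
    by (simp add: sums_iff)
qed

context analytic_contraction
begin

lemma mult_op_shift_funpow: "mult_op B ((hardy_shift ^^ j) f) = (hardy_shift ^^ j) (mult_op B f)"
  by (induction j) (auto simp: mult_op_shift)

end

lemma hardy_coeff_adjoint_mult_op:
  fixes \<phi> :: "complex \<Rightarrow> complex" and f :: "complex hardy"
  assumes "analytic_contraction (\<lambda>z x. \<phi> z * x)"
  shows "hardy_coeff (adjoint_op (mult_op (\<lambda>z x. \<phi> z * x)) f) j
    = cinner ((backward_shift ^^ j) f) (mult_op (\<lambda>z x. \<phi> z * x) (hardy_const 1))"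
proof -
  interpret analytic_contraction "\<lambda>z x. \<phi> z * x"
    by (rule assms)
  show ?thesis
    by (simp only: hardy_coeff_eq_cinner adjoint_exists'[OF bounded_clinear_mult_op] mult_op_shift_funpow
        cinner_shift_funpow_left[symmetric])
qed

text \<open>An operator range \<open>R(H\<^sup>2)\<close> with the norm \<open>\<parallel>R x\<parallel> := \<parallel>x\<parallel>\<close> on which the backward shift is
  contractive; this is \<open>\<H>(B)\<close> for \<open>R = (I - T\<^sub>B T\<^sub>B\<^sup>*)\<^sup>1\<^sup>/\<^sup>2\<close>.\<close>

locale shift_range =
  fixes R :: "complex hardy \<Rightarrow> complex hardy"
  assumes bounded_R: "bounded_clinear R"
    and selfadjoint: "cinner (R x) y = cinner x (R y)"
    and injective: "R x = 0 \<Longrightarrow> x = 0"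
    and shift_contractive: "norm (R (hardy_shift h)) \<le> norm (R h)"
begin

lemma R_inject: "R x = R y \<longleftrightarrow> x = y"
  using injective[of "x - y"] bounded_clinear_diff[OF bounded_R, of x y] by auto

lemma dense_range: "\<exists>N g. norm (y - R (hardy_trunc N g)) < e" if "e > 0"
proof -
  have sub: "csubspace (closure (range R))"
    by (rule csubspace_closure[OF csubspace_range[OF bounded_R]])
  have "y \<in> closure (range R)"
  proof (rule mem_closed_csubspaceI[OF sub closed_closure])
    fix w assume w: "\<And>v. v \<in> closure (range R) \<Longrightarrow> cinner v w = 0"
    have "cinner (R (R w)) w = 0"
      by (intro w subsetD[OF closure_subset]) simp
    then have "cinner (R w) (R w) = 0"
      by (simp only: selfadjoint)
    then have "R w = 0"
      by (simp only: cinner_eq_zero_iff)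
    then have "w = 0"
      by (rule injective)
    then show "cinner y w = 0"
      by simp
  qed
  then obtain v where "v \<in> range R" "dist v y < e / 2"
    using \<open>e > 0\<close> unfolding closure_approachable by (meson half_gt_zero)
  then obtain g where g: "dist (R g) y < e / 2"
    by blast
  have "(\<lambda>N. R (hardy_trunc N g)) \<longlonglongrightarrow> R g"
    by (rule bounded_clinear_tendsto[OF bounded_R hardy_trunc_tendsto])
  then have "\<forall>\<^sub>F N in sequentially. dist (R (hardy_trunc N g)) (R g) < e / 2"
    using \<open>e > 0\<close> by (intro tendstoD) auto
  then obtain N where "dist (R (hardy_trunc N g)) (R g) < e / 2"
    using eventually_happens'[OF sequentially_bot] by blast
  then have "dist (R (hardy_trunc N g)) y < e"
    using g dist_triangle[of "R (hardy_trunc N g)" y "R g"] by linarith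
  then show ?thesis
    by (metis dist_commute dist_norm)
qed

text \<open>Boundedness and coefficientwise convergence of the images give weak convergence, and closed
  subspaces are weakly closed.\<close>

lemma weak_limit:
  assumes V: "csubspace V" "closed V" and x: "\<And>n. x n \<in> V" "\<And>n. norm (x n) \<le> K"
    and lim: "\<And>j. (\<lambda>n. hardy_coeff (R (x n)) j) \<longlonglongrightarrow> hardy_coeff g j"
  obtains y where "y \<in> V" "R y = g" "norm y \<le> K"
proof -
  have K: "0 \<le> K"
    using order_trans[OF norm_ge_zero x(2)] .
  have trunc: "(\<lambda>n. cinner (R (x n)) (hardy_trunc N h)) \<longlonglongrightarrow> cinner g (hardy_trunc N h)" for N h
    unfolding cinner_hardy_trunc_right by (intro tendsto_intros lim)
  have bound: "cmod (cinner h g) \<le> K * norm (R h)" for h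
  proof -
    have "cmod (cinner g (hardy_trunc N h)) \<le> K * norm (R (hardy_trunc N h))" for N
    proof (rule LIMSEQ_le_const2[OF tendsto_norm[OF trunc]])
      have "cmod (cinner (R (x n)) (hardy_trunc N h)) \<le> K * norm (R (hardy_trunc N h))" for n
        unfolding selfadjoint using norm_cinner_le mult_right_mono[OF x(2) norm_ge_zero] order_trans by blast
      then show "\<exists>M. \<forall>n\<ge>M. cmod (cinner (R (x n)) (hardy_trunc N h)) \<le> K * norm (R (hardy_trunc N h))"
        by blast
    qed
    moreover have "(\<lambda>N. cmod (cinner g (hardy_trunc N h))) \<longlonglongrightarrow> cmod (cinner g h)"
      by (intro tendsto_norm tendsto_cinner_right hardy_trunc_tendsto)
    moreover have "(\<lambda>N. K * norm (R (hardy_trunc N h))) \<longlonglongrightarrow> K * norm (R h)"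
      by (intro tendsto_intros bounded_clinear_tendsto[OF bounded_R] hardy_trunc_tendsto)
    ultimately have "cmod (cinner g h) \<le> K * norm (R h)"
      by (meson LIMSEQ_le)
    then show ?thesis
      by (subst cinner_commute) simp
  qed
  obtain y where y: "R y = g" "norm y \<le> K"
    using range_criterion[OF bounded_R selfadjoint bound K] .
  have "y \<in> V"
  proof (rule mem_closed_csubspaceI[OF V])
    fix w assume w: "\<And>v. v \<in> V \<Longrightarrow> cinner v w = 0"
    have small: "cmod (cinner y w) \<le> 2 * K * e" if e: "e > 0" for e
    proof -
      obtain N h where h: "norm (w - R (hardy_trunc N h)) < e"
        using dense_range[OF e] by blast
      define u where "u = hardy_trunc N h"
      have "cmod (cinner y w) \<le> cmod (cinner (y - x n) (R u)) + 2 * K * e" for n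
      proof -
        have split: "cinner y w = cinner (y - x n) (R u) + cinner (y - x n) (w - R u)"
          using w[OF x(1), of n] by (simp add: cinner_diff_left cinner_diff_right)
        have "cmod (cinner (y - x n) (w - R u)) \<le> 2 * K * e"
        proof -
          have "cmod (cinner (y - x n) (w - R u)) \<le> norm (y - x n) * norm (w - R u)"
            by (rule norm_cinner_le)
          also have "\<dots> \<le> (2 * K) * e"
            using norm_triangle_ineq4[of y "x n"] y(2) x(2)[of n] h K
            by (intro mult_mono) (auto simp: u_def)
          finally show ?thesis .
        qed
        then show ?thesis
          unfolding split using norm_triangle_ineq[of "cinner (y - x n) (R u)" "cinner (y - x n) (w - R u)"] by linarith
      qed
      moreover have "(\<lambda>n. cmod (cinner (y - x n) (R u)) + 2 * K * e) \<longlonglongrightarrow> 0 + 2 * K * e"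
      proof (intro tendsto_add tendsto_const tendsto_norm_zero)
        have "(\<lambda>n. cinner g u - cinner (R (x n)) u) \<longlonglongrightarrow> cinner g u - cinner g u"
          unfolding u_def by (intro tendsto_diff tendsto_const trunc)
        then show "(\<lambda>n. cinner (y - x n) (R u)) \<longlonglongrightarrow> 0"
          by (simp add: cinner_diff_left selfadjoint[symmetric] y(1) bounded_clinear_diff[OF bounded_R])
      qed
      ultimately show ?thesis
        using LIMSEQ_le_const by fastforce
    qed
    show "cinner y w = 0"
    proof (rule ccontr)
      assume "cinner y w \<noteq> 0"
      then have c: "cmod (cinner y w) > 0"
        by simp
      define e where "e = cmod (cinner y w) / (4 * K + 1)"
      have "e > 0"
        using c K by (simp add: e_def)
      moreover have "2 * K * e < cmod (cinner y w)"
        using c K by (simp add: e_def field_simps add_pos_nonneg mult_pos_pos)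
      ultimately show False
        using small[of e] by simp
    qed
  qed
  then show thesis
    using that y by blast
qed

lemma intertwiner_exists:
  obtains C where "contraction_op C" "\<And>x. R (C x) = backward_shift (R x)"
proof -
  have "\<exists>c. R c = backward_shift (R x) \<and> norm c \<le> norm x" for x
  proof -
    have "cmod (cinner h (backward_shift (R x))) \<le> norm x * norm (R h)" for h
    proof -
      have "cinner h (backward_shift (R x)) = cinner (R (hardy_shift h)) x"
        by (simp add: cinner_hardy_shift[symmetric] selfadjoint)
      then show ?thesis
        using norm_cinner_le[of "R (hardy_shift h)" x] mult_right_mono[OF shift_contractive[of h], of "norm x"]
        by (simp add: mult.commute)
    qed
    then show ?thesis
      using range_criterion[OF bounded_R selfadjoint, of "backward_shift (R x)" "norm x"] by (metis norm_ge_zero)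
  qed
  then obtain C where C: "\<And>x. R (C x) = backward_shift (R x)" "\<And>x. norm (C x) \<le> norm x"
    by metis
  have "bounded_clinear C"
  proof (rule bounded_clinearI[where K = 1])
    show "C (x + y) = C x + C y" for x y
      by (subst R_inject[symmetric])
        (simp add: C(1) bounded_clinear_add[OF bounded_R] bounded_clinear_add[OF bounded_clinear_backward_shift])
    show "C (c *\<^sub>C x) = c *\<^sub>C C x" for c x
      by (subst R_inject[symmetric])
        (simp add: C(1) bounded_clinear_scaleC[OF bounded_R] bounded_clinear_scaleC[OF bounded_clinear_backward_shift])
  qed (simp add: C(2))
  then show thesis
    using that[of C] C by (simp add: contraction_op_def)
qed

lemma multiplier_action:
  assumes V: "csubspace V" "closed V" and inv: "\<And>x y. x \<in> V \<Longrightarrow> R y = backward_shift (R x) \<Longrightarrow> y \<in> V"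
    and \<phi>: "\<phi> holomorphic_on ball 0 1" "\<And>z. cmod z < 1 \<Longrightarrow> cmod (\<phi> z) \<le> 1" and x: "x \<in> V"
  obtains y where "y \<in> V" "R y = adjoint_op (mult_op (\<lambda>z x. \<phi> z * x)) (R x)" "norm y \<le> norm x"
proof -
  interpret T: analytic_contraction "\<lambda>z x. \<phi> z * x"
    by (rule analytic_contraction_scalar[OF \<phi>])
  obtain C where "contraction_op C" and RC: "\<And>x. R (C x) = backward_shift (R x)"
    using intertwiner_exists by metis
  then interpret contraction_op C
    by simp
  define p where "p = mult_op (\<lambda>z x. \<phi> z * x) (hardy_const 1)"
  have p_eval: "hardy_eval p z = \<phi> z" if "cmod z < 1" for z
    unfolding p_def using T.hardy_eval_mult_op[OF that, of "hardy_const 1"] by (simp add: hardy_eval_const)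
  define a where "a n = cnj (hardy_coeff p n)" for n
  have a: "(\<lambda>n. a n * z ^ n) sums cnj (\<phi> (cnj z))" if "cmod z < 1" for z
    using hardy_eval_sums_complex[of "cnj z" p] that
    by (subst sums_cnj[symmetric]) (simp add: a_def p_eval)
  define r where "r = radius"
  note r = radius_bounds[folded r_def] and r_lim = tendsto_radius[folded r_def]
  have ar: "summable (\<lambda>n. cmod (a n * of_real (r k) ^ n))" for k
    using a r[of k] by (intro powser_summable_cmod) (auto simp: sums_iff)
  define y where "y k = (\<Sum>n. (a n * of_real (r k) ^ n) *\<^sub>C (C ^^ n) x)" for k
  have y_sums: "(\<lambda>n. (a n * of_real (r k) ^ n) *\<^sub>C (C ^^ n) x) sums y k" for k
    unfolding y_def by (intro summable_sums summable_power_series ar)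
  have C_pow: "(C ^^ n) x \<in> V" for n
    by (induction n) (use x inv RC in auto)
  have y_V: "y k \<in> V" for k
  proof (rule closed_sequentially[OF V(2)])
    show "(\<lambda>N. \<Sum>n<N. (a n * of_real (r k) ^ n) *\<^sub>C (C ^^ n) x) \<longlonglongrightarrow> y k"
      using y_sums[of k] by (simp add: sums_def)
    show "(\<Sum>n<N. (a n * of_real (r k) ^ n) *\<^sub>C (C ^^ n) x) \<in> V" for N
      using V(1) C_pow by (intro csubspace_sum) (auto simp: csubspace_def)
  qed
  have y_norm: "norm (y k) \<le> norm x" for k
    unfolding y_def by (rule von_neumann_inequality[OF a _ r]) (use \<phi>(2) in auto)
  have R_pow: "R ((C ^^ n) x) = (backward_shift ^^ n) (R x)" for n
    by (induction n) (auto simp: RC)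
  have "(\<lambda>k. hardy_coeff (R (y k)) j) \<longlonglongrightarrow> hardy_coeff (adjoint_op (mult_op (\<lambda>z x. \<phi> z * x)) (R x)) j" for j
  proof -
    define c where "c n = hardy_coeff (R x) (n + j) * a n" for n
    have c_norm: "summable (\<lambda>n. norm (c n))"
    proof (rule summable_comparison_test)
      have "cmod (c n) \<le> (cmod (hardy_coeff ((backward_shift ^^ j) (R x)) n))\<^sup>2 + (cmod (hardy_coeff p n))\<^sup>2" for n
      proof -
        have "u * w \<le> u\<^sup>2 + w\<^sup>2" if "0 \<le> u" "0 \<le> w" for u w :: real
        proof -
          have "2 * (u * w) \<le> u\<^sup>2 + w\<^sup>2" "0 \<le> u * w"
            using that zero_le_power2[of "u - w"] by (auto simp: power2_diff)
          then show ?thesis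
            by linarith
        qed
        from this[of "cmod (hardy_coeff (R x) (n + j))" "cmod (hardy_coeff p n)"] show ?thesis
          by (simp add: c_def a_def norm_mult hardy_coeff_backward_shift_funpow)
      qed
      then show "\<exists>N. \<forall>n\<ge>N. norm (norm (c n)) \<le> (cmod (hardy_coeff ((backward_shift ^^ j) (R x)) n))\<^sup>2 + (cmod (hardy_coeff p n))\<^sup>2"
        by simp
      show "summable (\<lambda>n. (cmod (hardy_coeff ((backward_shift ^^ j) (R x)) n))\<^sup>2 + (cmod (hardy_coeff p n))\<^sup>2)"
        by (intro summable_add summable_hardy)
    qed
    have coeff: "hardy_coeff (R (y k)) j = (\<Sum>n. c n * of_real (r k) ^ n)" for k
    proof -
      have "bounded_linear (\<lambda>x. hardy_coeff (R x) j)"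
        using bounded_linear_compose[OF bounded_linear_hardy_coeff] bounded_R by (auto simp: bounded_clinear_def)
      from bounded_linear.sums[OF this y_sums[of k]]
      show ?thesis
        by (simp add: sums_iff bounded_clinear_scaleC[OF bounded_R] R_pow hardy_coeff_scaleC scaleC_complex_def
            hardy_coeff_backward_shift_funpow c_def add.commute mult_ac)
    qed
    have "(\<lambda>k. \<Sum>n. c n * of_real (r k) ^ n) \<longlonglongrightarrow> (\<Sum>n. c n)"
    proof (rule tannerys_theorem[THEN conjunct2, THEN conjunct2])
      show "(\<lambda>k. c n * of_real (r k) ^ n) \<longlonglongrightarrow> c n" for n
        by (rule tendsto_eq_intros refl r_lim | simp)+
      show "\<forall>\<^sub>F (n, k) in sequentially \<times>\<^sub>F sequentially. norm (c n * of_real (r k) ^ n) \<le> norm (c n)"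
      proof (intro always_eventually allI, clarify)
        fix n k
        have "cmod (c n) * r k ^ n \<le> cmod (c n) * 1"
          using r[of k] by (intro mult_left_mono power_le_one) auto
        then show "norm (c n * of_real (r k) ^ n) \<le> norm (c n)"
          using r[of k] by (simp add: norm_mult norm_power)
      qed
    qed (use c_norm in auto)
    moreover have "(\<Sum>n. c n) = hardy_coeff (adjoint_op (mult_op (\<lambda>z x. \<phi> z * x)) (R x)) j"
      unfolding hardy_coeff_adjoint_mult_op[OF T.analytic_contraction_axioms]
      by (simp add: cinner_hardy.rep_eq cinner_complex_def hardy_coeff_backward_shift_funpow c_def a_def p_def)
    ultimately show ?thesis
      by (simp add: coeff)
  qed
  from weak_limit[OF V y_V y_norm this] that show thesis
    by blast
qed

theorem closed_invariant_subspace: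
  fixes k :: "real \<Rightarrow> real"
  assumes k: "integrable circ k" "\<And>t. 0 \<le> k t"
    and dominated: "\<And>f. norm (mult_op (\<lambda>z x. exp (- herglotz k z) * x) f) \<le> norm (R f)"
    and V: "csubspace V" "closed V" and inv: "\<And>x y. x \<in> V \<Longrightarrow> R y = backward_shift (R x) \<Longrightarrow> y \<in> V"
    and x: "R x \<in> closure (R ` V)"
  shows "x \<in> V"
proof -
  define a where "a z = exp (- herglotz k z)" for z
  have a_hol: "a holomorphic_on ball 0 1"
    unfolding a_def by (intro holomorphic_intros holomorphic_herglotz k)
  have a_le: "cmod (a z) \<le> 1" if "cmod z < 1" for z
    using Re_herglotz_nonneg[OF that k] by (simp add: a_def norm_exp_eq_Re)
  interpret T: analytic_contraction "\<lambda>z x. a z * x"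
    by (rule analytic_contraction_scalar[OF a_hol a_le])
  define T where "T = mult_op (\<lambda>z x. a z * x)"
  have Tb: "bounded_clinear T"
    unfolding T_def by (rule T.bounded_clinear_mult_op)
  have "\<exists>c. R c = adjoint_op T h \<and> norm c \<le> norm h" for h
  proof -
    have "cmod (cinner g (adjoint_op T h)) \<le> norm h * norm (R g)" for g
    proof -
      have "cmod (cinner g (adjoint_op T h)) \<le> norm (T g) * norm h"
        unfolding adjoint_exists[OF Tb, symmetric] by (rule norm_cinner_le)
      also have "\<dots> \<le> norm (R g) * norm h"
        using dominated[of g] by (intro mult_right_mono) (auto simp: T_def a_def)
      finally show ?thesis
        by (simp add: mult.commute)
    qed
    then show ?thesis
      using range_criterion[OF bounded_R selfadjoint, of "adjoint_op T h" "norm h"] by (metis norm_ge_zero)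
  qed
  then obtain A where A: "\<And>h. R (A h) = adjoint_op T h" "\<And>h. norm (A h) \<le> norm h"
    by metis
  have A_diff: "A (g - h) = A g - A h" for g h
    by (subst R_inject[symmetric])
      (simp add: A(1) bounded_clinear_diff[OF bounded_R] bounded_clinear_diff[OF bounded_clinear_adjoint[OF Tb]])
  have A_V: "A (R v) \<in> V" if v: "v \<in> V" for v
  proof -
    obtain y where y: "y \<in> V" "R y = adjoint_op T (R v)"
      unfolding T_def by (rule multiplier_action[OF V inv a_hol a_le v])
    then have "A (R v) = y"
      using A(1)[of "R v"] R_inject[of "A (R v)" y] by simp
    then show ?thesis
      using y(1) by simp
  qed
  obtain f where f: "\<And>n. f n \<in> R ` V" "f \<longlonglongrightarrow> R x"
    using x by (auto simp: closure_sequential)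
  have A_x: "A (R x) \<in> V"
  proof (rule closed_sequentially[OF V(2)])
    show "A (f n) \<in> V" for n
      using f(1)[of n] A_V by auto
    show "(\<lambda>n. A (f n)) \<longlonglongrightarrow> A (R x)"
    proof (rule LIM_zero_cancel, rule Lim_null_comparison)
      show "\<forall>\<^sub>F n in sequentially. norm (A (f n) - A (R x)) \<le> norm (f n - R x)"
        unfolding A_diff[symmetric] using A(2) by (intro always_eventually) blast
      show "(\<lambda>n. norm (f n - R x)) \<longlonglongrightarrow> 0"
        by (intro tendsto_norm_zero LIM_zero f)
    qed
  qed
  define l where "l n t = min (k t) (real n)" for n t
  have k_meas: "k \<in> borel_measurable circ"
    using borel_measurable_integrable[OF k(1)] .
  have l: "integrable circ (l n)" "l n t \<le> real n" "0 \<le> l n t" for n t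
  proof -
    show "integrable circ (l n)"
      by (rule Bochner_Integration.integrable_bound[OF k(1)])
        (use k_meas k(2) in \<open>auto simp: l_def[abs_def] intro!: AE_I2 borel_measurable_min\<close>)
  qed (use k(2) in \<open>auto simp: l_def\<close>)
  define \<psi> where "\<psi> n z = exp (- herglotz (\<lambda>t. k t - l n t) z)" for n z
  have kl: "integrable circ (\<lambda>t. k t - l n t)" "0 \<le> k t - l n t" for n t
    using k(1) l(1) by (auto simp: l_def)
  have \<psi>_hol: "\<psi> n holomorphic_on ball 0 1" for n
    unfolding \<psi>_def by (intro holomorphic_intros holomorphic_herglotz kl)
  have \<psi>_le: "cmod (\<psi> n z) \<le> 1" if "cmod z < 1" for n z
    using Re_herglotz_nonneg[OF that kl] by (simp add: \<psi>_def norm_exp_eq_Re)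
  have "\<exists>y\<in>V. R y = adjoint_op (mult_op (\<lambda>z x. \<psi> n z * x)) (R x) \<and> norm y \<le> norm x" for n
  proof -
    define \<phi> where "\<phi> z = exp (herglotz (l n) z - of_nat n)" for z
    have \<phi>_hol: "\<phi> holomorphic_on ball 0 1"
      unfolding \<phi>_def by (intro holomorphic_intros holomorphic_herglotz l)
    have \<phi>_le: "cmod (\<phi> z) \<le> 1" if "cmod z < 1" for z
      using Re_herglotz_le[OF that l(1), of n "real n"] l(2) by (simp add: \<phi>_def norm_exp_eq_Re)
    interpret F: analytic_contraction "\<lambda>z x. \<phi> z * x"
      by (rule analytic_contraction_scalar[OF \<phi>_hol \<phi>_le])
    interpret P: analytic_contraction "\<lambda>z x. \<psi> n z * x"
      by (rule analytic_contraction_scalar[OF \<psi>_hol \<psi>_le])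
    define F where "F = mult_op (\<lambda>z x. \<phi> z * x)"
    define P where "P = mult_op (\<lambda>z x. \<psi> n z * x)"
    have Fb: "bounded_clinear F" and Pb: "bounded_clinear P"
      unfolding F_def P_def by (rule F.bounded_clinear_mult_op P.bounded_clinear_mult_op)+
    define E where "E = complex_of_real (exp (real n))"
    have \<psi>_eq: "\<psi> n z = E * (a z * \<phi> z)" if "cmod z < 1" for z
      unfolding \<psi>_def a_def \<phi>_def E_def herglotz_diff[OF that k(1) l(1)]
      by (simp add: exp_of_real[symmetric] flip: exp_add)
    have P_eq: "P h = E *\<^sub>C T (F h)" for h
      unfolding P_def
    proof (rule P.mult_op_eqI)
      fix z :: complex assume z: "cmod z < 1"
      show "hardy_eval (E *\<^sub>C T (F h)) z = \<psi> n z * hardy_eval h z"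
        by (simp add: T_def F_def hardy_eval_scaleC z T.hardy_eval_mult_op F.hardy_eval_mult_op
            scaleC_complex_def \<psi>_eq mult.assoc)
    qed
    have adj: "adjoint_op P h = E *\<^sub>C adjoint_op F (adjoint_op T h)" for h
    proof (rule cinner_eqI)
      show "cinner z (adjoint_op P h) = cinner z (E *\<^sub>C adjoint_op F (adjoint_op T h))" for z
        by (simp add: adjoint_exists[OF Pb, symmetric] cinner_scaleC_right adjoint_exists[OF Fb, symmetric]
            adjoint_exists[OF Tb, symmetric] P_eq cinner_scaleC_left) (simp add: E_def)
    qed
    obtain u where u: "u \<in> V" "R u = adjoint_op F (R (A (R x)))"
      unfolding F_def by (rule multiplier_action[OF V inv \<phi>_hol \<phi>_le A_x])
    have "R (E *\<^sub>C u) = adjoint_op P (R x)"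
      by (simp add: bounded_clinear_scaleC[OF bounded_R] u(2) A(1) adj)
    moreover have "E *\<^sub>C u \<in> V"
      using u(1) V(1) by (simp add: csubspace_def)
    moreover obtain y where y: "R y = adjoint_op P (R x)" "norm y \<le> norm x"
      unfolding P_def by (rule multiplier_action[OF csubspace_UNIV closed_UNIV UNIV_I \<psi>_hol \<psi>_le UNIV_I])
    moreover have "E *\<^sub>C u = y"
      using calculation R_inject[of "E *\<^sub>C u" y] by simp
    ultimately show ?thesis
      unfolding P_def by blast
  qed
  then obtain y where y: "\<And>n. y n \<in> V" "\<And>n. R (y n) = adjoint_op (mult_op (\<lambda>z x. \<psi> n z * x)) (R x)"
    "\<And>n. norm (y n) \<le> norm x"
    by metis
  define p where "p n = mult_op (\<lambda>z x. \<psi> n z * x) (hardy_const 1)" for n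
  have p_lim: "p \<longlonglongrightarrow> hardy_const 1"
  proof -
    have c1: "norm (hardy_const (1 :: complex)) = 1"
    proof -
      have "(norm (hardy_const (1 :: complex)))\<^sup>2 = 1"
        by (simp only: cinner_self_Re cinner_hardy_const) (simp add: hardy_const.rep_eq)
      then show ?thesis
        unfolding abs_square_eq_1 by simp
    qed
    have sq: "(norm (p n - hardy_const 1))\<^sup>2 \<le> 2 - 2 * Re (\<psi> n 0)" for n
    proof -
      interpret P: analytic_contraction "\<lambda>z x. \<psi> n z * x"
        by (rule analytic_contraction_scalar[OF \<psi>_hol \<psi>_le])
      have "(norm (p n))\<^sup>2 \<le> 1"
        unfolding p_def using P.norm_mult_op_le[of "hardy_const 1"] c1 by (simp add: power_le_one)
      moreover have "cinner (p n) (hardy_const 1) = \<psi> n 0"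
        unfolding cinner_hardy_const hardy_eval_0[symmetric] p_def
        using P.hardy_eval_mult_op[of 0 "hardy_const 1"] by (simp add: hardy_eval_const)
      ultimately show ?thesis
        unfolding norm_diff_sq by (simp add: c1)
    qed
    have "(\<lambda>n. \<psi> n 0) \<longlonglongrightarrow> exp (- 0)"
      unfolding \<psi>_def l_def by (intro tendsto_intros herglotz_truncation_tendsto k) simp
    then have "(\<lambda>n. 2 - 2 * Re (\<psi> n 0)) \<longlonglongrightarrow> 2 - 2 * Re (exp (- 0))"
      by (intro tendsto_intros)
    then have "(\<lambda>n. 2 - 2 * Re (\<psi> n 0)) \<longlonglongrightarrow> 0"
      by simp
    then have "(\<lambda>n. (norm (p n - hardy_const 1))\<^sup>2) \<longlonglongrightarrow> 0"
      by (rule Lim_null_comparison[rotated]) (simp add: sq)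
    then have "(\<lambda>n. norm (p n - hardy_const 1)) \<longlonglongrightarrow> 0"
      using tendsto_real_sqrt by fastforce
    then show ?thesis
      by (rule LIM_zero_cancel[OF tendsto_norm_zero_cancel])
  qed
  have "(\<lambda>n. hardy_coeff (R (y n)) j) \<longlonglongrightarrow> hardy_coeff (R x) j" for j
  proof -
    have "hardy_coeff (R (y n)) j = cinner ((backward_shift ^^ j) (R x)) (p n)" for n
      unfolding y(2) p_def
      by (rule hardy_coeff_adjoint_mult_op[OF analytic_contraction_scalar[OF \<psi>_hol \<psi>_le]])
    moreover have "hardy_coeff (R x) j = cinner ((backward_shift ^^ j) (R x)) (hardy_const 1)"
      by (simp add: cinner_hardy_const hardy_coeff_backward_shift_funpow)
    ultimately show ?thesis
      by (simp add: tendsto_cinner_right[OF p_lim])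
  qed
  from weak_limit[OF V y(1,3) this] R_inject show ?thesis
    by metis
qed

lemma range_norm_R: "range_norm R (R x) = norm x"
proof -
  have "orth_complement {k. R k = 0} = UNIV"
    by (auto simp: orth_complement_def dest!: injective)
  then show ?thesis
    by (simp add: range_norm_def R_inject)
qed

lemma range_norm_minus: "range_norm R (- y) = range_norm R y"
proof (cases "y \<in> range R")
  case True
  then obtain x where "y = R x"
    by blast
  then have "- y = R (- x)"
    using bounded_clinear_diff[OF bounded_R, of 0 x] bounded_clinear_zero[OF bounded_R] by simp
  then show ?thesis
    using \<open>y = R x\<close> by (simp only: range_norm_R norm_minus_cancel)
next
  case False
  then have "- y \<noteq> R x" for x
    using bounded_clinear_diff[OF bounded_R, of 0 x] bounded_clinear_zero[OF bounded_R]
    by (metis diff_0 minus_minus rangeI)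
  from this[symmetric] have "R x \<noteq> - y" "R x \<noteq> y" for x
    using False by auto
  then show ?thesis
    by (simp add: range_norm_def)
qed

lemma Metric_space_range: "Metric_space (range R) (\<lambda>x y. range_norm R (x - y))"
proof
  show "0 \<le> range_norm R (x - y)" for x y
    by (simp add: range_norm_def)
  show "range_norm R (x - y) = range_norm R (y - x)" for x y
    using range_norm_minus[of "x - y"] by simp
  show "range_norm R (x - y) = 0 \<longleftrightarrow> x = y" if "x \<in> range R" "y \<in> range R" for x y
    using that range_norm_R[of 0] bounded_clinear_zero[OF bounded_R]
    by (auto simp: range_norm_R R_inject simp flip: bounded_clinear_diff[OF bounded_R])
  show "range_norm R (x - z) \<le> range_norm R (x - y) + range_norm R (y - z)"
    if xyz: "x \<in> range R" "y \<in> range R" "z \<in> range R" for x y z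
  proof -
    obtain u v w where "x = R u" "y = R v" "z = R w"
      using xyz by blast
    then show ?thesis
      using norm_triangle_ineq[of "u - v" "v - w"]
      by (simp add: range_norm_R flip: bounded_clinear_diff[OF bounded_R])
  qed
qed

lemma closed_preimage:
  assumes M: "closedin (range_topology R) M"
  shows "closed {x. R x \<in> M}"
  unfolding closed_sequential_limits
proof (intro allI impI, elim conjE)
  interpret Metric_space "range R" "\<lambda>x y. range_norm R (x - y)"
    by (rule Metric_space_range)
  fix f x assume f: "\<forall>n. f n \<in> {x. R x \<in> M}" "f \<longlonglongrightarrow> x"
  show "x \<in> {x. R x \<in> M}"
  proof (rule ccontr)
    assume "x \<notin> {x. R x \<in> M}"
    then have "R x \<in> range R - M"
      by simp
    then obtain e where e: "e > 0" "disjnt M (mball (R x) e)"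
      using M unfolding range_topology_def closedin_metric by blast
    have "\<forall>\<^sub>F n in sequentially. dist (f n) x < e"
      using f(2) e(1) by (rule tendstoD)
    then obtain n where "dist (f n) x < e"
      using eventually_happens'[OF sequentially_bot] by blast
    then have "R (f n) \<in> mball (R x) e"
      by (simp add: range_norm_R dist_norm norm_minus_commute flip: bounded_clinear_diff[OF bounded_R])
    then show False
      using e(2) f(1) by (auto simp: disjnt_def)
  qed
qed

end

context analytic_contraction
begin

abbreviation T_star :: "complex hardy \<Rightarrow> 'd hardy" where
  "T_star \<equiv> adjoint_op (mult_op B)"

lemma selfadjoint_contraction_mult_op: "selfadjoint_contraction (\<lambda>f. mult_op B (T_star f))"
proof
  note bT = bounded_clinear_mult_op and bS = bounded_clinear_adjoint[OF bounded_clinear_mult_op]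
  have le: "norm (T_star f) \<le> norm f" for f
    using norm_adjoint_le[OF bT, of 1] norm_mult_op_le by simp
  show norm: "norm (mult_op B (T_star f)) \<le> norm f" for f
    by (rule order_trans[OF norm_mult_op_le le])
  show "bounded_clinear (\<lambda>f. mult_op B (T_star f))"
    by (rule bounded_clinearI[where K = 1])
      (simp_all add: bounded_clinear_add[OF bT] bounded_clinear_add[OF bS]
        bounded_clinear_scaleC[OF bT] bounded_clinear_scaleC[OF bS] norm)
  show "cinner (mult_op B (T_star f)) g = cinner f (mult_op B (T_star g))" for f g
    by (simp add: adjoint_exists[OF bT] adjoint_exists'[OF bT])
qed

lemma dBR_op_positive: "positive_op (dBR_op B)"
  and norm_dBR_op_sq: "(norm (dBR_op B f))\<^sup>2 = (norm f)\<^sup>2 - (norm (T_star f))\<^sup>2"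
proof -
  interpret S: selfadjoint_contraction "\<lambda>f. mult_op B (T_star f)"
    by (rule selfadjoint_contraction_mult_op)
  have eq: "dBR_op B = S.sqrt_root"
    unfolding dBR_op_def by (rule S.sqrt_op_eq)
  show pos: "positive_op (dBR_op B)"
    unfolding eq by (rule S.sqrt_root_positive)
  have "(norm (dBR_op B f))\<^sup>2 = Re (cinner (dBR_op B (dBR_op B f)) f)"
    by (simp only: cinner_self_Re positive_op_self_adjoint[OF pos])
  also have "\<dots> = Re (cinner f f) - Re (cinner (mult_op B (T_star f)) f)"
    by (simp add: eq S.sqrt_root_square cinner_diff_left)
  also have "\<dots> = (norm f)\<^sup>2 - (norm (T_star f))\<^sup>2"
    by (simp only: adjoint_exists[OF bounded_clinear_mult_op] cinner_self_Re)
  finally show "(norm (dBR_op B f))\<^sup>2 = (norm f)\<^sup>2 - (norm (T_star f))\<^sup>2" .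
qed

lemma norm_dBR_op_shift: "norm (dBR_op B (hardy_shift f)) \<le> norm (dBR_op B f)"
proof -
  have "T_star f = backward_shift (T_star (hardy_shift f))"
  proof (rule cinner_eqI)
    fix h
    have "cinner h (backward_shift (T_star (hardy_shift f))) = cinner (mult_op B (hardy_shift h)) (hardy_shift f)"
      by (simp only: cinner_hardy_shift[symmetric] adjoint_exists[OF bounded_clinear_mult_op])
    also have "\<dots> = cinner h (T_star f)"
      by (simp only: mult_op_shift cinner_hardy_shift backward_shift_shift adjoint_exists[OF bounded_clinear_mult_op])
    finally show "cinner h (T_star f) = cinner h (backward_shift (T_star (hardy_shift f)))" ..
  qed
  then have "norm (T_star f) \<le> norm (T_star (hardy_shift f))"
    by (metis norm_backward_shift_le)
  then have "(norm (dBR_op B (hardy_shift f)))\<^sup>2 \<le> (norm (dBR_op B f))\<^sup>2"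
    by (simp add: norm_dBR_op_sq power_mono)
  then show ?thesis
    by simp
qed

lemma norm_dBR_op_ge:
  assumes sep: "separable_space (euclidean :: 'd topology)"
    and k: "integrable circ k" "\<And>t. 0 \<le> k t"
    and ae: "AE t in circ. BB_star B (cis t) = 1 - exp (- 2 * k t)"
  shows "norm (mult_op (\<lambda>z x. exp (- herglotz k z) * x) f) \<le> norm (dBR_op B f)"
proof -
  define a where "a z = exp (- herglotz k z)" for z
  have a_hol: "a holomorphic_on ball 0 1"
    unfolding a_def by (intro holomorphic_intros holomorphic_herglotz k)
  have a_le: "cmod (a z) \<le> 1" if "cmod z < 1" for z
    using Re_herglotz_nonneg[OF that k] by (simp add: a_def norm_exp_eq_Re)
  interpret A: analytic_contraction "\<lambda>z x. a z * x"
    by (rule analytic_contraction_scalar[OF a_hol a_le])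
  have meas: "(\<lambda>t. exp (- 2 * k t)) \<in> borel_measurable circ"
    using borel_measurable_integrable[OF k(1)] by measurable
  have trunc: "norm (mult_op (\<lambda>z x. a z * x) (hardy_trunc N f)) \<le> norm (dBR_op B (hardy_trunc N f))" for N
  proof -
    define F where "F t = (cmod (hardy_eval (hardy_trunc N f) (cis t)))\<^sup>2" for t
    have F: "integrable circ F"
      unfolding F_def by (intro integrable_circ_continuous continuous_intros continuous_on_hardy_trunc_circle)
    have vF: "integrable circ (\<lambda>t. exp (- 2 * k t) * F t)"
    proof (rule Bochner_Integration.integrable_bound[OF F])
      show "AE t in circ. norm (exp (- 2 * k t) * F t) \<le> norm (F t)"
        using k(2) by (intro AE_I2) (simp add: abs_mult mult_left_le_one_le)
      show "(\<lambda>t. exp (- 2 * k t) * F t) \<in> borel_measurable circ"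
        using meas borel_measurable_integrable[OF F] by (rule borel_measurable_times)
    qed
    have "(norm (mult_op (\<lambda>z x. a z * x) (hardy_trunc N f)))\<^sup>2 \<le> circle_mean (\<lambda>t. exp (- 2 * k t) * F t)"
      using norm_mult_op_outer_le[OF k, of N f] by (simp add: a_def F_def)
    also have "\<dots> = circle_mean F - circle_mean (\<lambda>t. (1 - exp (- 2 * k t)) * F t)"
      unfolding left_diff_distrib mult_1_left by (simp only: circle_mean_diff[OF F vF])
    also have "circle_mean F = (norm (hardy_trunc N f))\<^sup>2"
      unfolding F_def by (rule circle_mean_hardy_trunc)
    also have "(norm (hardy_trunc N f))\<^sup>2 - circle_mean (\<lambda>t. (1 - exp (- 2 * k t)) * F t)
        \<le> (norm (hardy_trunc N f))\<^sup>2 - (norm (T_star (hardy_trunc N f)))\<^sup>2"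
      unfolding F_def
      by (intro diff_left_mono norm_adjoint_mult_op_le[OF sep _ ae] borel_measurable_diff borel_measurable_const meas)
    also have "\<dots> = (norm (dBR_op B (hardy_trunc N f)))\<^sup>2"
      by (rule norm_dBR_op_sq[symmetric])
    finally show ?thesis
      by simp
  qed
  have "norm (mult_op (\<lambda>z x. a z * x) f) \<le> norm (dBR_op B f)"
  proof (rule LIMSEQ_le)
    show "(\<lambda>N. norm (mult_op (\<lambda>z x. a z * x) (hardy_trunc N f))) \<longlonglongrightarrow> norm (mult_op (\<lambda>z x. a z * x) f)"
      by (intro tendsto_norm bounded_clinear_tendsto[OF A.bounded_clinear_mult_op] hardy_trunc_tendsto)
    show "(\<lambda>N. norm (dBR_op B (hardy_trunc N f))) \<longlonglongrightarrow> norm (dBR_op B f)"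
      by (intro tendsto_norm bounded_clinear_tendsto[OF positive_op_bounded[OF dBR_op_positive]] hardy_trunc_tendsto)
  qed (use trunc in blast)
  then show ?thesis
    by (simp add: a_def)
qed

lemma log_integrable_obtain:
  assumes sep: "separable_space (euclidean :: 'd topology)"
    and log: "log_integrable_on_circle (\<lambda>\<zeta>. 1 - BB_star B \<zeta>)"
  obtains k where "integrable circ k" "\<And>t. 0 \<le> k t" "AE t in circ. BB_star B (cis t) = 1 - exp (- 2 * k t)"
proof
  define k where "k t = max 0 (- ln (1 - BB_star B (cis t)) / 2)" for t
  have ln: "integrable circ (\<lambda>t. - ln (1 - BB_star B (cis t)) / 2)"
    using log by (simp add: log_integrable_on_circle_def)
  then show "integrable circ k"
    unfolding k_def by (intro Bochner_Integration.integrable_max) auto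
  show "0 \<le> k t" for t
    by (simp add: k_def)
  have "AE t in circ. 0 < 1 - BB_star B (cis t)"
    using log by (simp add: log_integrable_on_circle_def)
  with AE_boundary_value[OF sep] show "AE t in circ. BB_star B (cis t) = 1 - exp (- 2 * k t)"
  proof eventually_elim
    case (elim t)
    have "0 \<le> BB_star B (cis t)"
      using BB_star_bounds(1) elim(1) by blast
    then have "ln (1 - BB_star B (cis t)) \<le> 0"
      using elim(2) by simp
    then have "- 2 * k t = ln (1 - BB_star B (cis t))"
      by (simp add: k_def)
    then have "exp (- 2 * k t) = 1 - BB_star B (cis t)"
      using elim(2) by (simp only: exp_ln)
    then show ?case
      by simp
  qed
qed

end

theorem theoremB:
  fixes B :: "complex \<Rightarrow> 'd::complex_hilbert \<Rightarrow> complex"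
    and M :: "complex hardy set"
  assumes "separable_space (euclidean :: 'd topology)"
    and "B \<in> schur_class"
    and "log_integrable_on_circle (\<lambda>\<zeta>. 1 - BB_star B \<zeta>)"
    and "csubspace M"
    and "M \<subset> dBR_space B"
    and "closedin (dBR_topology B) M"
    and "\<And>f. f \<in> M \<Longrightarrow> backward_shift f \<in> M"
  shows "\<exists>\<theta>. inner_function \<theta> \<and> M = dBR_space B \<inter> model_space \<theta>"
proof -
  interpret analytic_contraction B
    by (rule schur_class_analytic_contraction[OF assms(2)])
  obtain k where k: "integrable circ k" "\<And>t. 0 \<le> k t" "AE t in circ. BB_star B (cis t) = 1 - exp (- 2 * k t)"
    using log_integrable_obtain[OF assms(1,3)] by metis
  define R where "R = dBR_op B"
  have dominated: "norm (mult_op (\<lambda>z x. exp (- herglotz k z) * x) f) \<le> norm (R f)" for f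
    unfolding R_def by (rule norm_dBR_op_ge[OF assms(1) k])
  interpret shift_range R
  proof
    show "bounded_clinear R"
      unfolding R_def by (rule positive_op_bounded[OF dBR_op_positive])
    show "cinner (R x) y = cinner x (R y)" for x y
      unfolding R_def by (rule positive_op_self_adjoint[OF dBR_op_positive])
    show "norm (R (hardy_shift h)) \<le> norm (R h)" for h
      unfolding R_def by (rule norm_dBR_op_shift)
    show "x = 0" if "R x = 0" for x
    proof (rule hardy_eval_inject)
      fix z :: complex assume z: "cmod z < 1"
      interpret A: analytic_contraction "\<lambda>z x. exp (- herglotz k z) * x"
        using Re_herglotz_nonneg[OF _ k(1,2)]
        by (intro analytic_contraction_scalar holomorphic_intros holomorphic_herglotz k)
          (simp add: norm_exp_eq_Re)
      have "mult_op (\<lambda>z x. exp (- herglotz k z) * x) x = 0"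
        using dominated[of x] that by simp
      then have "exp (- herglotz k z) * hardy_eval x z = hardy_eval 0 z"
        using A.hardy_eval_mult_op[OF z, of x] by simp
      moreover have "hardy_eval 0 z = (0 :: complex)"
        by (simp add: hardy_eval_def hardy_coeff_simps)
      ultimately show "hardy_eval x z = hardy_eval 0 z"
        by simp
    qed
  qed
  define V where "V = {x. R x \<in> M}"
  have M_range: "M \<subseteq> range R"
    using assms(5) by (auto simp: dBR_space_def R_def)
  then have RV: "R ` V = M"
    by (auto simp: V_def)
  have V: "csubspace V" "closed V"
  proof -
    show "csubspace V"
      using assms(4) unfolding csubspace_def V_def
      by (auto simp: bounded_clinear_zero[OF bounded_R] bounded_clinear_add[OF bounded_R] bounded_clinear_scaleC[OF bounded_R])
    show "closed V"
      unfolding V_def using assms(6) by (intro closed_preimage) (simp add: dBR_topology_def R_def)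
  qed
  have inv: "y \<in> V" if "x \<in> V" "R y = backward_shift (R x)" for x y
    using that assms(7) by (simp add: V_def)
  have mem: "f \<in> M" if f: "f \<in> dBR_space B" "f \<in> closure M" for f
  proof -
    obtain x where x: "f = R x"
      using f(1) by (auto simp: dBR_space_def R_def)
    have "x \<in> V"
      by (rule closed_invariant_subspace[OF k(1,2) dominated V inv]) (use f(2) in \<open>simp_all add: RV x\<close>)
    then show ?thesis
      by (simp add: V_def x)
  qed
  have "backward_shift f \<in> closure M" if f: "f \<in> closure M" for f
  proof -
    obtain g where g: "\<And>n. g n \<in> M" "g \<longlonglongrightarrow> f"
      using f by (auto simp: closure_sequential)
    have "(\<lambda>n. backward_shift (g n)) \<longlonglongrightarrow> backward_shift f"
      by (rule bounded_clinear_tendsto[OF bounded_clinear_backward_shift g(2)])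
    then show ?thesis
      unfolding closure_sequential using g(1) assms(7) by (intro exI[of _ "\<lambda>n. backward_shift (g n)"]) simp
  qed
  moreover have "closure M \<noteq> UNIV"
    using mem assms(5) by blast
  ultimately obtain \<theta> where \<theta>: "inner_function \<theta>" "closure M = model_space \<theta>"
    using backward_shift_invariant_model_space[OF csubspace_closure[OF assms(4)] closed_closure] by metis
  have "M = dBR_space B \<inter> closure M"
    using mem assms(5) closure_subset by blast
  then show ?thesis
    using \<theta> by auto
qed

end
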